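(* Suppose that $\phi$ is an essentially linear fractional selfmap of $\mathbb{U}$ fixing $1$. Suppose that $\phi'(1) > 1$, so that the Denjoy-Wolff point $\omega$ of $\phi$ lies in $\mathbb{U}$. Let $N$ be the least positive integer for which $|\phi'(\omega)|^N \le \phi'(1)^{-1/2}$. Then, for the composition operator $C_\phi: H^2(\mathbb{U})\to H^2(\mathbb{U})$, $$\mathrm{Sp}(C_\phi) = \{z: |z| \le \phi'(1)^{-1/2}\} \cup \{\phi'(\omega)^n: n = 0,\ldots, N-1\}$$ and $$\mathrm{Sp}_e(C_\phi) = \{z: |z| \le \phi'(1)^{-1/2}\}.$$
   Context: $\mathbb{U}$ is the open unit disc in $\mathbb{C}$ and $H^2(\mathbb{U})$ is the classical Hardy space of analytic functions on $\mathbb{U}$ with square-summable Maclaurin coefficients. An (analytic) selfmap of $\mathbb{U}$ is an analytic function $\phi$ on $\mathbb{U}$ with $\phi(\mathbb{U})\subseteq\mathbb{U}$; $C_\phi f = f\circ\phi$ is the composition operator, which is bounded on $H^2(\mathbb{U})$. For a bounded operator $T$ on a Hilbert space, $\mathrm{Sp}(T)$ is its spectrum and $\mathrm{Sp}_e(T)$ is its essential spectrum, $\{\lambda : T-\lambda I \text{ is not Fredholm}\}$. A selfmap $\phi$ is essentially linear fractional if there is $\eta\in\partial\mathbb{U}$ such that: (a) $\phi(\mathbb{U})$ is contained in a proper subdisc of $\mathbb{U}$ internally tangent to the unit circle at $\eta$; (b) the set $\phi^{-1}(\{\eta\}) := \{\zeta\in\partial\mathbb{U} : \eta \text{ belongs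 to the cluster set of } \phi \text{ at } \zeta\}$ consists of exactly one element, say $\zeta_0$; (c) $\phi'''$ extends continuously to $\mathbb{U}\cup\{\zeta_0\}$. Consequently $\phi,\phi',\phi''$ also extend continuously to $\zeta_0$, and values at $\zeta_0$ denote values of these extensions. If $\phi$ fixes the boundary point $1$, then $\eta=\zeta_0=1$. Denjoy-Wolff point: if $\phi$ is not an elliptic automorphism of $\mathbb{U}$, there is a unique $\omega$ in the closed disc with $\phi^{[n]}(z)\to\omega$ for each $z\in\mathbb{U}$, where $\phi^{[n]}$ is the $n$-th iterate; it is the Denjoy-Wolff point. If $|\omega|<1$ then $\phi(\omega)=\omega$ and $|\phi'(\omega)|<1$. Convention: $\phi'(\omega)^0=1$. *)

theory Defs
  imports "HOL-Complex_Analysis.Complex_Analysis"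
begin

class scaleC =
  fixes scaleC :: "complex \<Rightarrow> 'a \<Rightarrow> 'a"  (infixr "*\<^sub>C" 75)

class complex_normed_vector = real_normed_vector + scaleC +
  assumes scaleC_add_right: "a *\<^sub>C (x + y) = a *\<^sub>C x + a *\<^sub>C y"
    and scaleC_add_left: "(a + b) *\<^sub>C x = a *\<^sub>C x + b *\<^sub>C x"
    and scaleC_scaleC: "a *\<^sub>C (b *\<^sub>C x) = (a * b) *\<^sub>C x"
    and scaleC_one: "1 *\<^sub>C x = x"
    and scaleR_scaleC: "r *\<^sub>R x = complex_of_real r *\<^sub>C x"
    and norm_scaleC: "norm (a *\<^sub>C x) = cmod a * norm x"

interpretation complex_vs:
  vector_space "scaleC :: complex \<Rightarrow> 'a \<Rightarrow> 'a::complex_normed_vector"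
  by unfold_locales (rule scaleC_add_right scaleC_add_left scaleC_scaleC scaleC_one)+

definition bounded_clinear :: "('a::complex_normed_vector \<Rightarrow> 'b::complex_normed_vector) \<Rightarrow> bool"
  where "bounded_clinear T \<longleftrightarrow> bounded_linear T \<and> (\<forall>c x. T (c *\<^sub>C x) = c *\<^sub>C T x)"

definition invertible_operator :: "('a::complex_normed_vector \<Rightarrow> 'a) \<Rightarrow> bool"
  where "invertible_operator T \<longleftrightarrow> bounded_clinear T \<and>
    (\<exists>S. bounded_clinear S \<and> S \<circ> T = id \<and> T \<circ> S = id)"

text \<open>In \<open>fredholm\<close>, kernel and cokernel are finite-dimensional over the complex numbers.\<close>

definition fredholm :: "('a::complex_normed_vector \<Rightarrow> 'a) \<Rightarrow> bool"
  where "fredholm T \<longleftrightarrow> bounded_clinear T \<and>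
    (\<exists>B. finite B \<and> {x. T x = 0} \<subseteq> complex_vs.span B) \<and>
    closed (range T) \<and>
    (\<exists>B. finite B \<and> complex_vs.span (range T \<union> B) = UNIV)"

definition spectrum :: "('a::complex_normed_vector \<Rightarrow> 'a) \<Rightarrow> complex set"
  where "spectrum T = {\<mu>. \<not> invertible_operator (\<lambda>x. T x - \<mu> *\<^sub>C x)}"

definition essential_spectrum :: "('a::complex_normed_vector \<Rightarrow> 'a) \<Rightarrow> complex set"
  where "essential_spectrum T = {\<mu>. \<not> fredholm (\<lambda>x. T x - \<mu> *\<^sub>C x)}"

abbreviation unit_disc :: "complex set"
  where "unit_disc \<equiv> ball 0 1"

definition maclaurin_coeff :: "(complex \<Rightarrow> complex) \<Rightarrow> nat \<Rightarrow> complex"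
  where "maclaurin_coeff f n = (deriv ^^ n) f 0 / fact n"

text \<open>
  Elements of the Hardy space are functions on the disc.  Each is represented by its extension
  by zero to the whole plane, so that equality of representatives is equality on the disc.
\<close>

typedef hardy2 = "{f :: complex \<Rightarrow> complex. f holomorphic_on unit_disc \<and>
    (\<forall>z. z \<notin> unit_disc \<longrightarrow> f z = 0) \<and> summable (\<lambda>n. (cmod (maclaurin_coeff f n))\<^sup>2)}"
  morphisms hardy2_fun Abs_hardy2
  by (rule exI[of _ "\<lambda>_. 0"]) (auto simp: maclaurin_coeff_def)

setup_lifting type_definition_hardy2

lemma maclaurin_coeff_zero: "maclaurin_coeff (\<lambda>z. 0) n = 0"
  by (simp add: maclaurin_coeff_def)

lemma maclaurin_coeff_add:
  assumes "f holomorphic_on unit_disc" "g holomorphic_on unit_disc"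
  shows "maclaurin_coeff (\<lambda>z. f z + g z) n = maclaurin_coeff f n + maclaurin_coeff g n"
  using higher_deriv_add[OF assms, of 0 n] by (simp add: maclaurin_coeff_def add_divide_distrib)

lemma maclaurin_coeff_diff:
  assumes "f holomorphic_on unit_disc" "g holomorphic_on unit_disc"
  shows "maclaurin_coeff (\<lambda>z. f z - g z) n = maclaurin_coeff f n - maclaurin_coeff g n"
  using higher_deriv_diff[OF assms, of 0 n] by (simp add: maclaurin_coeff_def diff_divide_distrib)

lemma maclaurin_coeff_cmult:
  assumes "f holomorphic_on unit_disc"
  shows "maclaurin_coeff (\<lambda>z. c * f z) n = c * maclaurin_coeff f n"
  using higher_deriv_cmult[OF assms, of 0 n c] by (simp add: maclaurin_coeff_def)

lemma norm_add_square_le: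
  fixes x y :: "'a::real_normed_vector"
  shows "(norm (x + y))\<^sup>2 \<le> 2 * (norm x)\<^sup>2 + 2 * (norm y)\<^sup>2"
proof -
  have "(norm (x + y))\<^sup>2 \<le> (norm x + norm y)\<^sup>2"
    by (intro power_mono norm_triangle_ineq) auto
  also have "\<dots> \<le> 2 * (norm x)\<^sup>2 + 2 * (norm y)\<^sup>2"
    using zero_le_power2[of "norm x - norm y"] by (simp add: power2_eq_square algebra_simps)
  finally show ?thesis .
qed

lemma summable_square_add:
  fixes a b :: "nat \<Rightarrow> complex"
  assumes "summable (\<lambda>n. (cmod (a n))\<^sup>2)" "summable (\<lambda>n. (cmod (b n))\<^sup>2)"
  shows "summable (\<lambda>n. (cmod (a n + b n))\<^sup>2)"
proof (rule summable_comparison_test')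
  show "summable (\<lambda>n. 2 * (cmod (a n))\<^sup>2 + 2 * (cmod (b n))\<^sup>2)"
    by (intro summable_add summable_mult assms)
  show "norm ((cmod (a n + b n))\<^sup>2) \<le> 2 * (cmod (a n))\<^sup>2 + 2 * (cmod (b n))\<^sup>2" if "n \<ge> 0" for n
    using norm_add_square_le[of "a n" "b n"] by simp
qed

lemma summable_square_cmult:
  fixes a :: "nat \<Rightarrow> complex"
  assumes "summable (\<lambda>n. (cmod (a n))\<^sup>2)"
  shows "summable (\<lambda>n. (cmod (c * a n))\<^sup>2)"
  by (simp add: norm_mult power_mult_distrib assms summable_mult)

instantiation hardy2 :: ab_group_add
begin

lift_definition zero_hardy2 :: hardy2 is "\<lambda>z. 0"
  by (auto simp: maclaurin_coeff_zero)

lift_definition plus_hardy2 :: "hardy2 \<Rightarrow> hardy2 \<Rightarrow> hardy2" is "\<lambda>f g z. f z + g z"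
  by (auto intro!: holomorphic_intros simp: maclaurin_coeff_add summable_square_add)

lift_definition uminus_hardy2 :: "hardy2 \<Rightarrow> hardy2" is "\<lambda>f z. - f z"
  subgoal for f
    using maclaurin_coeff_cmult[of f "-1"] by (auto intro!: holomorphic_intros)
  done

lift_definition minus_hardy2 :: "hardy2 \<Rightarrow> hardy2 \<Rightarrow> hardy2" is "\<lambda>f g z. f z - g z"
  subgoal for f g
    using summable_square_add[of "maclaurin_coeff f" "\<lambda>n. - maclaurin_coeff g n"]
    by (auto intro!: holomorphic_intros simp: maclaurin_coeff_diff)
  done

instance
  by standard (transfer; simp add: algebra_simps)+

end

instantiation hardy2 :: "{scaleC, real_vector}"
begin

lift_definition scaleC_hardy2 :: "complex \<Rightarrow> hardy2 \<Rightarrow> hardy2" is "\<lambda>c f z. c * f z"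
  by (auto intro!: holomorphic_intros simp: maclaurin_coeff_cmult summable_square_cmult)

definition scaleR_hardy2 :: "real \<Rightarrow> hardy2 \<Rightarrow> hardy2"
  where "scaleR_hardy2 r f = complex_of_real r *\<^sub>C f"

instance
  by standard (unfold scaleR_hardy2_def, (transfer; simp add: algebra_simps)+)

end

definition hardy2_coeff :: "hardy2 \<Rightarrow> nat \<Rightarrow> complex"
  where "hardy2_coeff f = maclaurin_coeff (hardy2_fun f)"

lemma summable_hardy2_coeff: "summable (\<lambda>n. (cmod (hardy2_coeff f n))\<^sup>2)"
  unfolding hardy2_coeff_def by transfer auto

lemma hardy2_coeff_zero: "hardy2_coeff 0 n = 0"
  unfolding hardy2_coeff_def by transfer (simp add: maclaurin_coeff_zero)

lemma hardy2_coeff_add: "hardy2_coeff (f + g) n = hardy2_coeff f n + hardy2_coeff g n"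
  unfolding hardy2_coeff_def by transfer (simp add: maclaurin_coeff_add)

lemma hardy2_coeff_scaleC: "hardy2_coeff (c *\<^sub>C f) n = c * hardy2_coeff f n"
  unfolding hardy2_coeff_def by transfer (simp add: maclaurin_coeff_cmult)

lemma hardy2_coeff_scaleR: "hardy2_coeff (r *\<^sub>R f) n = r *\<^sub>R hardy2_coeff f n"
  by (simp add: scaleR_hardy2_def hardy2_coeff_scaleC scaleR_conv_of_real)

lemma hardy2_eqI0:
  assumes "\<And>n. hardy2_coeff f n = 0"
  shows "f = 0"
  using assms unfolding hardy2_coeff_def
proof transfer
  fix f :: "complex \<Rightarrow> complex"
  assume f: "f holomorphic_on unit_disc \<and> (\<forall>z. z \<notin> unit_disc \<longrightarrow> f z = 0) \<and>
      summable (\<lambda>n. (cmod (maclaurin_coeff f n))\<^sup>2)"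
    and 0: "\<And>n. maclaurin_coeff f n = 0"
  have "f z = 0" for z
    using holomorphic_fun_eq_0_on_ball[of f 0 1 z] f 0
    by (cases "z \<in> unit_disc") (auto simp: maclaurin_coeff_def)
  then show "f = (\<lambda>z. 0)" by auto
qed

lemma summable_hardy2_inner: "summable (\<lambda>n. inner (hardy2_coeff f n) (hardy2_coeff g n))"
proof (rule summable_comparison_test')
  show "summable (\<lambda>n. (cmod (hardy2_coeff f n))\<^sup>2 + (cmod (hardy2_coeff g n))\<^sup>2)"
    by (intro summable_add summable_hardy2_coeff)
  show "norm (inner (hardy2_coeff f n) (hardy2_coeff g n)) \<le>
      (cmod (hardy2_coeff f n))\<^sup>2 + (cmod (hardy2_coeff g n))\<^sup>2" if "n \<ge> 0" for n
  proof -
    have "norm (inner (hardy2_coeff f n) (hardy2_coeff g n)) \<le>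
        cmod (hardy2_coeff f n) * cmod (hardy2_coeff g n)"
      by (simp add: Cauchy_Schwarz_ineq2)
    also have "\<dots> \<le> (cmod (hardy2_coeff f n))\<^sup>2 + (cmod (hardy2_coeff g n))\<^sup>2"
      using sum_squares_bound[of "cmod (hardy2_coeff f n)" "cmod (hardy2_coeff g n)"]
        mult_nonneg_nonneg[OF norm_ge_zero[of "hardy2_coeff f n"] norm_ge_zero[of "hardy2_coeff g n"]]
      by linarith
    finally show ?thesis .
  qed
qed

text \<open>
  The real inner product is the real part of the complex inner product
  \<open>\<Sum>n. a\<^sub>n * cnj b\<^sub>n\<close>; both induce the norm \<open>norm_hardy2\<close>.
\<close>

instantiation hardy2 :: real_inner
begin

definition inner_hardy2 :: "hardy2 \<Rightarrow> hardy2 \<Rightarrow> real"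
  where "inner_hardy2 f g = (\<Sum>n. inner (hardy2_coeff f n) (hardy2_coeff g n))"

definition norm_hardy2 :: "hardy2 \<Rightarrow> real"
  where "norm_hardy2 f = sqrt (\<Sum>n. (cmod (hardy2_coeff f n))\<^sup>2)"

definition dist_hardy2 :: "hardy2 \<Rightarrow> hardy2 \<Rightarrow> real"
  where "dist_hardy2 f g = norm (f - g)"

definition sgn_hardy2 :: "hardy2 \<Rightarrow> hardy2"
  where "sgn_hardy2 f = f /\<^sub>R norm f"

definition uniformity_hardy2 :: "(hardy2 \<times> hardy2) filter"
  where "uniformity_hardy2 = (INF e\<in>{0 <..}. principal {(f, g). dist f g < e})"

definition open_hardy2 :: "hardy2 set \<Rightarrow> bool"
  where "open_hardy2 U \<longleftrightarrow> (\<forall>x\<in>U. eventually (\<lambda>(x', y). x' = x \<longrightarrow> y \<in> U) uniformity)"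

instance
proof
  fix f g h :: hardy2 and r :: real and U :: "hardy2 set"
  show "dist f g = norm (f - g)" by (rule dist_hardy2_def)
  show "sgn f = f /\<^sub>R norm f" by (rule sgn_hardy2_def)
  show "(uniformity :: (hardy2 \<times> hardy2) filter) = (INF e\<in>{0 <..}. principal {(f, g). dist f g < e})"
    by (rule uniformity_hardy2_def)
  show "open U \<longleftrightarrow> (\<forall>x\<in>U. eventually (\<lambda>(x', y). x' = x \<longrightarrow> y \<in> U) uniformity)"
    by (rule open_hardy2_def)
  show "inner f g = inner g f"
    by (simp add: inner_hardy2_def inner_commute)
  show "inner (f + g) h = inner f h + inner g h"
    by (simp add: inner_hardy2_def hardy2_coeff_add inner_add_left suminf_add summable_hardy2_inner)
  show "inner (r *\<^sub>R f) g = r * inner f g"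
    by (simp add: inner_hardy2_def hardy2_coeff_scaleR suminf_mult summable_hardy2_inner)
  show "0 \<le> inner f f"
    unfolding inner_hardy2_def by (intro suminf_nonneg summable_hardy2_inner) simp
  show "norm f = sqrt (inner f f)"
    by (simp add: norm_hardy2_def inner_hardy2_def power2_norm_eq_inner)
  show "inner f f = 0 \<longleftrightarrow> f = 0"
  proof
    assume "inner f f = 0"
    then have "\<forall>n. inner (hardy2_coeff f n) (hardy2_coeff f n) = 0"
      unfolding inner_hardy2_def
      using suminf_eq_zero_iff[OF summable_hardy2_inner[of f f]] by simp
    then show "f = 0" by (intro hardy2_eqI0) simp
  qed (simp add: inner_hardy2_def hardy2_coeff_zero)
qed

end

instance hardy2 :: complex_normed_vector
proof
  fix f g :: hardy2 and a b :: complex and r :: real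
  show "a *\<^sub>C (f + g) = a *\<^sub>C f + a *\<^sub>C g" by transfer (simp add: algebra_simps)
  show "(a + b) *\<^sub>C f = a *\<^sub>C f + b *\<^sub>C f" by transfer (simp add: algebra_simps)
  show "a *\<^sub>C (b *\<^sub>C f) = (a * b) *\<^sub>C f" by transfer (simp add: algebra_simps)
  show "1 *\<^sub>C f = f" by transfer simp
  show "r *\<^sub>R f = complex_of_real r *\<^sub>C f" by (rule scaleR_hardy2_def)
  show "norm (a *\<^sub>C f) = cmod a * norm f"
    by (simp add: norm_hardy2_def hardy2_coeff_scaleC norm_mult power_mult_distrib
        suminf_mult summable_hardy2_coeff real_sqrt_mult)
qed

definition selfmap :: "(complex \<Rightarrow> complex) \<Rightarrow> bool"
  where "selfmap \<phi> \<longleftrightarrow> \<phi> holomorphic_on unit_disc \<and> \<phi> ` unit_disc \<subseteq> unit_disc"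

text \<open>
  For a selfmap \<open>\<phi>\<close>, the function described below exists in the Hardy space by Littlewood's
  subordination theorem, and it is unique because elements of \<open>hardy2\<close> are determined by their
  values on the disc.
\<close>

definition composition_operator :: "(complex \<Rightarrow> complex) \<Rightarrow> hardy2 \<Rightarrow> hardy2"
  where "composition_operator \<phi> f =
    (THE g. \<forall>z\<in>unit_disc. hardy2_fun g z = hardy2_fun f (\<phi> z))"

definition cluster_set :: "(complex \<Rightarrow> complex) \<Rightarrow> complex \<Rightarrow> complex set"
  where "cluster_set \<phi> \<zeta> = {w. \<exists>z :: nat \<Rightarrow> complex.
    (\<forall>n. z n \<in> unit_disc) \<and> z \<longlonglongrightarrow> \<zeta> \<and> (\<lambda>n. \<phi> (z n)) \<longlonglongrightarrow> w}"

definition extends_continuously_to :: "(complex \<Rightarrow> complex) \<Rightarrow> complex \<Rightarrow> bool"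
  where "extends_continuously_to f \<zeta> \<longleftrightarrow>
    (\<exists>g. continuous_on (insert \<zeta> unit_disc) g \<and> (\<forall>z\<in>unit_disc. g z = f z))"

text \<open>
  The radius condition excludes a degenerate disc; the condition on the circles says that they
  touch at \<open>\<eta>\<close> and nowhere else.
\<close>

definition internally_tangent_disc :: "complex \<Rightarrow> complex set \<Rightarrow> bool"
  where "internally_tangent_disc \<eta> D \<longleftrightarrow>
    (\<exists>c r. 0 < r \<and> D = ball c r \<and> D \<subset> unit_disc \<and> sphere c r \<inter> sphere 0 1 = {\<eta>})"

definition essentially_linear_fractional :: "(complex \<Rightarrow> complex) \<Rightarrow> bool"
  where "essentially_linear_fractional \<phi> \<longleftrightarrow> selfmap \<phi> \<and>
    (\<exists>\<eta>\<in>sphere 0 1.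
      (\<exists>D. internally_tangent_disc \<eta> D \<and> \<phi> ` unit_disc \<subseteq> D) \<and>
      (\<exists>\<zeta>\<^sub>0. {\<zeta>\<in>sphere 0 1. \<eta> \<in> cluster_set \<phi> \<zeta>} = {\<zeta>\<^sub>0} \<and>
        extends_continuously_to ((deriv ^^ 3) \<phi>) \<zeta>\<^sub>0))"

text \<open>
  The values \<open>\<phi>(\<zeta>)\<close> and \<open>\<phi>'(\<zeta>)\<close> at a boundary point \<open>\<zeta>\<close> are those of the continuous extensions of
  \<open>\<phi>\<close> and \<open>deriv \<phi>\<close> from the disc, i.e. limits from within the disc; the values that the HOL
  functions \<open>\<phi>\<close> and \<open>deriv \<phi>\<close> happen to take outside the disc play no role.
\<close>

definition has_boundary_value :: "(complex \<Rightarrow> complex) \<Rightarrow> complex \<Rightarrow> complex \<Rightarrow> bool"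
  where "has_boundary_value f \<zeta> l \<longleftrightarrow> (f \<longlongrightarrow> l) (at \<zeta> within unit_disc)"

definition denjoy_wolff_point :: "(complex \<Rightarrow> complex) \<Rightarrow> complex \<Rightarrow> bool"
  where "denjoy_wolff_point \<phi> \<omega> \<longleftrightarrow>
    \<omega> \<in> cball 0 1 \<and> (\<forall>z\<in>unit_disc. (\<lambda>n. (\<phi> ^^ n) z) \<longlonglongrightarrow> \<omega>)"

end

theory Submission
  imports Defs
begin

text \<open>
  Matching \<open>\<phi>\<close> to second order at \<open>1\<close> by a linear fractional map \<open>\<psi>\<close> makes \<open>f \<circ> \<phi> - u * (f \<circ> \<psi>)\<close>
  bounded pointwise by a multiple of the norm of \<open>f\<close>, and uniformly small away from \<open>1\<close> when many
  Maclaurin coefficients of \<open>f\<close> vanish; here \<open>u\<close> is a weight for which \<open>f \<mapsto> u * (f \<circ> \<psi>)\<close> has norm at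
  most \<open>d\<^bsup>-1/2\<^esup>\<close>.  So, up to operators of small norm and of finite rank, the composition operator
  has norm at most \<open>d\<^bsup>-1/2\<^esup>\<close>, and outside the disc of this radius only eigenvalues can occur.  An
  eigenfunction vanishing to order \<open>n\<close> at \<open>\<omega>\<close> has eigenvalue \<open>\<phi>'(\<omega>)\<^sup>n\<close>.

  For \<open>0 < \<bar>\<mu>\<bar> < d\<^bsup>-1/2\<^esup>\<close>, summing \<open>\<mu>\<^bsup>-k\<^esup> f(z\<^sub>k)\<close> over a two-sided orbit \<open>z\<^sub>k\<^sub>+\<^sub>1 = \<phi>(z\<^sub>k)\<close> that leaves \<open>1\<close>
  and tends to \<open>\<omega>\<close> gives a functional that annihilates the range of the operator minus \<open>\<mu>\<close> on the
  functions vanishing to high order at \<open>\<omega>\<close>.  Different orbits give independent functionals, so this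
  range has infinite codimension; the remaining points of the disc follow because finite
  codimension is stable under small perturbations.
\<close>

section \<open>Closed ranges and perturbations in Banach spaces\<close>

text \<open>The estimates rest on a balance of exponents. With \<open>t = 1 - z\<close>, the tangent
  disc gives \<open>1 - |\<phi> z|^2\<close> at least a multiple of \<open>|t|^2\<close>. Point
  evaluation at depth \<open>h\<close> costs \<open>h^(-1/2)\<close> and its variation costs
  \<open>h^(-3/2)\<close>, that is \<open>|t|^(-3)\<close>, which is just cancelled by the
  third-order error left by the matching. A weight equal to \<open>1\<close> up to
  \<open>O(t)\<close> is paid for by the factor \<open>1 / |t|\<close> of evaluation, so the weight
  may be chosen to make the model operator easy. The model must also map into a smaller tangent
  disc; this is a strict inequality for the second-order coefficient, read off by approaching
  \<open>1\<close> along a horocycle. The same exponent bounds the disc from inside. A backward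
  orbit approaches \<open>1\<close> non-tangentially, so its depth is of order
  \<open>d^(-k)\<close>, evaluation grows like \<open>d^(k/2)\<close>, and the weights
  \<open>\<mu>^k\<close> sum as soon as \<open>|\<mu>| * sqrt d < 1\<close>. On the forward half the
  weights grow, and only a zero of high order at \<open>\<omega>\<close> makes the series converge;
  working with Taylor remainders at \<open>\<omega>\<close> turns the sums into functionals on the
  whole space.\<close>

lemma scaleC_zero_left [simp]: "0 *\<^sub>C (x::'a::complex_normed_vector) = 0"
  by (rule complex_vs.scale_zero_left)

lemma scaleC_zero_right [simp]: "c *\<^sub>C (0::'a::complex_normed_vector) = 0"
  by (rule complex_vs.scale_zero_right)

lemma bounded_linear_scaleC_left: "bounded_linear (\<lambda>c. c *\<^sub>C (x::'a::complex_normed_vector))"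
proof (rule bounded_linear_intro[where K="norm x"])
  fix r c
  show "(r *\<^sub>R c) *\<^sub>C x = r *\<^sub>R (c *\<^sub>C x)"
    by (simp add: scaleR_scaleC scaleC_scaleC scaleR_conv_of_real)
qed (auto simp: scaleC_add_left norm_scaleC)

lemma bounded_linear_scaleC_right: "bounded_linear (\<lambda>x::'a::complex_normed_vector. c *\<^sub>C x)"
proof (rule bounded_linear_intro[where K="cmod c"])
  fix r :: real and x :: 'a
  show "c *\<^sub>C (r *\<^sub>R x) = r *\<^sub>R (c *\<^sub>C x)"
    by (simp add: scaleR_scaleC scaleC_scaleC mult.commute)
qed (auto simp: scaleC_add_right norm_scaleC mult.commute)

lemma bounded_clinearI:
  assumes "\<And>x y. T (x + y) = T x + T y" "\<And>c x. T (c *\<^sub>C x) = c *\<^sub>C T x"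
    and "\<And>x. norm (T x) \<le> K * norm x"
  shows "bounded_clinear T"
  unfolding bounded_clinear_def
proof (intro conjI allI)
  show "bounded_linear T"
    by (rule bounded_linear_intro[where K=K]) (auto simp: assms scaleR_scaleC mult.commute)
qed (rule assms)

lemma bounded_clinearD:
  assumes "bounded_clinear T"
  shows "bounded_linear T" "T (c *\<^sub>C x) = c *\<^sub>C T x" "T (x + y) = T x + T y"
    "T (x - y) = T x - T y" "T 0 = 0"
  using assms by (auto simp: bounded_clinear_def linear_simps)

lemma module_hom_bounded_clinear: "bounded_clinear T \<Longrightarrow> module_hom scaleC scaleC T"
  by (simp add: module_hom_iff bounded_clinearD(2,3) complex_vs.module_axioms)

lemma bounded_clinear_shift:
  assumes "bounded_clinear T"
  shows "bounded_clinear (\<lambda>x. T x - c *\<^sub>C x)"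
  unfolding bounded_clinear_def
proof (intro conjI allI)
  show "bounded_linear (\<lambda>x. T x - c *\<^sub>C x)"
    by (intro bounded_linear_sub bounded_clinearD(1)[OF assms] bounded_linear_scaleC_right)
  show "T (a *\<^sub>C x) - c *\<^sub>C a *\<^sub>C x = a *\<^sub>C (T x - c *\<^sub>C x)" for a x
    by (simp add: bounded_clinearD(2)[OF assms] complex_vs.scale_right_diff_distrib
        scaleC_scaleC mult.commute)
qed

lemma subspace_range: "bounded_clinear T \<Longrightarrow> complex_vs.subspace (range T)"
  by (rule module_hom.subspace_image[OF module_hom_bounded_clinear]) simp_all

lemma in_span_range_Un:
  assumes "bounded_clinear T"
  shows "y \<in> complex_vs.span (range T \<union> B) \<longleftrightarrow> (\<exists>x. y - T x \<in> complex_vs.span B)"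
proof -
  have "complex_vs.span (range T) = range T"
    using complex_vs.span_eq_iff[THEN iffD2] subspace_range[OF assms] by blast
  note rg = this
  have "y \<in> complex_vs.span (range T \<union> B) \<longleftrightarrow> (\<exists>x b. y = T x + b \<and> b \<in> complex_vs.span B)"
    unfolding complex_vs.span_Un rg by auto
  also have "\<dots> \<longleftrightarrow> (\<exists>x. y - T x \<in> complex_vs.span B)"
    by (metis add_diff_cancel_left' diff_add_cancel add.commute)
  finally show ?thesis .
qed

text \<open>The coefficient of \<open>v\<close> is at most the norm divided by the distance from
  \<open>v\<close> to the closed span of \<open>S\<close>. Along a convergent sequence the
  coefficients are therefore Cauchy, and the two components converge separately.\<close>

lemma closed_span_insert:
  fixes S :: "'a::complex_normed_vector set"
  assumes cl: "closed (complex_vs.span S)"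
  shows "closed (complex_vs.span (insert v S))"
proof (cases "v \<in> complex_vs.span S")
  case True
  then show ?thesis using cl by (simp add: complex_vs.span_redundant)
next
  case False
  let ?Y = "complex_vs.span S"
  have ne: "?Y \<noteq> {}" using complex_vs.span_zero by blast
  define \<delta> where "\<delta> = infdist v ?Y"
  have \<delta>: "\<delta> > 0"
    using False in_closed_iff_infdist_zero[OF cl ne, of v] infdist_nonneg[of v ?Y]
    by (auto simp: \<delta>_def)
  have lower: "cmod c * \<delta> \<le> norm (y + c *\<^sub>C v)" if y: "y \<in> ?Y" for y c
  proof (cases "c = 0")
    case False
    have "- ((1/c) *\<^sub>C y) \<in> ?Y"
      using y by (intro complex_vs.span_neg complex_vs.span_scale)
    then have "\<delta> \<le> dist v (- ((1/c) *\<^sub>C y))"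
      unfolding \<delta>_def by (rule infdist_le)
    then have "cmod c * \<delta> \<le> norm (c *\<^sub>C (v + (1/c) *\<^sub>C y))"
      by (simp add: dist_norm norm_scaleC mult_left_mono)
    also have "c *\<^sub>C (v + (1/c) *\<^sub>C y) = y + c *\<^sub>C v"
      using False by (simp add: scaleC_add_right scaleC_scaleC scaleC_one)
    finally show ?thesis .
  qed simp
  show ?thesis
    unfolding closed_sequential_limits
  proof (intro allI impI, elim conjE)
    fix x l assume x: "\<forall>n. x n \<in> complex_vs.span (insert v S)" and lim: "x \<longlonglongrightarrow> l"
    obtain k where k: "\<And>n. x n - k n *\<^sub>C v \<in> ?Y"
      using x unfolding complex_vs.span_breakdown_eq by metis
    have kd: "cmod (k m - k n) * \<delta> \<le> dist (x m) (x n)" for m n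
    proof -
      have "cmod (k m - k n) * \<delta> \<le>
          norm (((x m - k m *\<^sub>C v) - (x n - k n *\<^sub>C v)) + (k m - k n) *\<^sub>C v)"
        by (intro lower complex_vs.span_diff k)
      also have "((x m - k m *\<^sub>C v) - (x n - k n *\<^sub>C v)) + (k m - k n) *\<^sub>C v = x m - x n"
        by (simp add: complex_vs.scale_left_diff_distrib)
      finally show ?thesis by (simp add: dist_norm)
    qed
    have "Cauchy k"
    proof (rule metric_CauchyI)
      fix e :: real assume "e > 0"
      then obtain M where M: "\<And>m n. m \<ge> M \<Longrightarrow> n \<ge> M \<Longrightarrow> dist (x m) (x n) < e * \<delta>"
        using metric_CauchyD[OF LIMSEQ_imp_Cauchy[OF lim], of "e * \<delta>"] \<delta> by auto
      have "dist (k m) (k n) < e" if "m \<ge> M" "n \<ge> M" for m n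
      proof -
        have "cmod (k m - k n) * \<delta> < e * \<delta>" using kd[of m n] M[OF that] by linarith
        then show ?thesis using \<delta> by (simp add: dist_norm)
      qed
      then show "\<exists>M. \<forall>m\<ge>M. \<forall>n\<ge>M. dist (k m) (k n) < e" by blast
    qed
    then obtain c where c: "k \<longlonglongrightarrow> c" using Cauchy_convergent convergent_def by blast
    have "(\<lambda>n. x n - k n *\<^sub>C v) \<longlonglongrightarrow> l - c *\<^sub>C v"
      by (intro tendsto_diff lim bounded_linear.tendsto[OF bounded_linear_scaleC_left c])
    then have "l - c *\<^sub>C v \<in> ?Y"
      by (rule closed_sequentially[OF cl k])
    then show "l \<in> complex_vs.span (insert v S)"
      unfolding complex_vs.span_breakdown_eq by blast
  qed
qed

lemma closed_span_Un_finite: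
  fixes S :: "'a::complex_normed_vector set"
  assumes "closed (complex_vs.span S)" "finite B"
  shows "closed (complex_vs.span (S \<union> B))"
  using assms(2) by induction (use assms(1) in \<open>auto simp: closed_span_insert\<close>)

lemma closed_span_finite: "finite B \<Longrightarrow> closed (complex_vs.span (B :: 'a::complex_normed_vector set))"
  using closed_span_Un_finite[of "{}" B] by simp

section \<open>Baire category and stability of finite codimension\<close>

lemma Baire_union:
  fixes F :: "nat \<Rightarrow> 'a::{real_normed_vector,banach} set"
  assumes "(\<Union>n. closure (F n)) = UNIV"
  shows "\<exists>n. interior (closure (F n)) \<noteq> {}"
proof (rule ccontr)
  assume *: "\<not> ?thesis"
  have "Met_TC.mtopology interior_of \<Union>(range (\<lambda>n. closure (F n))) = ({}::'a set)"
    by (rule Met_TC.metric_Baire_category_alt) (use * in \<open>auto simp: Met_TC.mcomplete_def convergent_eq_Cauchy[symmetric]\<close>)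
  then show False using assms by auto
qed

text \<open>Successive approximation, using the bound from Baire's theorem with a margin for \<open>S\<close>.\<close>

lemma open_mapping_perturbed:
  fixes T :: "'a::{complex_normed_vector,banach} \<Rightarrow> 'a"
  assumes T: "bounded_clinear T" and B: "finite B"
    and span: "complex_vs.span (range T \<union> B) = UNIV"
  obtains \<epsilon> C where "\<epsilon> > 0" "C > 0"
    "\<And>S y. bounded_clinear S \<Longrightarrow> (\<And>x. norm (S x) \<le> \<epsilon> * norm x) \<Longrightarrow>
      \<exists>x. norm x \<le> C * norm y \<and> y - (T x + S x) \<in> complex_vs.span B"
proof -
  interpret T: bounded_linear T by (rule bounded_clinearD(1)[OF T])
  let ?W = "complex_vs.span B"
  \<comment> \<open>Images of balls modulo the finite-dimensional span of \<open>B\<close>; the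
    spanning hypothesis says that they exhaust the space.\<close>
  define R where "R n = {y. \<exists>x. norm x \<le> real n \<and> y - T x \<in> ?W}" for n
  have "(\<Union>n. closure (R n)) = UNIV"
  proof (intro set_eqI iffI UNIV_I)
    fix y
    obtain x where x: "y - T x \<in> ?W"
      using span in_span_range_Un[OF T] by blast
    obtain n where "norm x \<le> real n" using real_arch_simple by blast
    then have "y \<in> R n" using x by (auto simp: R_def)
    then show "y \<in> (\<Union>n. closure (R n))" using closure_subset by blast
  qed
  from Baire_union[OF this] obtain n y0 where "y0 \<in> interior (closure (R n))" by blast
  then obtain \<delta> where \<delta>: "\<delta> > 0" "ball y0 \<delta> \<subseteq> closure (R n)"
    by (meson mem_interior)
  define a where "a = real n + 1"
  have a: "a > 0" by (simp add: a_def)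
  have approx: "\<exists>x. norm x \<le> a \<and> (\<exists>r. norm r < \<eta> \<and> y - T x - r \<in> ?W)"
    if y: "norm y < \<delta>" and \<eta>: "\<eta> > 0" for y \<eta>
  proof -
    have "y0 + y \<in> closure (R n)" "y0 - y \<in> closure (R n)"
      using y \<delta>(2) by (auto simp: dist_norm)
    then obtain u v where u: "u \<in> R n" "norm (u - (y0 + y)) < \<eta>"
      and v: "v \<in> R n" "norm (v - (y0 - y)) < \<eta>"
      unfolding closure_approachable dist_norm using \<eta> by meson
    obtain xu xv where xu: "norm xu \<le> real n" "u - T xu \<in> ?W"
      and xv: "norm xv \<le> real n" "v - T xv \<in> ?W"
      using u(1) v(1) by (auto simp: R_def)
    \<comment> \<open>Half the difference of the approximations at \<open>y0 + y\<close> and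
      \<open>y0 - y\<close> moves the centre of the ball to the origin: modulo \<open>?W\<close> the
      sets \<open>R n\<close> are convex and symmetric.\<close>
    let ?x = "(1/2) *\<^sub>R (xu - xv)" and ?r = "y - (1/2) *\<^sub>R (u - v)"
    have "norm ?x \<le> a"
      using norm_triangle_ineq4[of xu xv] xu(1) xv(1) by (simp add: a_def)
    moreover have "norm ?r < \<eta>"
    proof -
      have "?r = (1/2) *\<^sub>R ((v - (y0 - y)) - (u - (y0 + y)))"
        by (simp add: algebra_simps flip: scaleR_add_left)
      then have "norm ?r \<le> (1/2) * (norm (v - (y0 - y)) + norm (u - (y0 + y)))"
        using norm_triangle_ineq4[of "v - (y0 - y)" "u - (y0 + y)"] by simp
      also have "\<dots> < \<eta>" using u(2) v(2) by simp
      finally show ?thesis .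
    qed
    moreover have "y - T ?x - ?r \<in> ?W"
    proof -
      have "y - T ?x - ?r = complex_of_real (1/2) *\<^sub>C ((u - T xu) - (v - T xv))"
        unfolding scaleR_scaleC[symmetric] by (simp add: T.scaleR T.diff algebra_simps)
      then show ?thesis
        by (metis complex_vs.span_scale complex_vs.span_diff xu(2) xv(2))
    qed
    ultimately show ?thesis by blast
  qed
  \<comment> \<open>After rescaling \<open>y\<close> to norm \<open>\<delta> / 2\<close>, the
    approximation error and the contribution of \<open>S\<close> are each at most
    \<open>\<delta> / 8\<close>, so that one correction at least halves the residual. Summing the
    corrections gives \<open>4 * a / \<delta>\<close>, and \<open>C\<close> leaves room.\<close>
  define \<epsilon> where "\<epsilon> = \<delta> / (8 * a)"
  define C where "C = 8 * a / \<delta>"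
  show thesis
  proof (rule that[of \<epsilon> C])
    show "\<epsilon> > 0" "C > 0" using \<delta> a by (auto simp: \<epsilon>_def C_def)
    fix S :: "'a \<Rightarrow> 'a" and y :: 'a
    assume S: "bounded_clinear S" and Sb: "\<And>x. norm (S x) \<le> \<epsilon> * norm x"
    interpret S: bounded_linear S by (rule bounded_clinearD(1)[OF S])
    have step: "\<exists>x r. norm x \<le> (2 * a / \<delta>) * norm y \<and> norm r \<le> norm y / 2 \<and> y - (T x + S x) - r \<in> ?W" for y
    proof (cases "y = 0")
      case True
      then show ?thesis
        by (intro exI[of _ 0]) (simp add: T.zero S.zero complex_vs.span_zero)
    next
      case False
      define s where "s = \<delta> / (2 * norm y)"
      have s: "s > 0" using \<delta> False by (simp add: s_def)
      have "norm (s *\<^sub>R y) < \<delta>" using s False \<delta> by (simp add: s_def)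
      from approx[OF this, of "\<delta> / 8"] \<delta> obtain x r
        where x: "norm x \<le> a" and r: "norm r < \<delta> / 8" and w: "s *\<^sub>R y - T x - r \<in> ?W"
        by auto
      let ?x = "(1/s) *\<^sub>R x" and ?r = "(1/s) *\<^sub>R (r - S x)"
      have "norm ?x \<le> (1/s) * a" using s x by (simp add: divide_right_mono)
      moreover have "(1/s) * a = (2 * a / \<delta>) * norm y" using False \<delta> by (simp add: s_def)
      moreover have "norm ?r \<le> norm y / 2"
      proof -
        have "norm (S x) \<le> \<epsilon> * a" using Sb[of x] x \<open>\<epsilon> > 0\<close>
          by (meson mult_left_mono less_imp_le order_trans)
        also have "\<dots> = \<delta> / 8" using a by (simp add: \<epsilon>_def)
        finally have "norm (r - S x) \<le> \<delta> / 4"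
          using norm_triangle_ineq4[of r "S x"] r by linarith
        then have "norm ?r \<le> (1/s) * (\<delta> / 4)"
          using s mult_left_mono[of "norm (r - S x)" "\<delta> / 4" "1/s"] by simp
        also have "\<dots> = norm y / 2" using False \<delta> by (simp add: s_def)
        finally show ?thesis .
      qed
      moreover have "y - (T ?x + S ?x) - ?r \<in> ?W"
      proof -
        have "y - (T ?x + S ?x) - ?r = (1/s) *\<^sub>R (s *\<^sub>R y - T x - r)"
          using s by (simp add: T.scaleR S.scaleR algebra_simps)
        moreover have "(1/s) *\<^sub>R (s *\<^sub>R y - T x - r) \<in> ?W"
          unfolding scaleR_scaleC[of "1/s"] by (rule complex_vs.span_scale[OF w])
        ultimately show ?thesis by simp
      qed
      ultimately show ?thesis by metis
    qed
    then obtain X r where X: "\<And>y. norm (X y) \<le> (2 * a / \<delta>) * norm y"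
      and r: "\<And>y. norm (r y) \<le> norm y / 2"
      and W: "\<And>y. y - (T (X y) + S (X y)) - r y \<in> ?W"
      by metis
    \<comment> \<open>The residual after \<open>k\<close> corrections; it halves each time, so the
      corrections form an absolutely convergent series.\<close>
    define Y where "Y k = (r ^^ k) y" for k
    have Yn: "norm (Y k) \<le> norm y * (1/2) ^ k" for k
    proof (induction k)
      case (Suc k)
      have "norm (Y (Suc k)) \<le> norm (Y k) / 2" using r[of "Y k"] by (simp add: Y_def)
      then show ?case using Suc by simp
    qed (simp add: Y_def)
    have Xn: "norm (X (Y k)) \<le> (2 * a / \<delta> * norm y) * (1/2) ^ k" for k
    proof -
      have "norm (X (Y k)) \<le> (2 * a / \<delta>) * (norm y * (1/2) ^ k)"
        using X[of "Y k"] Yn[of k] a \<delta>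
        by (meson divide_nonneg_pos less_imp_le mult_left_mono mult_nonneg_nonneg order_trans zero_le_numeral)
      then show ?thesis by (simp add: mult.assoc)
    qed
    have geo: "(\<lambda>k. (2 * a / \<delta> * norm y) * (1/2) ^ k) sums ((2 * a / \<delta> * norm y) * 2)"
      using geometric_sums[of "1/2::real"] by (intro sums_mult) simp
    have sumX: "summable (\<lambda>k. X (Y k))"
      by (rule summable_comparison_test'[OF sums_summable[OF geo]]) (use Xn in auto)
    have sumN: "summable (\<lambda>k. norm (X (Y k)))"
      by (rule summable_comparison_test'[OF sums_summable[OF geo]]) (use Xn in auto)
    define x where "x = (\<Sum>k. X (Y k))"
    have "norm x \<le> (\<Sum>k. norm (X (Y k)))" unfolding x_def by (rule summable_norm[OF sumN])
    also have "\<dots> \<le> (2 * a / \<delta> * norm y) * 2"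
      using suminf_le[OF Xn sumN sums_summable[OF geo]] sums_unique[OF geo] by simp
    finally have nx: "norm x \<le> (4 * a / \<delta>) * norm y" by simp
    have part: "y - (T (\<Sum>k<m. X (Y k)) + S (\<Sum>k<m. X (Y k))) - Y m \<in> ?W" for m
    proof (induction m)
      case 0
      then show ?case by (simp add: Y_def T.zero S.zero complex_vs.span_zero)
    next
      case (Suc m)
      have "Y m - (T (X (Y m)) + S (X (Y m))) - Y (Suc m) \<in> ?W"
        using W[of "Y m"] by (simp add: Y_def)
      from complex_vs.span_add[OF Suc this]
      show ?case by (simp add: T.add S.add algebra_simps)
    qed
    have "(\<lambda>m. y - (T (\<Sum>k<m. X (Y k)) + S (\<Sum>k<m. X (Y k))) - Y m) \<longlonglongrightarrow> y - (T x + S x) - 0"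
    proof (intro tendsto_diff tendsto_add tendsto_const T.tendsto S.tendsto)
      show "(\<lambda>m. \<Sum>k<m. X (Y k)) \<longlonglongrightarrow> x"
        unfolding x_def by (rule summable_LIMSEQ[OF sumX])
      then show "(\<lambda>m. \<Sum>k<m. X (Y k)) \<longlonglongrightarrow> x" .
      have "(\<lambda>k. norm y * (1/2) ^ k) \<longlonglongrightarrow> norm y * 0"
        by (intro tendsto_mult tendsto_const LIMSEQ_power_zero) auto
      then show "Y \<longlonglongrightarrow> 0"
        using Yn by (intro Lim_null_comparison[of Y "\<lambda>k. norm y * (1/2) ^ k"]) auto
    qed
    then have "y - (T x + S x) - 0 \<in> ?W"
      by (rule closed_sequentially[OF closed_span_finite[OF B] part])
    then have "y - (T x + S x) \<in> ?W" by simp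
    moreover have "norm x \<le> C * norm y"
    proof -
      have "(4 * a / \<delta>) * norm y \<le> C * norm y"
        using a \<delta> unfolding C_def by (intro mult_right_mono divide_right_mono) auto
      then show ?thesis using nx by linarith
    qed
    ultimately show "\<exists>x. norm x \<le> C * norm y \<and> y - (T x + S x) \<in> ?W" by blast
  qed
qed


text \<open>Moving the spectral parameter adds a small multiple of the identity. The same complement
  \<open>B\<close> serves for all nearby parameters, so infinite codimension on a set passes to its
  closure.\<close>

lemma range_shift_perturbed:
  fixes T :: "'a::{complex_normed_vector,banach} \<Rightarrow> 'a"
  assumes T: "bounded_clinear T" and B: "finite B"
    and span: "complex_vs.span (range (\<lambda>x. T x - \<mu> *\<^sub>C x) \<union> B) = UNIV"
  obtains \<epsilon> where "\<epsilon> > 0"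
    "\<And>\<nu>. cmod (\<nu> - \<mu>) \<le> \<epsilon> \<Longrightarrow> complex_vs.span (range (\<lambda>x. T x - \<nu> *\<^sub>C x) \<union> B) = UNIV"
proof -
  obtain \<epsilon> C where \<epsilon>: "\<epsilon> > 0" and C: "\<And>S y. bounded_clinear S \<Longrightarrow>
      (\<And>x. norm (S x) \<le> \<epsilon> * norm x) \<Longrightarrow>
      \<exists>x. norm x \<le> C * norm y \<and> y - ((T x - \<mu> *\<^sub>C x) + S x) \<in> complex_vs.span B"
    using open_mapping_perturbed[OF bounded_clinear_shift[OF T] B span] by metis
  show thesis
  proof (rule that[OF \<epsilon>])
    fix \<nu> assume \<nu>: "cmod (\<nu> - \<mu>) \<le> \<epsilon>"
    have S: "bounded_clinear (\<lambda>x::'a. (\<mu> - \<nu>) *\<^sub>C x)"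
      by (rule bounded_clinearI[where K="cmod (\<mu> - \<nu>)"])
         (auto simp: scaleC_add_right scaleC_scaleC norm_scaleC mult.commute)
    have "norm ((\<mu> - \<nu>) *\<^sub>C x) \<le> \<epsilon> * norm x" for x :: 'a
      using \<nu> by (simp add: norm_scaleC norm_minus_commute mult_right_mono)
    from C[OF S this] have "\<exists>x. y - (T x - \<nu> *\<^sub>C x) \<in> complex_vs.span B" for y
      by (simp add: complex_vs.scale_left_diff_distrib) blast
    then show "complex_vs.span (range (\<lambda>x. T x - \<nu> *\<^sub>C x) \<union> B) = UNIV"
      using in_span_range_Un[OF bounded_clinear_shift[OF T]] by blast
  qed
qed

text \<open>Bounded inverse theorem: with an empty complement and the zero perturbation, the norm
  bound on a preimage in \<open>open_mapping_perturbed\<close> is a bound on the inverse.\<close>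

lemma bijective_imp_invertible_operator:
  fixes T :: "'a::{complex_normed_vector,banach} \<Rightarrow> 'a"
  assumes T: "bounded_clinear T" and inj: "inj T" and surj: "surj T"
  shows "invertible_operator T"
proof -
  have "complex_vs.span (range T \<union> {}) = UNIV" using surj by simp
  then obtain \<epsilon> C where "\<epsilon> > 0" and C: "\<And>S y. bounded_clinear S \<Longrightarrow>
      (\<And>x. norm (S x) \<le> \<epsilon> * norm x) \<Longrightarrow>
      \<exists>x. norm x \<le> C * norm y \<and> y - (T x + S x) \<in> complex_vs.span {}"
    using open_mapping_perturbed[OF T, of "{}"] by (metis finite.emptyI)
  have "bounded_clinear (\<lambda>x::'a. 0::'a)"
    by (rule bounded_clinearI[where K=0]) auto
  from C[OF this] \<open>\<epsilon> > 0\<close> have C: "\<exists>x. norm x \<le> C * norm y \<and> T x = y" for y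
    by fastforce
  have TI: "T (inv T y) = y" for y by (rule surj_f_inv_f[OF surj])
  have IT: "inv T (T y) = y" for y by (rule inv_f_f[OF inj])
  have "bounded_clinear (inv T)"
  proof (rule bounded_clinearI[where K=C])
    show "inv T (x + y) = inv T x + inv T y" for x y
      by (metis IT TI bounded_clinearD(3)[OF T])
    show "inv T (c *\<^sub>C x) = c *\<^sub>C inv T x" for c x
      by (metis IT TI bounded_clinearD(2)[OF T])
    show "norm (inv T y) \<le> C * norm y" for y
      using C[of y] IT by metis
  qed
  then show ?thesis
    unfolding invertible_operator_def using T IT TI by (intro conjI exI[of _ "inv T"]) auto
qed

text \<open>Dimension count: a missed vector \<open>w\<close>, added to the image of a basis, would
  be an independent set larger than the basis inside the same span.\<close>

lemma injective_on_finite_span_imp_surjective: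
  assumes N: "module_hom scaleC scaleC N" and P: "finite P"
    and inj: "inj_on N (complex_vs.span P)"
    and into: "N ` complex_vs.span P \<subseteq> complex_vs.span P"
    and w: "w \<in> complex_vs.span (P :: 'a::complex_normed_vector set)"
  shows "w \<in> N ` complex_vs.span P"
proof (rule ccontr)
  assume notin: "w \<notin> N ` complex_vs.span P"
  obtain B where B: "B \<subseteq> complex_vs.span P" "complex_vs.independent B"
    "complex_vs.span P \<subseteq> complex_vs.span B"
    using complex_vs.maximal_independent_subset[of "complex_vs.span P"] by blast
  have fB: "finite B" by (rule conjunct1[OF complex_vs.independent_span_bound[OF P B(2,1)]])
  have spB: "complex_vs.span B = complex_vs.span P"
    using B(1,3) by (metis complex_vs.span_mono complex_vs.span_span subset_antisym)
  have injB: "inj_on N (complex_vs.span B)" using inj spB by simp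
  have ind: "complex_vs.independent (N ` B)"
    by (rule module_hom.independent_injective_image[OF N B(2) injB])
  have "w \<notin> complex_vs.span (N ` B)"
    using notin spB by (simp add: module_hom.span_image[OF N])
  then have ind2: "complex_vs.independent (insert w (N ` B))" "w \<notin> N ` B"
    using complex_vs.independent_insertI[OF _ ind] complex_vs.span_base[of w "N ` B"] by auto
  have "insert w (N ` B) \<subseteq> complex_vs.span B"
    using w into B(1) spB by auto
  from complex_vs.independent_span_bound[OF fB ind2(1) this]
  have "card (insert w (N ` B)) \<le> card B" by simp
  moreover have "card (N ` B) = card B"
    using inj_on_subset[OF injB complex_vs.span_superset] by (rule card_image)
  ultimately show False using ind2(2) fB by simp
qed

text \<open>
  The hypotheses say that \<open>T\<close> is a perturbation of \<open>A\<close> by a finite rank operator vanishing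
  on \<open>H\<close>.
\<close>

lemma fredholm_finite_rank_perturbation:
  fixes T A :: "'a::{complex_normed_vector,banach} \<Rightarrow> 'a"
  assumes T: "bounded_clinear T" and A: "bounded_clinear A"
    and Ab: "\<And>x. norm (A x) \<le> q * norm x" and q: "0 \<le> q" "q < cmod \<mu>"
    and H: "closed H" "complex_vs.subspace H" and TA: "\<And>x. x \<in> H \<Longrightarrow> T x = A x"
    and P: "finite P" and dec: "\<And>x. \<exists>h\<in>H. x - h \<in> complex_vs.span P"
  shows "fredholm (\<lambda>x. T x - \<mu> *\<^sub>C x)"
    and "inj (\<lambda>x. T x - \<mu> *\<^sub>C x) \<Longrightarrow> invertible_operator (\<lambda>x. T x - \<mu> *\<^sub>C x)"
proof -
  define D where "D x = A x - \<mu> *\<^sub>C x" for x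
  define M where "M x = T x - \<mu> *\<^sub>C x" for x
  define F where "F x = T x - A x" for x
  have D: "bounded_clinear D" and M: "bounded_clinear M"
    unfolding D_def M_def by (intro bounded_clinear_shift A T)+
  have \<mu>: "\<mu> \<noteq> 0" "0 < cmod \<mu>" using q by auto
  have Dlow: "(cmod \<mu> - q) * norm x \<le> norm (D x)" for x
    using norm_triangle_ineq2[of "\<mu> *\<^sub>C x" "A x"] Ab[of x]
    by (simp add: D_def norm_scaleC norm_minus_commute algebra_simps)
  have Dinj: "x = y" if "D x = D y" for x y
  proof -
    have "D (x - y) = 0" using that bounded_clinearD(4)[OF D] by simp
    then have "(cmod \<mu> - q) * norm (x - y) \<le> 0" using Dlow[of "x - y"] by simp
    then show ?thesis using q by (simp add: mult_le_0_iff)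
  qed
  have "\<exists>x. D x = y" for y
  proof -
    \<comment> \<open>A solution of \<open>D x = y\<close> is a fixed point of this contraction,
      whose ratio is at most \<open>q / cmod \<mu>\<close>; together with \<open>Dlow\<close> this
      inverts \<open>D\<close>.\<close>
    define f where "f x = (1/\<mu>) *\<^sub>C (A x - y)" for x
    have "\<exists>!x. f x = x"
    proof (rule banach_fix_type)
      show "0 \<le> q / cmod \<mu>" "q / cmod \<mu> < 1" using q \<mu> by auto
      show "\<forall>x y. dist (f x) (f y) \<le> q / cmod \<mu> * dist x y"
      proof (intro allI)
        fix u v
        have "f u - f v = (1/\<mu>) *\<^sub>C (A (u - v))"
          by (simp add: f_def bounded_clinearD(4)[OF A] flip: complex_vs.scale_right_diff_distrib)
        then have "dist (f u) (f v) = norm (A (u - v)) / cmod \<mu>"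
          by (simp add: dist_norm norm_scaleC norm_divide)
        also have "\<dots> \<le> (q * norm (u - v)) / cmod \<mu>"
          using Ab \<mu> by (intro divide_right_mono) auto
        finally show "dist (f u) (f v) \<le> q / cmod \<mu> * dist u v" by (simp add: dist_norm)
      qed
    qed
    then obtain x where "f x = x" by blast
    then have "\<mu> *\<^sub>C x = \<mu> *\<^sub>C f x" by simp
    also have "\<dots> = A x - y" using \<mu> by (simp add: f_def scaleC_scaleC scaleC_one)
    finally have "D x = y" by (simp add: D_def)
    then show ?thesis ..
  qed
  then obtain G where DG: "\<And>y. D (G y) = y" by metis
  have GD: "G (D x) = x" for x using Dinj DG by blast
  have G_add: "G (x + y) = G x + G y" for x y
    by (rule Dinj) (simp add: DG bounded_clinearD(3)[OF D])
  have G_scale: "G (c *\<^sub>C x) = c *\<^sub>C G x" for c x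
    by (rule Dinj) (simp add: DG bounded_clinearD(2)[OF D])
  have Ghom: "module_hom scaleC scaleC G"
    by (simp add: module_hom_iff G_add G_scale complex_vs.module_axioms)
  have FM: "F x = M x - D x" for x by (simp add: F_def M_def D_def)
  have F: "module_hom scaleC scaleC F"
    by (simp add: module_hom_iff FM bounded_clinearD(2,3)[OF D] bounded_clinearD(2,3)[OF M]
        complex_vs.module_axioms complex_vs.scale_right_diff_distrib)
  have F0: "F h = 0" if "h \<in> H" for h using TA[OF that] by (simp add: F_def)
  have FP: "F x \<in> complex_vs.span (F ` P)" for x
  proof -
    obtain h where h: "h \<in> H" "x - h \<in> complex_vs.span P" using dec by blast
    have "F x = F (x - h)" using F0[OF h(1)] module_hom.diff[OF F] by simp
    then show ?thesis using h(2) by (simp add: module_hom.span_image[OF F])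
  qed
  \<comment> \<open>\<open>G \<circ> F\<close> has its range in this finite-dimensional space. A
    vector \<open>x\<close> in the kernel of \<open>M\<close> equals \<open>- G (F x)\<close>, so
    the kernel lies in it as well.\<close>
  define W where "W = complex_vs.span (G ` F ` P)"
  have GFW: "G (F x) \<in> W" for x
    using FP[of x] unfolding W_def module_hom.span_image[OF Ghom] by blast
  have MH: "M h = D h" if "h \<in> H" for h using F0[OF that] FM[of h] by simp
  show "fredholm (\<lambda>x. T x - \<mu> *\<^sub>C x)"
    unfolding fredholm_def M_def[symmetric]
  proof (intro conjI)
    show "\<exists>B. finite B \<and> {x. M x = 0} \<subseteq> complex_vs.span B"
    proof (intro exI conjI subsetI)
      show "finite (G ` F ` P)" using P by simp
      fix x assume "x \<in> {x. M x = 0}"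
      then have "D x = - F x" using FM[of x] by simp
      then have "x = - G (F x)" by (metis GD module_hom.neg[OF Ghom])
      then show "x \<in> complex_vs.span (G ` F ` P)"
        using GFW[of x] complex_vs.span_neg unfolding W_def by metis
    qed
    have subD: "complex_vs.subspace (D ` H)"
      by (rule module_hom.subspace_image[OF module_hom_bounded_clinear[OF D] H(2)])
    have clD: "closed (D ` H)"
      unfolding closed_sequential_limits
    proof (intro allI impI, elim conjE)
      fix y l assume "\<forall>n. y n \<in> D ` H" and lim: "y \<longlonglongrightarrow> l"
      then have "\<forall>n. \<exists>x. x \<in> H \<and> y n = D x" by blast
      then obtain h where h: "\<And>n. h n \<in> H" "\<And>n. y n = D (h n)" by metis
      have "Cauchy h"
      proof (rule metric_CauchyI)
        fix e :: real assume "e > 0"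
        then obtain K where K: "\<And>m n. m \<ge> K \<Longrightarrow> n \<ge> K \<Longrightarrow> dist (y m) (y n) < (cmod \<mu> - q) * e"
          using metric_CauchyD[OF LIMSEQ_imp_Cauchy[OF lim], of "(cmod \<mu> - q) * e"] q by auto
        have "dist (h m) (h n) < e" if "m \<ge> K" "n \<ge> K" for m n
        proof -
          have "(cmod \<mu> - q) * dist (h m) (h n) \<le> dist (y m) (y n)"
            using Dlow[of "h m - h n"] by (simp add: dist_norm h(2) bounded_clinearD(4)[OF D])
          then have "(cmod \<mu> - q) * dist (h m) (h n) < (cmod \<mu> - q) * e"
            using K[OF that] by linarith
          then show ?thesis using q by simp
        qed
        then show "\<exists>K. \<forall>m\<ge>K. \<forall>n\<ge>K. dist (h m) (h n) < e" by blast
      qed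
      then obtain h0 where h0: "h \<longlonglongrightarrow> h0" using Cauchy_convergent convergent_def by blast
      have "h0 \<in> H" by (rule closed_sequentially[OF H(1) h(1) h0])
      moreover have "(\<lambda>n. D (h n)) \<longlonglongrightarrow> D h0"
        by (rule bounded_linear.tendsto[OF bounded_clinearD(1)[OF D] h0])
      then have "D h0 = l" using lim h(2) LIMSEQ_unique by (metis ext)
      ultimately show "l \<in> D ` H" by blast
    qed
    have spD: "complex_vs.span (D ` H) = D ` H"
      using complex_vs.span_eq_iff[THEN iffD2] subD by blast
    have "range M = complex_vs.span (D ` H \<union> M ` P)"
    proof (intro subset_antisym subsetI)
      fix y assume "y \<in> range M"
      then obtain x where x: "y = M x" by blast
      obtain h where h: "h \<in> H" "x - h \<in> complex_vs.span P" using dec by blast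
      have "y = D h + M (x - h)" using x MH[OF h(1)] bounded_clinearD(4)[OF M] by simp
      moreover have "M (x - h) \<in> complex_vs.span (M ` P)"
        using h(2) by (simp add: module_hom.span_image[OF module_hom_bounded_clinear[OF M]])
      ultimately show "y \<in> complex_vs.span (D ` H \<union> M ` P)"
        using h(1) unfolding complex_vs.span_Un spD by blast
    next
      fix y assume "y \<in> complex_vs.span (D ` H \<union> M ` P)"
      moreover have "D ` H \<union> M ` P \<subseteq> range M"
        using MH by (metis (no_types, lifting) Un_least image_cong image_mono subset_UNIV)
      ultimately show "y \<in> range M"
        using complex_vs.span_minimal[OF _ subspace_range[OF M]] by blast
    qed
    moreover have "closed (complex_vs.span (D ` H \<union> M ` P))"
      using closed_span_Un_finite[of "D ` H" "M ` P"] clD spD P by simp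
    ultimately show "closed (range M)" by simp
    show "\<exists>B. finite B \<and> complex_vs.span (range M \<union> B) = UNIV"
    proof (intro exI conjI)
      show "finite (D ` P)" using P by simp
      have "\<exists>x. y - M x \<in> complex_vs.span (D ` P)" for y
      proof -
        obtain h where h: "h \<in> H" "G y - h \<in> complex_vs.span P" using dec by blast
        have "y - M h = D (G y - h)" by (simp add: DG MH[OF h(1)] bounded_clinearD(4)[OF D])
        then show ?thesis
          using h(2) by (metis imageI module_hom.span_image[OF module_hom_bounded_clinear[OF D]])
      qed
      then show "complex_vs.span (range M \<union> D ` P) = UNIV"
        using in_span_range_Un[OF M] by blast
    qed
  qed (rule M)
  show "invertible_operator (\<lambda>x. T x - \<mu> *\<^sub>C x)" if inj: "inj (\<lambda>x. T x - \<mu> *\<^sub>C x)"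
  proof -
    have injM: "inj M" using inj by (simp add: M_def[abs_def])
    \<comment> \<open>\<open>M = D \<circ> N\<close>, so injectivity passes from \<open>M\<close> to
      \<open>N\<close>. As \<open>N\<close> differs from the identity by a map into
      \<open>W\<close>, surjectivity only has to be checked on the finite-dimensional
      \<open>W\<close>.\<close>
    define N where "N x = x + G (F x)" for x
    have DN: "D (N x) = M x" for x
      by (simp add: N_def bounded_clinearD(3)[OF D] DG FM)
    have N: "module_hom scaleC scaleC N"
      by (simp add: module_hom_iff N_def module_hom.add[OF F] module_hom.scale[OF F] G_add G_scale
          scaleC_add_right complex_vs.module_axioms)
    have "inj N" using injM DN by (metis injD injI)
    then have "inj_on N W" by (rule inj_on_subset) simp
    have NW: "N ` W \<subseteq> W"
      using GFW unfolding N_def W_def by (auto intro: complex_vs.span_add)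
    have "\<exists>x. M x = y" for y
    proof -
      have "G (F (G y)) \<in> N ` complex_vs.span (G ` F ` P)"
      proof (rule injective_on_finite_span_imp_surjective[OF N])
        show "finite (G ` F ` P)" using P by simp
      qed (use \<open>inj_on N W\<close> NW GFW in \<open>auto simp: W_def\<close>)
      then obtain w where w: "N w = G (F (G y))" by (metis imageE)
      have "N (G y - w) = G y" using w by (simp add: module_hom.diff[OF N]) (simp add: N_def)
      then have "M (G y - w) = y" using DN DG by metis
      then show ?thesis ..
    qed
    then have "surj M" by (metis surjI)
    then have "invertible_operator M" by (rule bijective_imp_invertible_operator[OF M injM])
    then show ?thesis by (simp add: M_def[abs_def])
  qed
qed

section \<open>Circle means and the Hardy space\<close>

lemma hardy2_fun_holomorphic: "hardy2_fun f holomorphic_on unit_disc"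
  by (rule hardy2_fun[THEN CollectD, THEN conjunct1])

lemma hardy2_fun_outside: "z \<notin> unit_disc \<Longrightarrow> hardy2_fun f z = 0"
  using hardy2_fun[of f] by auto

lemma hardy2_eqI: "(\<And>z. z \<in> unit_disc \<Longrightarrow> hardy2_fun f z = hardy2_fun g z) \<Longrightarrow> f = g"
  by (metis hardy2_fun_inject hardy2_fun_outside ext)

lemma hardy2_fun_zero [simp]: "hardy2_fun 0 z = 0"
  by transfer simp

lemma hardy2_fun_add: "hardy2_fun (f + g) z = hardy2_fun f z + hardy2_fun g z"
  by transfer simp

lemma hardy2_fun_diff: "hardy2_fun (f - g) z = hardy2_fun f z - hardy2_fun g z"
  by transfer simp

lemma hardy2_fun_scaleC: "hardy2_fun (c *\<^sub>C f) z = c * hardy2_fun f z"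
  by transfer simp

lemma hardy2_fun_sum: "hardy2_fun (sum h A) z = (\<Sum>i\<in>A. hardy2_fun (h i) z)"
  by (induction A rule: infinite_finite_induct) (auto simp: hardy2_fun_add)

lemma hardy2_coeff_diff: "hardy2_coeff (f - g) n = hardy2_coeff f n - hardy2_coeff g n"
  by (metis add_diff_cancel diff_add_cancel hardy2_coeff_add)

lemma hardy2_norm_square: "(norm f)\<^sup>2 = (\<Sum>n. (cmod (hardy2_coeff f n))\<^sup>2)"
  by (simp add: norm_hardy2_def suminf_nonneg summable_hardy2_coeff)

lemma maclaurin_sums:
  assumes "g holomorphic_on unit_disc" "z \<in> unit_disc"
  shows "(\<lambda>n. maclaurin_coeff g n * z ^ n) sums g z"
  using holomorphic_power_series[OF assms] by (simp add: maclaurin_coeff_def)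

lemma maclaurin_summable_norm:
  assumes "g holomorphic_on unit_disc" "0 \<le> r" "r < 1"
  shows "summable (\<lambda>n. cmod (maclaurin_coeff g n) * r ^ n)"
proof -
  define s where "s = (r + 1) / 2"
  have s: "r < s" "s < 1" "0 < s" using assms by (auto simp: s_def)
  have "summable (\<lambda>n. maclaurin_coeff g n * of_real s ^ n)"
    using maclaurin_sums[OF assms(1), of "of_real s"] s by (auto simp: sums_iff)
  then have "summable (\<lambda>n. norm (maclaurin_coeff g n * of_real r ^ n))"
    by (rule powser_insidea) (use s assms in auto)
  then show ?thesis using assms by (simp add: norm_mult norm_power)
qed

lemma hardy2_fun_sums:
  "z \<in> unit_disc \<Longrightarrow> (\<lambda>n. hardy2_coeff f n * z ^ n) sums hardy2_fun f z"
  unfolding hardy2_coeff_def by (rule maclaurin_sums[OF hardy2_fun_holomorphic])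

lemma Cauchy_Schwarz_sums:
  fixes a b :: "nat \<Rightarrow> complex"
  assumes a: "summable (\<lambda>n. (cmod (a n))\<^sup>2)" and b: "summable (\<lambda>n. (cmod (b n))\<^sup>2)"
    and s: "(\<lambda>n. a n * b n) sums s"
  shows "cmod s \<le> sqrt (\<Sum>n. (cmod (a n))\<^sup>2) * sqrt (\<Sum>n. (cmod (b n))\<^sup>2)"
proof -
  have "cmod (\<Sum>n<N. a n * b n) \<le> sqrt (\<Sum>n. (cmod (a n))\<^sup>2) * sqrt (\<Sum>n. (cmod (b n))\<^sup>2)" for N
  proof -
    have "cmod (\<Sum>n<N. a n * b n) \<le> (\<Sum>n<N. \<bar>cmod (a n)\<bar> * \<bar>cmod (b n)\<bar>)"
      by (rule order_trans[OF norm_sum]) (simp add: norm_mult)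
    also have "\<dots> \<le> L2_set (\<lambda>n. cmod (a n)) {..<N} * L2_set (\<lambda>n. cmod (b n)) {..<N}"
      by (rule L2_set_mult_ineq)
    also have "\<dots> \<le> sqrt (\<Sum>n. (cmod (a n))\<^sup>2) * sqrt (\<Sum>n. (cmod (b n))\<^sup>2)"
      unfolding L2_set_def
      by (intro mult_mono real_sqrt_le_mono sum_le_suminf a b)
         (auto intro!: sum_nonneg suminf_nonneg a b)
    finally show ?thesis .
  qed
  moreover have "(\<lambda>N. cmod (\<Sum>n<N. a n * b n)) \<longlonglongrightarrow> cmod s"
    using s by (intro tendsto_norm) (simp add: sums_def)
  ultimately show ?thesis by (intro LIMSEQ_le_const2) auto
qed

text \<open>Cauchy-Schwarz against the tail of a geometric sequence. The factor
  \<open>cmod z ^ M\<close> makes functions with many vanishing coefficients uniformly small on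
  every smaller disc.\<close>

lemma hardy2_eval_tail_bound:
  assumes z: "cmod z < 1" and low: "\<And>n. n < M \<Longrightarrow> hardy2_coeff f n = 0"
  shows "cmod (hardy2_fun f z) \<le> norm f * (cmod z ^ M / sqrt (1 - (cmod z)\<^sup>2))"
proof -
  define b where "b n = (if n < M then 0 else z ^ n)" for n
  have q: "0 \<le> (cmod z)\<^sup>2" "(cmod z)\<^sup>2 < 1" using z by (auto simp: power_less_one_iff abs_square_less_1)
  have geo: "(\<lambda>n. (cmod (b n))\<^sup>2) sums ((cmod z)\<^sup>2 ^ M / (1 - (cmod z)\<^sup>2))"
  proof -
    have "(\<lambda>n. (cmod (b (n + M)))\<^sup>2) sums ((cmod z)\<^sup>2 ^ M * (1 / (1 - (cmod z)\<^sup>2)))"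
      using sums_mult[OF geometric_sums[of "(cmod z)\<^sup>2"], of "(cmod z)\<^sup>2 ^ M"] q
      by (simp add: b_def norm_mult norm_power power_mult_distrib mult.commute power_add flip: power_mult)
    moreover have "(\<Sum>i<M. (cmod (b i))\<^sup>2) = 0" by (simp add: b_def)
    ultimately show ?thesis using sums_iff_shift[of "\<lambda>n. (cmod (b n))\<^sup>2" M] by simp
  qed
  have "(\<lambda>n. hardy2_coeff f n * b n) sums hardy2_fun f z"
  proof -
    have "(\<lambda>n. hardy2_coeff f n * b n) = (\<lambda>n. hardy2_coeff f n * z ^ n)"
      using low by (auto simp: b_def)
    then show ?thesis using hardy2_fun_sums[of z f] z by simp
  qed
  from Cauchy_Schwarz_sums[OF summable_hardy2_coeff sums_summable[OF geo] this]
  have "cmod (hardy2_fun f z) \<le> norm f * sqrt ((cmod z)\<^sup>2 ^ M / (1 - (cmod z)\<^sup>2))"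
    by (simp add: norm_hardy2_def sums_unique[OF geo, symmetric])
  also have "sqrt ((cmod z)\<^sup>2 ^ M / (1 - (cmod z)\<^sup>2)) = cmod z ^ M / sqrt (1 - (cmod z)\<^sup>2)"
    by (simp add: real_sqrt_divide real_sqrt_power)
  finally show ?thesis .
qed

lemma hardy2_eval_bound:
  assumes z: "cmod z < 1"
  shows "cmod (hardy2_fun f z) \<le> norm f / sqrt (1 - (cmod z)\<^sup>2)"
  using hardy2_eval_tail_bound[OF z, of 0 f] by simp

section \<open>Parseval's identity on circles\<close>

lemma has_integral_circle_exp:
  fixes k :: int
  shows "((\<lambda>\<theta>. exp (\<i> * of_int k * of_real \<theta>)) has_integral (if k = 0 then 2 * of_real pi else 0)) {-pi..pi}"
proof (cases "k = 0")
  case True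
  have "((\<lambda>\<theta>::real. 1::complex) has_integral (pi - (-pi)) *\<^sub>R 1) {-pi..pi}"
    using has_integral_const_real[of "1::complex" "-pi" pi] by simp
  then show ?thesis using True by (simp add: scaleR_conv_of_real)
next
  case False
  define F where "F \<theta> = exp (\<i> * of_int k * of_real \<theta>) / (\<i> * of_int k)" for \<theta> :: real
  have "((\<lambda>\<theta>. exp (\<i> * of_int k * of_real \<theta>)) has_integral (F pi - F (-pi))) {-pi..pi}"
  proof (rule fundamental_theorem_of_calculus)
    fix \<theta> :: real assume "\<theta> \<in> {-pi..pi}"
    have "((\<lambda>z. exp (\<i> * of_int k * z) / (\<i> * of_int k)) has_field_derivative exp (\<i> * of_int k * of_real \<theta>)) (at (of_real \<theta>))"
      using False by (auto intro!: derivative_eq_intros)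
    from has_vector_derivative_real_field[OF this]
    show "(F has_vector_derivative exp (\<i> * of_int k * of_real \<theta>)) (at \<theta> within {-pi..pi})"
      unfolding F_def by simp
  qed simp
  moreover have "F pi = F (-pi)"
  proof -
    have "exp (\<i> * of_int k * of_real pi) = exp (\<i> * of_int k * of_real (-pi))"
      unfolding exp_eq by (intro exI[of _ k]) (simp add: algebra_simps)
    then show ?thesis by (simp add: F_def)
  qed
  ultimately show ?thesis using False by simp
qed

definition circle_point :: "real \<Rightarrow> real \<Rightarrow> complex"
  where "circle_point r \<theta> = of_real r * exp (\<i> * of_real \<theta>)"

definition circle_mean :: "(complex \<Rightarrow> complex) \<Rightarrow> real \<Rightarrow> real"
  where "circle_mean g r = integral {-pi..pi} (\<lambda>\<theta>. (cmod (g (circle_point r \<theta>)))\<^sup>2) / (2 * pi)"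

lemma cmod_circle_point [simp]: "cmod (circle_point r \<theta>) = \<bar>r\<bar>"
  by (simp add: circle_point_def norm_mult)

lemma continuous_circle_point: "continuous_on A (circle_point r)"
  unfolding circle_point_def by (intro continuous_intros)

lemma circle_integrable:
  assumes "g holomorphic_on unit_disc" "0 \<le> r" "r < 1"
  shows "(\<lambda>\<theta>. (cmod (g (circle_point r \<theta>)))\<^sup>2) integrable_on {-pi..pi}"
proof (intro integrable_continuous_real continuous_intros)
  show "continuous_on {-pi..pi} (\<lambda>\<theta>. g (circle_point r \<theta>))"
    by (rule continuous_on_compose2[OF holomorphic_on_imp_continuous_on[OF assms(1)] continuous_circle_point])
       (use assms in auto)
qed

text \<open>Induction on the number of terms: the cross term between the new power and the lower
  ones integrates to zero.\<close>

lemma circle_mean_polynomial: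
  fixes a :: "nat \<Rightarrow> complex"
  shows "((\<lambda>\<theta>. (cmod (\<Sum>n<N. a n * circle_point r \<theta> ^ n))\<^sup>2) has_integral
    (2 * pi * (\<Sum>n<N. (cmod (a n))\<^sup>2 * r ^ (2 * n)))) {-pi..pi}"
proof (induction N)
  case 0
  then show ?case by simp
next
  case (Suc N)
  define p where "p \<theta> = (\<Sum>n<N. a n * circle_point r \<theta> ^ n)" for \<theta>
  define q where "q \<theta> = a N * circle_point r \<theta> ^ N" for \<theta>
  have pq: "((\<lambda>\<theta>. p \<theta> * cnj (q \<theta>)) has_integral 0) {-pi..pi}"
  proof -
    have "((\<lambda>\<theta>. \<Sum>n<N. (a n * cnj (a N) * of_real r ^ (n + N)) * exp (\<i> * of_int (int n - int N) * of_real \<theta>))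
        has_integral (\<Sum>n<N. (a n * cnj (a N) * of_real r ^ (n + N)) * (if int n - int N = 0 then 2 * of_real pi else 0))) {-pi..pi}"
      by (intro has_integral_sum has_integral_mult_right has_integral_circle_exp) auto
    also have "(\<Sum>n<N. (a n * cnj (a N) * of_real r ^ (n + N)) * (if int n - int N = 0 then 2 * of_real pi else 0)) = 0"
      by (intro sum.neutral) auto
    also have "(\<lambda>\<theta>. \<Sum>n<N. (a n * cnj (a N) * of_real r ^ (n + N)) * exp (\<i> * of_int (int n - int N) * of_real \<theta>))
        = (\<lambda>\<theta>. p \<theta> * cnj (q \<theta>))"
    proof
      fix \<theta> :: real
      have e: "exp (\<i> * of_int (int n - int N) * of_real \<theta>) = exp (\<i> * of_real \<theta>) ^ n * cnj (exp (\<i> * of_real \<theta>)) ^ N" for n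
        by (simp add: exp_cnj left_diff_distrib right_diff_distrib exp_diff exp_minus divide_inverse
            mult.assoc mult.left_commute power_inverse flip: exp_of_nat_mult)
      show "(\<Sum>n<N. (a n * cnj (a N) * of_real r ^ (n + N)) * exp (\<i> * of_int (int n - int N) * of_real \<theta>)) = p \<theta> * cnj (q \<theta>)"
        unfolding p_def q_def e sum_distrib_right circle_point_def
        by (intro sum.cong refl) (simp add: power_mult_distrib power_add mult_ac)
    qed
    finally show ?thesis .
  qed
  have "((\<lambda>\<theta>. Re (p \<theta> * cnj (q \<theta>))) has_integral Re 0) {-pi..pi}"
    using has_integral_linear[OF pq bounded_linear_Re] by (simp add: o_def)
  then have re: "((\<lambda>\<theta>. 2 * Re (p \<theta> * cnj (q \<theta>))) has_integral 2 * 0) {-pi..pi}"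
    by (intro has_integral_mult_right) simp
  have "((\<lambda>\<theta>. (cmod (a N))\<^sup>2 * r ^ (2 * N)) has_integral (2 * pi) *\<^sub>R ((cmod (a N))\<^sup>2 * r ^ (2 * N))) {-pi..pi}"
    using has_integral_const_real[of "(cmod (a N))\<^sup>2 * r ^ (2 * N)" "-pi" pi] by simp
  from has_integral_add[OF has_integral_add[OF Suc.IH this] re]
  have "((\<lambda>\<theta>. (cmod (p \<theta>))\<^sup>2 + (cmod (a N))\<^sup>2 * r ^ (2 * N) + 2 * Re (p \<theta> * cnj (q \<theta>))) has_integral
      2 * pi * (\<Sum>n<Suc N. (cmod (a n))\<^sup>2 * r ^ (2 * n))) {-pi..pi}"
    by (simp add: p_def algebra_simps)
  moreover have "(cmod (p \<theta>))\<^sup>2 + (cmod (a N))\<^sup>2 * r ^ (2 * N) + 2 * Re (p \<theta> * cnj (q \<theta>))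
      = (cmod (\<Sum>n<Suc N. a n * circle_point r \<theta> ^ n))\<^sup>2" for \<theta>
  proof -
    have "(cmod (q \<theta>))\<^sup>2 = (cmod (a N))\<^sup>2 * r ^ (2 * N)"
      by (simp add: q_def norm_mult norm_power power_mult_distrib mult.commute[of 2] power_mult)
         (simp add: power_even_abs flip: power_mult)
    moreover have "(cmod (p \<theta> + q \<theta>))\<^sup>2 = (cmod (p \<theta>))\<^sup>2 + (cmod (q \<theta>))\<^sup>2 + 2 * Re (p \<theta> * cnj (q \<theta>))"
      unfolding cmod_power2 by (simp add: power2_eq_square algebra_simps)
    ultimately show ?thesis by (simp add: p_def q_def)
  qed
  ultimately show ?case by simp
qed

text \<open>On a circle inside the disc the partial sums have a common bound, the absolutely
  convergent sum \<open>B\<close>, so dominated convergence passes from polynomials to power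
  series.\<close>

lemma circle_mean_sums:
  assumes g: "g holomorphic_on unit_disc" and r: "0 \<le> r" "r < 1"
  shows "(\<lambda>n. (cmod (maclaurin_coeff g n))\<^sup>2 * r ^ (2 * n)) sums circle_mean g r"
proof -
  let ?a = "maclaurin_coeff g"
  define B where "B = (\<Sum>n. cmod (?a n) * r ^ n)"
  have sm: "summable (\<lambda>n. cmod (?a n) * r ^ n)" by (rule maclaurin_summable_norm[OF g r])
  have bound: "cmod (\<Sum>n<N. ?a n * circle_point r \<theta> ^ n) \<le> B" for N \<theta>
  proof -
    have "cmod (\<Sum>n<N. ?a n * circle_point r \<theta> ^ n) \<le> (\<Sum>n<N. cmod (?a n) * r ^ n)"
      by (rule order_trans[OF norm_sum]) (use r in \<open>simp add: norm_mult norm_power\<close>)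
    also have "\<dots> \<le> B" unfolding B_def by (rule sum_le_suminf[OF sm]) (use r in auto)
    finally show ?thesis .
  qed
  have "(\<lambda>N. integral {-pi..pi} (\<lambda>\<theta>. (cmod (\<Sum>n<N. ?a n * circle_point r \<theta> ^ n))\<^sup>2))
      \<longlonglongrightarrow> integral {-pi..pi} (\<lambda>\<theta>. (cmod (g (circle_point r \<theta>)))\<^sup>2)"
  proof (rule dominated_convergence(2)[where h="\<lambda>\<theta>. B\<^sup>2"])
    show "(\<lambda>\<theta>. (cmod (\<Sum>n<N. ?a n * circle_point r \<theta> ^ n))\<^sup>2) integrable_on {-pi..pi}" for N
      using circle_mean_polynomial by blast
    show "(\<lambda>\<theta>. B\<^sup>2) integrable_on {-pi..pi}" by (intro integrable_continuous_real continuous_intros)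
    show "norm ((cmod (\<Sum>n<N. ?a n * circle_point r \<theta> ^ n))\<^sup>2) \<le> B\<^sup>2" for N \<theta>
      using bound by (auto intro!: power_mono)
    show "(\<lambda>N. (cmod (\<Sum>n<N. ?a n * circle_point r \<theta> ^ n))\<^sup>2) \<longlonglongrightarrow> (cmod (g (circle_point r \<theta>)))\<^sup>2" for \<theta>
      using maclaurin_sums[OF g, of "circle_point r \<theta>"] r
      by (intro tendsto_intros) (auto simp: sums_def)
  qed
  then have "(\<lambda>N. integral {-pi..pi} (\<lambda>\<theta>. (cmod (\<Sum>n<N. ?a n * circle_point r \<theta> ^ n))\<^sup>2) / (2 * pi))
      \<longlonglongrightarrow> circle_mean g r"
    unfolding circle_mean_def by (intro tendsto_divide tendsto_const) auto
  moreover have "integral {-pi..pi} (\<lambda>\<theta>. (cmod (\<Sum>n<N. ?a n * circle_point r \<theta> ^ n))\<^sup>2) / (2 * pi)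
      = (\<Sum>n<N. (cmod (?a n))\<^sup>2 * r ^ (2 * n))" for N
    using integral_unique[OF circle_mean_polynomial[where a="?a" and r=r and N=N]] by simp
  ultimately show ?thesis by (simp add: sums_def)
qed

lemma circle_mean_le:
  assumes "g holomorphic_on unit_disc" "0 \<le> r" "r < 1"
    and "h integrable_on {-pi..pi}" "\<And>\<theta>. \<theta> \<in> {-pi..pi} \<Longrightarrow> (cmod (g (circle_point r \<theta>)))\<^sup>2 \<le> h \<theta>"
  shows "circle_mean g r \<le> integral {-pi..pi} h / (2 * pi)"
  unfolding circle_mean_def
  by (intro divide_right_mono integral_le circle_integrable assms) auto

text \<open>The value is meaningful only once membership in the Hardy space is known. The lemmas
  \<open>hardy2_of_circle_mean\<close>, \<open>hardy2_of_bounded\<close> and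
  \<open>hardy2_of_limit\<close> derive this from a bound and return the norm estimate with
  it.\<close>

definition hardy2_of :: "(complex \<Rightarrow> complex) \<Rightarrow> hardy2"
  where "hardy2_of g = Abs_hardy2 (\<lambda>z. if z \<in> unit_disc then g z else 0)"

text \<open>Letting \<open>r\<close> tend to \<open>1\<close> in a partial sum of Parseval's
  identity bounds the partial sums of the squared coefficients by \<open>K\<close>. Pointwise
  estimates on circles thereby become norm estimates.\<close>

lemma hardy2_of_circle_mean:
  assumes g: "g holomorphic_on unit_disc"
    and K: "\<And>r. 0 \<le> r \<Longrightarrow> r < 1 \<Longrightarrow> circle_mean g r \<le> K"
  shows "z \<in> unit_disc \<Longrightarrow> hardy2_fun (hardy2_of g) z = g z"
    and "(norm (hardy2_of g))\<^sup>2 \<le> K"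
proof -
  let ?a = "maclaurin_coeff g" and ?g = "\<lambda>z. if z \<in> unit_disc then g z else 0"
  have partial: "(\<Sum>n<N. (cmod (?a n))\<^sup>2) \<le> K" for N
  proof -
    have le: "(\<Sum>n<N. (cmod (?a n))\<^sup>2 * r ^ (2 * n)) \<le> K" if r: "0 \<le> r" "r < 1" for r
    proof -
      have "(\<Sum>n<N. (cmod (?a n))\<^sup>2 * r ^ (2 * n)) \<le> (\<Sum>n. (cmod (?a n))\<^sup>2 * r ^ (2 * n))"
        using sums_summable[OF circle_mean_sums[OF g r]] r by (intro sum_le_suminf) auto
      also have "\<dots> = circle_mean g r" using sums_unique[OF circle_mean_sums[OF g r]] by simp
      finally show ?thesis using K[OF r] by simp
    qed
    have "((\<lambda>r. \<Sum>n<N. (cmod (?a n))\<^sup>2 * r ^ (2 * n)) \<longlongrightarrow> (\<Sum>n<N. (cmod (?a n))\<^sup>2 * 1 ^ (2 * n))) (at_left 1)"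
      by (intro tendsto_intros)
    moreover have "eventually (\<lambda>r. (\<Sum>n<N. (cmod (?a n))\<^sup>2 * r ^ (2 * n)) \<le> K) (at_left (1::real))"
      unfolding eventually_at_left_field using le by (intro exI[of _ 0]) auto
    ultimately show ?thesis using tendsto_upperbound[of _ _ "at_left (1::real)"] by fastforce
  qed
  have summ: "summable (\<lambda>n. (cmod (?a n))\<^sup>2)"
    by (rule summableI_nonneg_bounded[OF _ partial]) auto
  have coeff: "maclaurin_coeff ?g n = ?a n" for n
  proof -
    have "eventually (\<lambda>z. z \<in> unit_disc) (nhds (0::complex))"
      by (intro eventually_nhds_in_open) auto
    then have "eventually (\<lambda>z. ?g z = g z) (nhds 0)" by eventually_elim auto
    then show ?thesis unfolding maclaurin_coeff_def by (simp add: higher_deriv_cong_ev)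
  qed
  have "?g holomorphic_on unit_disc" using g by (subst holomorphic_cong[OF refl, of _ _ g]) auto
  then have fn: "hardy2_fun (hardy2_of g) = ?g"
    unfolding hardy2_of_def using coeff summ by (intro Abs_hardy2_inverse) auto
  then show "z \<in> unit_disc \<Longrightarrow> hardy2_fun (hardy2_of g) z = g z" by simp
  have "(norm (hardy2_of g))\<^sup>2 = (\<Sum>n. (cmod (?a n))\<^sup>2)"
    unfolding hardy2_norm_square hardy2_coeff_def fn coeff ..
  also have "\<dots> \<le> K" by (rule suminf_le_const[OF summ partial])
  finally show "(norm (hardy2_of g))\<^sup>2 \<le> K" .
qed

lemma circle_mean_hardy2_le:
  assumes "0 \<le> r" "r < 1"
  shows "circle_mean (hardy2_fun f) r \<le> (norm f)\<^sup>2"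
proof -
  note s = circle_mean_sums[OF hardy2_fun_holomorphic[of f] assms, folded hardy2_coeff_def]
  have "circle_mean (hardy2_fun f) r = (\<Sum>n. (cmod (hardy2_coeff f n))\<^sup>2 * r ^ (2 * n))"
    using s by (rule sums_unique)
  also have "\<dots> \<le> (\<Sum>n. (cmod (hardy2_coeff f n))\<^sup>2)"
    by (intro suminf_le sums_summable[OF s] summable_hardy2_coeff)
       (use assms in \<open>auto intro!: mult_left_le power_le_one\<close>)
  finally show ?thesis by (simp add: hardy2_norm_square)
qed

lemma hardy2_of_hardy2_fun [simp]: "hardy2_of (hardy2_fun f) = f"
  using hardy2_of_circle_mean(1)[OF hardy2_fun_holomorphic circle_mean_hardy2_le, of _ f]
  by (intro hardy2_eqI) auto

lemma hardy2_of_bounded: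
  assumes g: "g holomorphic_on unit_disc" and b: "\<And>z. z \<in> unit_disc \<Longrightarrow> cmod (g z) \<le> K"
  shows "z \<in> unit_disc \<Longrightarrow> hardy2_fun (hardy2_of g) z = g z"
    and "norm (hardy2_of g) \<le> K"
proof -
  have K: "K \<ge> 0" using b[of 0] norm_ge_zero[of "g 0"] by (simp del: norm_ge_zero)
  have m: "circle_mean g r \<le> K\<^sup>2" if "0 \<le> r" "r < 1" for r
  proof -
    have "circle_mean g r \<le> integral {-pi..pi} (\<lambda>\<theta>. K\<^sup>2) / (2 * pi)"
      by (rule circle_mean_le[OF g that]) (use that b in \<open>auto intro!: power_mono\<close>)
    then show ?thesis by simp
  qed
  show "z \<in> unit_disc \<Longrightarrow> hardy2_fun (hardy2_of g) z = g z"
    by (rule hardy2_of_circle_mean(1)[OF g m])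
  show "norm (hardy2_of g) \<le> K"
    using hardy2_of_circle_mean(2)[OF g m] K by (simp add: power2_le_iff_abs_le)
qed

text \<open>The angles at most \<open>pi * \<delta>\<close> form an arc of normalised length
  \<open>\<delta>\<close>, where only the bound \<open>K\<close> is available; on the rest of the
  circle the smaller bound applies. This makes an operator with bounded values small in norm once
  its values are small away from \<open>1\<close>.\<close>

lemma hardy2_of_bounded_small:
  assumes g: "g holomorphic_on unit_disc" and b: "\<And>z. z \<in> unit_disc \<Longrightarrow> cmod (g z) \<le> K"
    and e: "\<And>z. z \<in> unit_disc \<Longrightarrow> \<delta> \<le> cmod (z - 1) \<Longrightarrow> cmod (g z) \<le> \<epsilon>" and \<delta>: "0 < \<delta>" "\<delta> \<le> 1"
  shows "(norm (hardy2_of g))\<^sup>2 \<le> \<epsilon>\<^sup>2 + K\<^sup>2 * \<delta>"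
proof (rule hardy2_of_circle_mean(2)[OF g])
  fix r :: real assume r: "0 \<le> r" "r < 1"
  define h where "h \<theta> = \<epsilon>\<^sup>2 + (if \<theta> \<in> {-(pi*\<delta>)..pi*\<delta>} then K\<^sup>2 else 0)" for \<theta> :: real
  have sub: "{-(pi*\<delta>)..pi*\<delta>} \<subseteq> {-pi..pi}" using \<delta> by auto
  have 1: "((\<lambda>\<theta>. K\<^sup>2) has_integral (2 * pi * \<delta>) * K\<^sup>2) {-(pi*\<delta>)..pi*\<delta>}"
    using has_integral_const_real[of "K\<^sup>2" "-(pi*\<delta>)" "pi*\<delta>"] \<delta> by (simp add: mult.assoc)
  have "(h has_integral ((2 * pi) * \<epsilon>\<^sup>2 + (2 * pi * \<delta>) * K\<^sup>2)) {-pi..pi}"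
    unfolding h_def
  proof (rule has_integral_add)
    show "((\<lambda>\<theta>. \<epsilon>\<^sup>2) has_integral (2 * pi) * \<epsilon>\<^sup>2) {-pi..pi}"
      using has_integral_const_real[of "\<epsilon>\<^sup>2" "-pi" pi] by simp
    show "((\<lambda>\<theta>. if \<theta> \<in> {-(pi*\<delta>)..pi*\<delta>} then K\<^sup>2 else 0) has_integral (2 * pi * \<delta>) * K\<^sup>2) {-pi..pi}"
      using has_integral_restrict[OF sub, of "\<lambda>\<theta>. K\<^sup>2"] 1 by simp
  qed
  then have hi: "h integrable_on {-pi..pi}" "integral {-pi..pi} h = (2 * pi) * \<epsilon>\<^sup>2 + (2 * pi * \<delta>) * K\<^sup>2"
    by (auto simp: has_integral_iff)
  have "circle_mean g r \<le> integral {-pi..pi} h / (2 * pi)"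
  proof (rule circle_mean_le[OF g r hi(1)])
    fix \<theta> :: real assume \<theta>: "\<theta> \<in> {-pi..pi}"
    let ?z = "circle_point r \<theta>"
    have z: "?z \<in> unit_disc" using r by simp
    show "(cmod (g ?z))\<^sup>2 \<le> h \<theta>"
    proof (cases "\<delta> \<le> cmod (?z - 1)")
      case True
      then show ?thesis
        using power_mono[OF e[OF z True] norm_ge_zero, of 2] zero_le_power2[of K]
        by (simp add: h_def add_increasing2)
    next
      case False
      let ?e = "exp (\<i> * of_real \<theta>)"
      \<comment> \<open>Radial projection to the unit circle at most doubles the distance to
        \<open>1\<close>, because \<open>1 - r\<close> is at most \<open>cmod (?z - 1)\<close>. The
        bound on the angle is thus uniform in \<open>r\<close>.\<close>
      have "cmod (?e - 1) \<le> cmod (?z - 1) + cmod (?e - ?z)"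
        using norm_triangle_ineq[of "?z - 1" "?e - ?z"] by simp
      also have "cmod (?e - ?z) = 1 - r"
      proof -
        have "?e - ?z = of_real (1 - r) * ?e" by (simp add: circle_point_def algebra_simps)
        then show ?thesis using r by (simp only: norm_mult norm_of_real norm_exp_i_times) simp
      qed
      also have "1 - r \<le> cmod (?z - 1)"
        using norm_triangle_ineq2[of 1 ?z] r by (simp add: norm_minus_commute)
      finally have small: "cmod (?e - 1) < 2 * \<delta>" using False by simp
      have "2 * \<bar>\<theta>\<bar> / pi \<le> cmod (?e - 1)"
      proof -
        have jordan: "2 * x / pi \<le> sin x" if "0 \<le> x" "x \<le> pi / 2" for x
        proof -
          \<comment> \<open>Jordan's inequality: the concave sine lies above its chord on
            \<open>[0, pi/2]\<close>.\<close>
          have cv: "convex_on {0..pi/2} (\<lambda>x. - sin x)"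
          proof (rule f''_ge0_imp_convex[where f'="\<lambda>x. - cos x" and f''=sin])
            fix x assume "x \<in> {0..pi/2}"
            then show "sin x \<ge> 0" by (intro sin_ge_zero) auto
          qed (auto intro!: derivative_eq_intros)
          define t where "t = 2 * x / pi"
          have t: "0 \<le> t" "t \<le> 1" using that by (auto simp: t_def field_simps)
          have "- sin ((1 - t) *\<^sub>R 0 + t *\<^sub>R (pi/2)) \<le> (1 - t) * (- sin 0) + t * (- sin (pi/2))"
            by (rule convex_onD[OF cv t]) auto
          then show ?thesis by (simp add: t_def)
        qed
        have "cmod (?e - 1) = 2 * \<bar>sin (\<theta> / 2)\<bar>" by (rule dist_exp_i_1)
        moreover have "2 * (\<bar>\<theta>\<bar>/2) / pi \<le> sin (\<bar>\<theta>\<bar>/2)" using \<theta> by (intro jordan) auto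
        moreover have "sin (\<bar>\<theta>\<bar>/2) \<le> \<bar>sin (\<theta>/2)\<bar>" by (cases "\<theta> \<ge> 0") auto
        ultimately show ?thesis by simp
      qed
      then have "2 * \<bar>\<theta>\<bar> / pi \<le> 2 * \<delta>" using small by linarith
      then have "\<bar>\<theta>\<bar> \<le> pi * \<delta>" by (simp add: field_simps)
      then have "\<theta> \<in> {-(pi*\<delta>)..pi*\<delta>}" by auto
      then show ?thesis
        using power_mono[OF b[OF z] norm_ge_zero, of 2] zero_le_power2[of \<epsilon>]
        by (simp add: h_def add_increasing)
    qed
  qed
  also have "\<dots> = \<epsilon>\<^sup>2 + K\<^sup>2 * \<delta>" by (simp add: hi(2) add_divide_distrib)
  finally show "circle_mean g r \<le> \<epsilon>\<^sup>2 + K\<^sup>2 * \<delta>" .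
qed

text \<open>A Fatou property. On each circle the evaluation bound dominates the sequence, so the
  circle means converge and keep the bound \<open>K\<^sup>2\<close>.\<close>

lemma hardy2_of_limit:
  fixes h :: "nat \<Rightarrow> hardy2"
  assumes g: "g holomorphic_on unit_disc" and K: "\<And>n. norm (h n) \<le> K"
    and lim: "\<And>z. z \<in> unit_disc \<Longrightarrow> (\<lambda>n. hardy2_fun (h n) z) \<longlonglongrightarrow> g z"
  shows "z \<in> unit_disc \<Longrightarrow> hardy2_fun (hardy2_of g) z = g z"
    and "norm (hardy2_of g) \<le> K"
proof -
  have K0: "K \<ge> 0" using K[of 0] norm_ge_zero[of "h 0"] by linarith
  have m: "circle_mean g r \<le> K\<^sup>2" if r: "0 \<le> r" "r < 1" for r
  proof -
    have "(\<lambda>n. integral {-pi..pi} (\<lambda>\<theta>. (cmod (hardy2_fun (h n) (circle_point r \<theta>)))\<^sup>2))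
        \<longlonglongrightarrow> integral {-pi..pi} (\<lambda>\<theta>. (cmod (g (circle_point r \<theta>)))\<^sup>2)"
    proof (rule dominated_convergence(2)[where h="\<lambda>\<theta>. (K / sqrt (1 - r\<^sup>2))\<^sup>2"])
      show "(\<lambda>\<theta>. (cmod (hardy2_fun (h n) (circle_point r \<theta>)))\<^sup>2) integrable_on {-pi..pi}" for n
        by (rule circle_integrable[OF hardy2_fun_holomorphic r])
      show "(\<lambda>\<theta>. (K / sqrt (1 - r\<^sup>2))\<^sup>2) integrable_on {-pi..pi}"
        by (intro integrable_continuous_real continuous_intros)
      show "norm ((cmod (hardy2_fun (h n) (circle_point r \<theta>)))\<^sup>2) \<le> (K / sqrt (1 - r\<^sup>2))\<^sup>2" for n \<theta>
      proof -
        have "cmod (hardy2_fun (h n) (circle_point r \<theta>)) \<le> norm (h n) / sqrt (1 - r\<^sup>2)"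
          using hardy2_eval_bound[of "circle_point r \<theta>" "h n"] r by simp
        also have "\<dots> \<le> K / sqrt (1 - r\<^sup>2)"
          using K r by (intro divide_right_mono) (auto simp: power_le_one)
        finally show ?thesis by (simp add: power_mono)
      qed
      show "(\<lambda>n. (cmod (hardy2_fun (h n) (circle_point r \<theta>)))\<^sup>2) \<longlonglongrightarrow> (cmod (g (circle_point r \<theta>)))\<^sup>2" for \<theta>
        using r by (intro tendsto_intros lim) auto
    qed
    then have "(\<lambda>n. circle_mean (hardy2_fun (h n)) r) \<longlonglongrightarrow> circle_mean g r"
      unfolding circle_mean_def by (intro tendsto_divide tendsto_const) auto
    moreover have "circle_mean (hardy2_fun (h n)) r \<le> K\<^sup>2" for n
      using circle_mean_hardy2_le[OF r, of "h n"] power_mono[OF K norm_ge_zero, of n 2] by linarith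
    ultimately show ?thesis by (intro LIMSEQ_le_const2) auto
  qed
  show "z \<in> unit_disc \<Longrightarrow> hardy2_fun (hardy2_of g) z = g z"
    by (rule hardy2_of_circle_mean(1)[OF g m])
  show "norm (hardy2_of g) \<le> K"
    using hardy2_of_circle_mean(2)[OF g m] K0 by (simp add: power2_le_iff_abs_le)
qed

instance hardy2 :: banach
proof
  fix f :: "nat \<Rightarrow> hardy2" assume f: "Cauchy f"
  have unif: "\<exists>N. \<forall>m\<ge>N. \<forall>n\<ge>N. \<forall>z\<in>cball 0 r. dist (hardy2_fun (f m) z) (hardy2_fun (f n) z) < e"
    if r: "0 \<le> r" "r < 1" and e: "e > 0" for r e
  proof -
    have q: "0 < sqrt (1 - r\<^sup>2)" using r by (simp add: power_less_one_iff abs_square_less_1)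
    then obtain N where N: "\<And>m n. m \<ge> N \<Longrightarrow> n \<ge> N \<Longrightarrow> dist (f m) (f n) < e * sqrt (1 - r\<^sup>2)"
      using metric_CauchyD[OF f, of "e * sqrt (1 - r\<^sup>2)"] e by auto
    have "dist (hardy2_fun (f m) z) (hardy2_fun (f n) z) < e"
      if "m \<ge> N" "n \<ge> N" "z \<in> cball 0 r" for m n z
    proof -
      have zr: "cmod z \<le> r" using that by simp
      have "dist (hardy2_fun (f m) z) (hardy2_fun (f n) z) \<le> norm (f m - f n) / sqrt (1 - (cmod z)\<^sup>2)"
        using hardy2_eval_bound[of z "f m - f n"] zr r by (simp add: hardy2_fun_diff dist_norm)
      also have "\<dots> \<le> norm (f m - f n) / sqrt (1 - r\<^sup>2)"
        using zr q r order.strict_trans1[OF zr r(2)]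
        by (intro divide_left_mono) (auto intro!: power_mono mult_pos_pos simp: power_less_one_iff)
      also have "\<dots> < e" using N[OF that(1,2)] q by (simp add: dist_norm field_simps)
      finally show ?thesis .
    qed
    then show ?thesis by blast
  qed
  define g where "g z = lim (\<lambda>n. hardy2_fun (f n) z)" for z
  have lim: "(\<lambda>n. hardy2_fun (f n) z) \<longlonglongrightarrow> g z" if z: "z \<in> unit_disc" for z
  proof -
    have "Cauchy (\<lambda>n. hardy2_fun (f n) z)"
      by (rule metric_CauchyI) (use unif[of "cmod z"] z in fastforce)
    then show ?thesis unfolding g_def by (simp add: Cauchy_convergent_iff convergent_LIMSEQ_iff)
  qed
  have "g holomorphic_on unit_disc"
  proof (rule holomorphic_uniform_sequence[OF open_ball hardy2_fun_holomorphic])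
    fix x :: complex assume x: "x \<in> unit_disc"
    define d where "d = (1 - cmod x) / 2"
    have d: "d > 0" "cmod x + d < 1" using x by (auto simp: d_def field_simps)
    have sub: "cball x d \<subseteq> cball 0 (cmod x + d)"
      by (auto simp: dist_norm) (metis add.commute add_le_cancel_right diff_le_eq norm_minus_commute norm_triangle_ineq2 order_trans)
    have "uniformly_Cauchy_on (cball x d) (\<lambda>n. hardy2_fun (f n))"
      unfolding uniformly_Cauchy_on_def
    proof (intro allI impI)
      fix e :: real assume "e > 0"
      then show "\<exists>M. \<forall>x\<in>cball x d. \<forall>m\<ge>M. \<forall>n\<ge>M. dist (hardy2_fun (f m) x) (hardy2_fun (f n) x) < e"
        using unif[of "cmod x + d" e] d sub by (meson add_nonneg_nonneg less_imp_le norm_ge_zero subsetD)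
    qed
    then have "uniform_limit (cball x d) (\<lambda>n. hardy2_fun (f n)) g sequentially"
      unfolding g_def uniformly_convergent_uniform_limit_iff[symmetric]
      by (rule Cauchy_uniformly_convergent)
    moreover have "cball x d \<subseteq> unit_disc" using sub d by auto
    ultimately show "\<exists>d>0. cball x d \<subseteq> unit_disc \<and> uniform_limit (cball x d) (\<lambda>n. hardy2_fun (f n)) g sequentially"
      using d by blast
  qed
  note g = this
  have "f \<longlonglongrightarrow> hardy2_of g"
  proof (rule metric_LIMSEQ_I)
    fix e :: real assume e: "e > 0"
    then obtain N where N: "\<And>m n. m \<ge> N \<Longrightarrow> n \<ge> N \<Longrightarrow> dist (f m) (f n) < e / 2"
      using metric_CauchyD[OF f, of "e / 2"] by auto
    have bd: "norm (f n) \<le> norm (f N) + e / 2" if "n \<ge> N" for n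
      using N[OF that order_refl] norm_triangle_ineq2[of "f n" "f N"] by (simp add: dist_norm)
    have gv: "hardy2_fun (hardy2_of g) z = g z" if "z \<in> unit_disc" for z
      by (rule hardy2_of_limit(1)[OF g, of "\<lambda>n. f (n + N)" "norm (f N) + e / 2"])
         (use bd that lim in \<open>auto intro: LIMSEQ_ignore_initial_segment\<close>)
    have "dist (f m) (hardy2_of g) < e" if m: "m \<ge> N" for m
    proof -
      \<comment> \<open>With \<open>m\<close> fixed, the Fatou property is applied to the
        differences \<open>f (n + N) - f m\<close>; this upgrades pointwise convergence to norm
        convergence.\<close>
      have "norm (hardy2_of (\<lambda>z. g z - hardy2_fun (f m) z)) \<le> e / 2"
      proof (rule hardy2_of_limit(2)[where h="\<lambda>n. f (n + N) - f m"])
        show "(\<lambda>z. g z - hardy2_fun (f m) z) holomorphic_on unit_disc"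
          by (intro holomorphic_intros g hardy2_fun_holomorphic)
        show "norm (f (n + N) - f m) \<le> e / 2" for n
          using N[of "n + N" m] m by (simp add: dist_norm less_imp_le)
        show "(\<lambda>n. hardy2_fun (f (n + N) - f m) z) \<longlonglongrightarrow> g z - hardy2_fun (f m) z" if "z \<in> unit_disc" for z
          unfolding hardy2_fun_diff
          by (intro tendsto_diff tendsto_const LIMSEQ_ignore_initial_segment[OF lim[OF that]])
      qed
      moreover have "hardy2_of (\<lambda>z. g z - hardy2_fun (f m) z) = hardy2_of g - f m"
      proof -
        have "hardy2_of (\<lambda>z. g z - hardy2_fun (f m) z) = hardy2_of (hardy2_fun (hardy2_of g - f m))"
          unfolding hardy2_of_def[of "\<lambda>z. g z - hardy2_fun (f m) z"]
            hardy2_of_def[of "hardy2_fun (hardy2_of g - f m)"] hardy2_fun_diff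
          by (rule arg_cong[where f=Abs_hardy2]) (auto simp: gv)
        then show ?thesis by simp
      qed
      ultimately show ?thesis using e by (simp add: dist_norm norm_minus_commute)
    qed
    then show "\<exists>no. \<forall>n\<ge>no. dist (f n) (hardy2_of g) < e" by blast
  qed
  then show "convergent f" by (rule convergentI)
qed

section \<open>Weighted composition with linear fractional maps\<close>

lemma hardy2_coeff_unique:
  assumes "\<And>z. z \<in> unit_disc \<Longrightarrow> (\<lambda>n. a n * z ^ n) sums hardy2_fun f z"
  shows "hardy2_coeff f n = a n"
proof -
  have "eventually (\<lambda>z. z \<in> unit_disc) (nhds (0::complex))"
    by (intro eventually_nhds_in_open) auto
  then have "eventually (\<lambda>z. (\<lambda>n. fps_nth (Abs_fps a) n * z ^ n) sums hardy2_fun f z) (nhds 0)"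
    by eventually_elim (use assms in simp)
  then have "hardy2_fun f has_fps_expansion Abs_fps a" by (rule has_fps_expansionI)
  from fps_nth_fps_expansion[OF this] show ?thesis
    by (simp add: hardy2_coeff_def maclaurin_coeff_def)
qed

lemma hardy2_of_polynomial:
  fixes c :: "nat \<Rightarrow> complex" and N :: nat
  defines "P \<equiv> \<lambda>z. \<Sum>n<N. c n * z ^ n"
  shows "z \<in> unit_disc \<Longrightarrow> hardy2_fun (hardy2_of P) z = P z"
    and "(norm (hardy2_of P))\<^sup>2 \<le> (\<Sum>n<N. (cmod (c n))\<^sup>2)"
proof -
  have P: "P holomorphic_on unit_disc" unfolding P_def by (intro holomorphic_intros)
  have m: "circle_mean P r \<le> (\<Sum>n<N. (cmod (c n))\<^sup>2)" if "0 \<le> r" "r < 1" for r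
  proof -
    have "circle_mean P r = (\<Sum>n<N. (cmod (c n))\<^sup>2 * r ^ (2 * n))"
      using integral_unique[OF circle_mean_polynomial[where a=c and N=N and r=r]]
      by (simp add: circle_mean_def P_def)
    also have "\<dots> \<le> (\<Sum>n<N. (cmod (c n))\<^sup>2)"
      using that by (intro sum_mono mult_left_le power_le_one) auto
    finally show ?thesis .
  qed
  show "z \<in> unit_disc \<Longrightarrow> hardy2_fun (hardy2_of P) z = P z"
    "(norm (hardy2_of P))\<^sup>2 \<le> (\<Sum>n<N. (cmod (c n))\<^sup>2)"
    using hardy2_of_circle_mean[OF P m] by auto
qed

text \<open>It suffices to test on polynomials: the images of the Taylor polynomials of
  \<open>f\<close> are bounded in norm and converge pointwise, so \<open>hardy2_of_limit\<close>
  applies.\<close>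

lemma weighted_composition_bound:
  assumes u: "u holomorphic_on unit_disc" and \<alpha>: "\<alpha> holomorphic_on unit_disc" "\<alpha> ` unit_disc \<subseteq> unit_disc"
    and K: "0 \<le> K"
    and poly: "\<And>a N. \<exists>h. (\<forall>z\<in>unit_disc. hardy2_fun h z = u z * (\<Sum>n<N. a n * \<alpha> z ^ n)) \<and>
      (norm h)\<^sup>2 \<le> K\<^sup>2 * (\<Sum>n<N. (cmod (a n))\<^sup>2)"
  shows "z \<in> unit_disc \<Longrightarrow> hardy2_fun (hardy2_of (\<lambda>z. u z * hardy2_fun f (\<alpha> z))) z = u z * hardy2_fun f (\<alpha> z)"
    and "norm (hardy2_of (\<lambda>z. u z * hardy2_fun f (\<alpha> z))) \<le> K * norm f"
proof -
  have "\<forall>N. \<exists>h. (\<forall>z\<in>unit_disc. hardy2_fun h z = u z * (\<Sum>n<N. hardy2_coeff f n * \<alpha> z ^ n)) \<and>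
      (norm h)\<^sup>2 \<le> K\<^sup>2 * (\<Sum>n<N. (cmod (hardy2_coeff f n))\<^sup>2)"
    using poly by blast
  from choice[OF this] obtain h where
    h': "\<forall>N. (\<forall>z\<in>unit_disc. hardy2_fun (h N) z = u z * (\<Sum>n<N. hardy2_coeff f n * \<alpha> z ^ n)) \<and>
      (norm (h N))\<^sup>2 \<le> K\<^sup>2 * (\<Sum>n<N. (cmod (hardy2_coeff f n))\<^sup>2)" by blast
  have h: "hardy2_fun (h N) z = u z * (\<Sum>n<N. hardy2_coeff f n * \<alpha> z ^ n)" if "z \<in> unit_disc" for N z
    using h' that by blast
  have hn: "(norm (h N))\<^sup>2 \<le> K\<^sup>2 * (\<Sum>n<N. (cmod (hardy2_coeff f n))\<^sup>2)" for N
    using h' by blast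
  have n: "norm (h N) \<le> K * norm f" for N
  proof -
    have "(norm (h N))\<^sup>2 \<le> K\<^sup>2 * (norm f)\<^sup>2"
      unfolding hardy2_norm_square[of f]
      by (rule order_trans[OF hn]) (intro mult_left_mono sum_le_suminf summable_hardy2_coeff; simp)
    then have "(norm (h N))\<^sup>2 \<le> (K * norm f)\<^sup>2" by (simp only: power_mult_distrib)
    then show ?thesis by (rule power2_le_imp_le) (use K in simp)
  qed
  have g: "(\<lambda>z. u z * hardy2_fun f (\<alpha> z)) holomorphic_on unit_disc"
    using holomorphic_on_compose_gen[OF \<alpha>(1) hardy2_fun_holomorphic \<alpha>(2)] u
    by (auto simp: o_def intro!: holomorphic_intros)
  have lim: "(\<lambda>N. hardy2_fun (h N) z) \<longlonglongrightarrow> u z * hardy2_fun f (\<alpha> z)" if z: "z \<in> unit_disc" for z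
    unfolding h[OF z]
    using hardy2_fun_sums[OF subsetD[OF \<alpha>(2) imageI[OF z]], of f]
    by (intro tendsto_intros) (simp add: sums_def)
  show "z \<in> unit_disc \<Longrightarrow> hardy2_fun (hardy2_of (\<lambda>z. u z * hardy2_fun f (\<alpha> z))) z = u z * hardy2_fun f (\<alpha> z)"
    "norm (hardy2_of (\<lambda>z. u z * hardy2_fun f (\<alpha> z))) \<le> K * norm f"
    using hardy2_of_limit[OF g n lim] by auto
qed

text \<open>The full series is the negative binomial one, with sum \<open>1 / s\<close>. By Pascal's
  rule the row \<open>j + 1\<close> is a convex combination, with weights \<open>s\<close> and
  \<open>1 - s\<close>, of the rows \<open>j\<close> and \<open>j + 1\<close> with one summand
  fewer, which preserves the bound.\<close>

lemma binomial_row_sum_le: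
  fixes s :: real
  assumes "0 < s" "s \<le> 1"
  shows "(\<Sum>n<N. real (n choose k) * s ^ k * (1 - s) ^ (n - k)) \<le> 1 / s"
proof (induction N arbitrary: k)
  case 0
  then show ?case using assms by simp
next
  case (Suc N)
  show ?case
  proof (cases k)
    case 0
    have "(\<Sum>n<Suc N. real (n choose k) * s ^ k * (1 - s) ^ (n - k)) = (\<Sum>n<Suc N. (1 - s) ^ n)"
      using 0 by simp
    also have "\<dots> = (1 - (1 - s) ^ Suc N) / s"
      using assms by (subst sum_gp_strict) simp
    also have "\<dots> \<le> 1 / s" using assms by (intro divide_right_mono) auto
    finally show ?thesis .
  next
    case (Suc j)
    have pascal: "real (Suc n choose Suc j) * s ^ Suc j * (1 - s) ^ (Suc n - Suc j) =
        s * (real (n choose j) * s ^ j * (1 - s) ^ (n - j)) +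
        (1 - s) * (real (n choose Suc j) * s ^ Suc j * (1 - s) ^ (n - Suc j))" for n
    proof (cases "n \<ge> Suc j")
      case True
      then have "n - j = Suc (n - Suc j)" by simp
      then show ?thesis by (simp add: algebra_simps)
    next
      case False
      then show ?thesis by (simp add: binomial_eq_0)
    qed
    have "(\<Sum>n<Suc N. real (n choose k) * s ^ k * (1 - s) ^ (n - k)) =
        (\<Sum>n<N. real (Suc n choose Suc j) * s ^ Suc j * (1 - s) ^ (Suc n - Suc j))"
      unfolding Suc by (subst sum.lessThan_Suc_shift) simp
    also have "\<dots> = s * (\<Sum>n<N. real (n choose j) * s ^ j * (1 - s) ^ (n - j)) +
        (1 - s) * (\<Sum>n<N. real (n choose Suc j) * s ^ Suc j * (1 - s) ^ (n - Suc j))"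
      unfolding pascal sum.distrib sum_distrib_left ..
    also have "\<dots> \<le> s * (1 / s) + (1 - s) * (1 / s)"
      using assms by (intro add_mono mult_left_mono Suc.IH) auto
    also have "\<dots> = 1 / s" using assms by (simp add: field_simps)
    finally show ?thesis .
  qed
qed

text \<open>
  Schur's test: the matrix of the composition operator is \<open>(n choose k) s\<^sup>k (1 - s)\<^bsup>n - k\<^esup>\<close>,
  with column sums \<open>1\<close> and row sums at most \<open>1 / s\<close>.
\<close>

lemma affine_composition_bound:
  fixes s :: real
  assumes s: "0 < s" "s < 1"
  defines "A \<equiv> \<lambda>z. 1 - of_real s * (1 - z)"
  shows "z \<in> unit_disc \<Longrightarrow> hardy2_fun (hardy2_of (\<lambda>z. hardy2_fun f (A z))) z = hardy2_fun f (A z)"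
    and "norm (hardy2_of (\<lambda>z. hardy2_fun f (A z))) \<le> 1 / sqrt s * norm f"
proof -
  have A: "A holomorphic_on unit_disc" unfolding A_def by (intro holomorphic_intros)
  have Ain: "A ` unit_disc \<subseteq> unit_disc"
  proof (clarsimp simp: A_def)
    fix z :: complex assume z: "cmod z < 1"
    have "cmod (1 - of_real s * (1 - z)) = cmod (of_real (1 - s) + of_real s * z)"
      by (simp add: algebra_simps)
    also have "\<dots> \<le> (1 - s) + s * cmod z"
      by (rule order_trans[OF norm_triangle_ineq]) (use s in \<open>simp only: norm_mult norm_of_real; simp\<close>)
    also have "\<dots> < 1" using s z by simp
    finally show "cmod (1 - of_real s * (1 - z)) < 1" .
  qed
  have poly: "\<exists>h. (\<forall>z\<in>unit_disc. hardy2_fun h z = 1 * (\<Sum>n<N. a n * A z ^ n)) \<and>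
      (norm h)\<^sup>2 \<le> (1 / sqrt s)\<^sup>2 * (\<Sum>n<N. (cmod (a n))\<^sup>2)" for a :: "nat \<Rightarrow> complex" and N
  proof -
    define w where "w k n = real (n choose k) * s ^ k * (1 - s) ^ (n - k)" for k n
    have w0: "w k n \<ge> 0" for k n using s by (simp add: w_def)
    define c where "c k = (\<Sum>n<N. of_real (w k n) * a n)" for k
    have Apow: "A z ^ n = (\<Sum>k<N. of_real (w k n) * z ^ k)" if "n < N" for n z
    proof -
      have "A z ^ n = (of_real s * z + of_real (1 - s)) ^ n" by (simp add: A_def algebra_simps)
      also have "\<dots> = (\<Sum>k\<le>n. of_nat (n choose k) * (of_real s * z) ^ k * of_real (1 - s) ^ (n - k))"
        by (rule binomial_ring)
      also have "\<dots> = (\<Sum>k\<le>n. of_real (w k n) * z ^ k)"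
        by (intro sum.cong refl) (simp add: w_def power_mult_distrib mult_ac)
      also have "\<dots> = (\<Sum>k<N. of_real (w k n) * z ^ k)"
        using that by (intro sum.mono_neutral_left) (auto simp: w_def)
      finally show ?thesis .
    qed
    \<comment> \<open>The column sum is the value of the polynomial \<open>A z ^ n\<close> at the
      fixed point \<open>1\<close> of \<open>A\<close>.\<close>
    have col: "(\<Sum>k<N. w k n) = 1" if "n < N" for n
    proof -
      have "of_real (\<Sum>k<N. w k n) = A 1 ^ n" using Apow[OF that, of 1] by simp
      then have "of_real (\<Sum>k<N. w k n) = (1::complex)" by (simp add: A_def)
      then show ?thesis by (simp only: of_real_eq_1_iff)
    qed
    have "(\<Sum>n<N. a n * A z ^ n) = (\<Sum>k<N. c k * z ^ k)" for z
    proof -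
      have "(\<Sum>n<N. a n * A z ^ n) = (\<Sum>n<N. \<Sum>k<N. of_real (w k n) * a n * z ^ k)"
        by (intro sum.cong refl) (simp add: Apow sum_distrib_left mult_ac)
      also have "\<dots> = (\<Sum>k<N. c k * z ^ k)"
        by (subst sum.swap) (simp add: c_def sum_distrib_right)
      finally show ?thesis .
    qed
    moreover have "(\<Sum>k<N. (cmod (c k))\<^sup>2) \<le> (1 / sqrt s)\<^sup>2 * (\<Sum>n<N. (cmod (a n))\<^sup>2)"
    proof -
      have ck: "(cmod (c k))\<^sup>2 \<le> 1 / s * (\<Sum>n<N. w k n * (cmod (a n))\<^sup>2)" for k
      proof -
        \<comment> \<open>Splitting each weight into two square roots lets Cauchy-Schwarz use the
          row sum in one factor and leave the column sum for the other.\<close>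
        have "cmod (c k) \<le> (\<Sum>n<N. \<bar>sqrt (w k n)\<bar> * \<bar>sqrt (w k n) * cmod (a n)\<bar>)"
          unfolding c_def
          by (rule order_trans[OF norm_sum])
             (use w0 in \<open>simp add: norm_mult abs_mult flip: mult.assoc\<close>)
        also have "\<dots> \<le> L2_set (\<lambda>n. sqrt (w k n)) {..<N} * L2_set (\<lambda>n. sqrt (w k n) * cmod (a n)) {..<N}"
          by (rule L2_set_mult_ineq)
        finally have "(cmod (c k))\<^sup>2 \<le> (L2_set (\<lambda>n. sqrt (w k n)) {..<N} * L2_set (\<lambda>n. sqrt (w k n) * cmod (a n)) {..<N})\<^sup>2"
          by (rule power_mono) simp
        also have "\<dots> = (\<Sum>n<N. w k n) * (\<Sum>n<N. w k n * (cmod (a n))\<^sup>2)"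
          unfolding power_mult_distrib L2_set_def
          using w0 by (subst (1 2) real_sqrt_pow2) (auto intro!: sum_nonneg simp: power_mult_distrib)
        also have "\<dots> \<le> 1 / s * (\<Sum>n<N. w k n * (cmod (a n))\<^sup>2)"
          using binomial_row_sum_le[of s k N] s w0
          by (intro mult_right_mono sum_nonneg) (auto simp: w_def)
        finally show ?thesis .
      qed
      have "(\<Sum>k<N. (cmod (c k))\<^sup>2) \<le> (\<Sum>k<N. 1 / s * (\<Sum>n<N. w k n * (cmod (a n))\<^sup>2))"
        by (intro sum_mono ck)
      also have "\<dots> = 1 / s * (\<Sum>n<N. (\<Sum>k<N. w k n) * (cmod (a n))\<^sup>2)"
        by (subst sum_distrib_left[symmetric], subst sum.swap) (simp add: sum_distrib_right)
      also have "\<dots> = 1 / s * (\<Sum>n<N. (cmod (a n))\<^sup>2)" using col by simp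
      finally show ?thesis using s by (simp add: power_divide)
    qed
    ultimately show ?thesis
      using hardy2_of_polynomial[where c=c and N=N] by (intro exI[of _ "hardy2_of (\<lambda>z. \<Sum>k<N. c k * z ^ k)"]) auto
  qed
  have K: "0 \<le> 1 / sqrt s" using s by simp
  show "z \<in> unit_disc \<Longrightarrow> hardy2_fun (hardy2_of (\<lambda>z. hardy2_fun f (A z))) z = hardy2_fun f (A z)"
    "norm (hardy2_of (\<lambda>z. hardy2_fun f (A z))) \<le> 1 / sqrt s * norm f"
    using weighted_composition_bound[OF _ A Ain K, of "\<lambda>_. 1", OF _ poly] by auto
qed

text \<open>
  With \<open>\<beta> z = (cnj g * z - cnj q) / (g - q * z)\<close> and \<open>e z = 1 / (g - q * z)\<close>, the functions
  \<open>e \<beta>\<^sup>n\<close> are orthogonal: \<open>e\<close> is a multiple of the reproducing kernel at the zero of \<open>\<beta>\<close>.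
\<close>

lemma automorphism_composition_bound:
  fixes g q :: complex and p :: real
  assumes p: "(cmod g)\<^sup>2 - (cmod q)\<^sup>2 = p" "p > 0"
  defines "\<beta> \<equiv> \<lambda>z. (cnj g * z - cnj q) / (g - q * z)"
  shows "z \<in> unit_disc \<Longrightarrow> g - q * z \<noteq> 0" "z \<in> unit_disc \<Longrightarrow> \<beta> z \<in> unit_disc" "\<beta> holomorphic_on unit_disc"
    and "z \<in> unit_disc \<Longrightarrow> hardy2_fun (hardy2_of (\<lambda>z. 1 / (g - q * z) * hardy2_fun f (\<beta> z))) z
        = 1 / (g - q * z) * hardy2_fun f (\<beta> z)"
    and "norm (hardy2_of (\<lambda>z. 1 / (g - q * z) * hardy2_fun f (\<beta> z))) \<le> 1 / sqrt p * norm f"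
proof -
  have gq: "cmod q < cmod g" using p power2_less_imp_less[of "cmod q" "cmod g"] by simp
  then have g0: "g \<noteq> 0" by auto
  have nz: "g - q * z \<noteq> 0" if "cmod z < 1" for z
  proof
    assume "g - q * z = 0"
    then have "cmod g = cmod q * cmod z" by (simp add: norm_mult[symmetric])
    also have "\<dots> \<le> cmod q * 1" using that by (intro mult_left_mono) auto
    finally show False using gq by simp
  qed
  then show "z \<in> unit_disc \<Longrightarrow> g - q * z \<noteq> 0" by simp
  have id: "(cmod (g - q * z))\<^sup>2 - (cmod (cnj g * z - cnj q))\<^sup>2 = p * (1 - (cmod z)\<^sup>2)" for z
    unfolding p(1)[symmetric] cmod_power2 by (simp add: power2_eq_square algebra_simps)
  have b1: "cmod (\<beta> z) < 1" if z: "cmod z < 1" for z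
  proof -
    have "(cmod (cnj g * z - cnj q))\<^sup>2 < (cmod (g - q * z))\<^sup>2"
    proof -
      have "(cmod z)\<^sup>2 < 1" using z by (simp add: abs_square_less_1)
      then have "0 < p * (1 - (cmod z)\<^sup>2)" using p(2) by simp
      then show ?thesis using id[of z] by linarith
    qed
    then have "cmod (cnj g * z - cnj q) < cmod (g - q * z)"
      using power2_less_imp_less norm_ge_zero by blast
    then show ?thesis using nz[OF z] by (simp add: \<beta>_def norm_divide)
  qed
  then show "z \<in> unit_disc \<Longrightarrow> \<beta> z \<in> unit_disc" by simp
  show \<beta>h: "\<beta> holomorphic_on unit_disc"
    unfolding \<beta>_def using nz by (intro holomorphic_intros) auto
  have eh: "(\<lambda>z. 1 / (g - q * z)) holomorphic_on unit_disc"
    using nz by (intro holomorphic_intros) auto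
  define e where "e = hardy2_of (\<lambda>z. 1 / (g - q * z))"
  have eb: "cmod (1 / (g - q * z)) \<le> 1 / (cmod g - cmod q)" if "z \<in> unit_disc" for z
  proof -
    have "cmod q * cmod z \<le> cmod q * 1" using that by (intro mult_left_mono) auto
    then have "cmod g - cmod q \<le> cmod (g - q * z)"
      using norm_triangle_ineq2[of g "q * z"] by (simp add: norm_mult)
    then show ?thesis using gq by (simp add: norm_divide frac_le)
  qed
  have ef: "hardy2_fun e z = 1 / (g - q * z)" if "z \<in> unit_disc" for z
    unfolding e_def by (rule hardy2_of_bounded(1)[OF eh eb that])
  have ec: "hardy2_coeff e n = (1/g) * (q/g) ^ n" for n
  proof (rule hardy2_coeff_unique)
    fix z :: complex assume z: "z \<in> unit_disc"
    have "cmod (q/g * z) < 1"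
    proof -
      have "cmod q * cmod z \<le> cmod q * 1" using z by (intro mult_left_mono) auto
      then have "cmod q * cmod z < cmod g" using gq by simp
      then show ?thesis using g0 by (simp add: norm_mult norm_divide field_simps)
    qed
    from sums_mult[OF geometric_sums[OF this], of "1/g"]
    have "(\<lambda>n. 1/g * (q/g * z) ^ n) sums (1/g * (1 / (1 - q/g * z)))" .
    also have "1/g * (1 / (1 - q/g * z)) = hardy2_fun e z"
      using g0 ef[OF z] nz[of z] z by (simp add: field_simps)
    finally show "(\<lambda>n. 1/g * (q/g) ^ n * z ^ n) sums hardy2_fun e z"
      by (simp only: power_mult_distrib mult.assoc)
  qed
  have en: "(norm e)\<^sup>2 = 1 / p"
  proof -
    have "(cmod (q/g))\<^sup>2 < 1"
      using gq g0 by (simp add: norm_divide power_divide power_strict_mono)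
    then have "(\<lambda>n. (cmod (1/g))\<^sup>2 * ((cmod (q/g))\<^sup>2) ^ n) sums ((cmod (1/g))\<^sup>2 * (1 / (1 - (cmod (q/g))\<^sup>2)))"
      by (intro sums_mult geometric_sums) simp
    moreover have "(\<lambda>n. (cmod (1/g))\<^sup>2 * ((cmod (q/g))\<^sup>2) ^ n) = (\<lambda>n. (cmod (hardy2_coeff e n))\<^sup>2)"
      by (simp only: ec norm_mult norm_power power_mult_distrib fun_eq_iff power_mult[symmetric] mult.commute[of 2] simp_thms)
    moreover have "(cmod (1/g))\<^sup>2 * (1 / (1 - (cmod (q/g))\<^sup>2)) = 1 / p"
      using g0 unfolding p(1)[symmetric] by (simp add: norm_divide power_divide field_simps)
    ultimately show ?thesis by (simp add: hardy2_norm_square sums_iff)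
  qed
  \<comment> \<open>Horner's scheme: a polynomial in \<open>\<beta>\<close> is its constant term
    plus \<open>\<beta>\<close> times a shorter one. Multiplication by \<open>\<beta>\<close> does
    not increase the norm and creates a zero at the zero of \<open>\<beta>\<close>, hence
    orthogonality to \<open>e\<close>, and the squared norms add.\<close>
  have poly: "\<exists>h. (\<forall>z\<in>unit_disc. hardy2_fun h z = 1 / (g - q * z) * (\<Sum>n<N. a n * \<beta> z ^ n)) \<and>
      (norm h)\<^sup>2 \<le> (1 / sqrt p)\<^sup>2 * (\<Sum>n<N. (cmod (a n))\<^sup>2)" for a :: "nat \<Rightarrow> complex" and N
  proof (induction N arbitrary: a)
    case 0
    then show ?case by (intro exI[of _ 0]) auto
  next
    case (Suc N)
    obtain h where h: "\<And>z. z \<in> unit_disc \<Longrightarrow> hardy2_fun h z = 1 / (g - q * z) * (\<Sum>n<N. a (Suc n) * \<beta> z ^ n)"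
      and hn: "(norm h)\<^sup>2 \<le> (1 / sqrt p)\<^sup>2 * (\<Sum>n<N. (cmod (a (Suc n)))\<^sup>2)"
      using Suc.IH[of "\<lambda>n. a (Suc n)"] by blast
    define B where "B z = \<beta> z * hardy2_fun h z" for z
    have Bh: "B holomorphic_on unit_disc"
      unfolding B_def by (intro holomorphic_intros \<beta>h hardy2_fun_holomorphic)
    have Bm: "circle_mean B r \<le> (norm h)\<^sup>2" if r: "0 \<le> r" "r < 1" for r
    proof -
      have "circle_mean B r \<le> circle_mean (hardy2_fun h) r"
        unfolding circle_mean_def[of "hardy2_fun h"]
      proof (rule circle_mean_le[OF Bh r circle_integrable[OF hardy2_fun_holomorphic r]])
        fix \<theta> :: real
        have "cmod (B (circle_point r \<theta>)) \<le> 1 * cmod (hardy2_fun h (circle_point r \<theta>))"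
          unfolding B_def norm_mult using b1[of "circle_point r \<theta>"] r by (intro mult_right_mono) auto
        then show "(cmod (B (circle_point r \<theta>)))\<^sup>2 \<le> (cmod (hardy2_fun h (circle_point r \<theta>)))\<^sup>2"
          by (intro power_mono) auto
      qed
      then show ?thesis using circle_mean_hardy2_le[OF r, of h] by linarith
    qed
    define b where "b = hardy2_of B"
    have bf: "hardy2_fun b z = B z" if "z \<in> unit_disc" for z
      unfolding b_def by (rule hardy2_of_circle_mean(1)[OF Bh Bm that])
    have bn: "(norm b)\<^sup>2 \<le> (norm h)\<^sup>2"
      unfolding b_def by (rule hardy2_of_circle_mean(2)[OF Bh Bm])
    have orth: "inner b (a 0 *\<^sub>C e) = 0"
    proof -
      \<comment> \<open>The zero of \<open>\<beta>\<close>. The coefficients of \<open>e\<close> are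
        proportional to the conjugates of the powers of \<open>z0\<close>, so pairing with
        \<open>e\<close> is evaluation at \<open>z0\<close> up to a factor.\<close>
      define z0 where "z0 = cnj q / cnj g"
      have z0: "z0 \<in> unit_disc" using gq g0 by (simp add: z0_def norm_divide)
      have "(\<lambda>n. hardy2_coeff b n * z0 ^ n) sums hardy2_fun b z0" by (rule hardy2_fun_sums[OF z0])
      moreover have "hardy2_fun b z0 = 0"
        unfolding bf[OF z0] B_def \<beta>_def using g0 by (simp add: z0_def)
      ultimately have "(\<lambda>n. (cnj (a 0) / cnj g) * (hardy2_coeff b n * z0 ^ n)) sums (cnj (a 0) / cnj g * 0)"
        by (intro sums_mult) simp
      then have "(\<lambda>n. Re ((cnj (a 0) / cnj g) * (hardy2_coeff b n * z0 ^ n))) sums Re 0"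
        by (intro bounded_linear.sums[OF bounded_linear_Re]) simp
      moreover have "Re ((cnj (a 0) / cnj g) * (hardy2_coeff b n * z0 ^ n))
          = inner (hardy2_coeff b n) (hardy2_coeff (a 0 *\<^sub>C e) n)" for n
      proof -
        have "inner x y = Re (cnj y * x)" for x y :: complex by (simp add: inner_complex_def mult.commute)
        then show ?thesis
          by (simp only: hardy2_coeff_scaleC ec complex_cnj_mult complex_cnj_power complex_cnj_divide
              complex_cnj_one z0_def) (simp add: mult_ac)
      qed
      ultimately show ?thesis by (simp add: inner_hardy2_def sums_iff)
    qed
    have "(norm (b + a 0 *\<^sub>C e))\<^sup>2 = (norm b)\<^sup>2 + (norm (a 0 *\<^sub>C e))\<^sup>2"
      using orth by (simp add: power2_norm_eq_inner inner_add_left inner_add_right inner_commute)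
    also have "(norm (a 0 *\<^sub>C e))\<^sup>2 = (cmod (a 0))\<^sup>2 * (1 / p)"
      by (simp add: norm_scaleC power_mult_distrib en)
    also have "(norm b)\<^sup>2 + (cmod (a 0))\<^sup>2 * (1 / p) \<le> (1 / sqrt p)\<^sup>2 * (\<Sum>n<Suc N. (cmod (a n))\<^sup>2)"
      using order_trans[OF bn hn] p(2) unfolding sum.lessThan_Suc_shift by (simp add: power_divide add_divide_distrib)
    finally have "(norm (b + a 0 *\<^sub>C e))\<^sup>2 \<le> (1 / sqrt p)\<^sup>2 * (\<Sum>n<Suc N. (cmod (a n))\<^sup>2)" .
    moreover have "hardy2_fun (b + a 0 *\<^sub>C e) z = 1 / (g - q * z) * (\<Sum>n<Suc N. a n * \<beta> z ^ n)"
      if z: "z \<in> unit_disc" for z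
    proof -
      have "(\<Sum>n<Suc N. a n * \<beta> z ^ n) = a 0 + \<beta> z * (\<Sum>n<N. a (Suc n) * \<beta> z ^ n)"
        unfolding sum.lessThan_Suc_shift sum_distrib_left by (simp add: mult_ac)
      then show ?thesis
        by (simp add: hardy2_fun_add hardy2_fun_scaleC bf[OF z] ef[OF z] B_def h[OF z] add_divide_distrib)
    qed
    ultimately show ?case by blast
  qed
  have K: "0 \<le> 1 / sqrt p" using p by simp
  have \<beta>i: "\<beta> ` unit_disc \<subseteq> unit_disc" using b1 by auto
  show "z \<in> unit_disc \<Longrightarrow> hardy2_fun (hardy2_of (\<lambda>z. 1 / (g - q * z) * hardy2_fun f (\<beta> z))) z
        = 1 / (g - q * z) * hardy2_fun f (\<beta> z)"
    "norm (hardy2_of (\<lambda>z. 1 / (g - q * z) * hardy2_fun f (\<beta> z))) \<le> 1 / sqrt p * norm f"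
    using weighted_composition_bound[OF eh \<beta>h \<beta>i K poly] by auto
qed

text \<open>
  In the coordinate \<open>S z = 1 / (1 - z)\<close>, which maps the disc onto \<open>Re S > 1/2\<close>, the map \<open>\<psi>\<close> below
  is \<open>S \<mapsto> S / d + e\<close>.  It is an automorphism followed by the affine map \<open>1 - s * (1 - z)\<close>.
\<close>

lemma model_operator_bound:
  fixes d s :: real and e :: complex and v \<psi> :: "complex \<Rightarrow> complex"
  assumes d: "d > 0" and e: "2 * Re e > 1 - 1 / d"
  defines "v \<equiv> \<lambda>z. 1 + of_real d * e * (1 - z)"
  defines "\<psi> \<equiv> \<lambda>z. 1 - of_real d * (1 - z) / v z"
  defines "s \<equiv> 1 / (2 * Re e + 1 / d)"
  shows "0 < s" "s < 1"
    and "z \<in> unit_disc \<Longrightarrow> v z \<noteq> 0" "z \<in> unit_disc \<Longrightarrow> \<psi> z \<in> ball (1 - of_real s) s"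
    and "\<psi> holomorphic_on unit_disc"
    and "z \<in> unit_disc \<Longrightarrow> hardy2_fun (hardy2_of (\<lambda>z. hardy2_fun f (\<psi> z) / v z)) z = hardy2_fun f (\<psi> z) / v z"
    and "norm (hardy2_of (\<lambda>z. hardy2_fun f (\<psi> z) / v z)) \<le> 1 / sqrt d * norm f"
proof -
  have "1 < 2 * Re e + 1 / d" using e by simp
  then show s: "0 < s" "s < 1" by (auto simp: s_def)
  \<comment> \<open>In the coordinate \<open>S\<close> the automorphism is
    \<open>S \<mapsto> p * S + q\<close>. It preserves the line \<open>Re S = 1/2\<close> exactly
    when \<open>2 * Re q = 1 - p\<close>, and \<open>s\<close> is the scale for which this holds;
    dividing by \<open>s\<close> then gives \<open>S / d + e\<close>.\<close>
  define p where "p = s / d"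
  have p: "p > 0" using s d by (simp add: p_def)
  define q where "q = of_real s * e"
  define g where "g = of_real p + q"
  have "2 * Re q = 1 - p"
  proof -
    have "s * (2 * Re e + 1 / d) = 1" using s by (simp add: s_def)
    then show ?thesis by (simp add: q_def p_def algebra_simps)
  qed
  then have q2: "of_real p + q = 1 - cnj q"
    by (simp add: complex_eq_iff)
  have pp: "(cmod g)\<^sup>2 - (cmod q)\<^sup>2 = p"
  proof -
    have "(cmod g)\<^sup>2 - (cmod q)\<^sup>2 = p * p + p * (2 * Re q)"
      unfolding g_def cmod_power2 by (simp add: power2_eq_square algebra_simps)
    also have "\<dots> = p" unfolding \<open>2 * Re q = 1 - p\<close> by (simp add: algebra_simps)
    finally show ?thesis .
  qed
  define \<beta> where "\<beta> z = (cnj g * z - cnj q) / (g - q * z)" for z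
  note ac = automorphism_composition_bound[OF pp p, folded \<beta>_def]
  define A where "A z = 1 - of_real s * (1 - z)" for z :: complex
  have den: "g - q * z = of_real p * v z" for z
    using d by (simp add: g_def v_def p_def q_def algebra_simps)
  show v0: "v z \<noteq> 0" if "z \<in> unit_disc" for z
    using ac(1)[OF that] unfolding den by auto
  have \<psi>A: "\<psi> z = A (\<beta> z)" if z: "z \<in> unit_disc" for z
  proof -
    have "g - q * z - (cnj g * z - cnj q) = (1 - z) * (g + cnj q)"
    proof -
      have sym: "cnj g + q = g + cnj q" by (simp add: g_def)
      have "g - q * z - (cnj g * z - cnj q) = (g + cnj q) - (cnj g + q) * z"
        by (simp only: ring_distribs) simp
      then show ?thesis unfolding sym by (simp only: ring_distribs) simp
    qed
    moreover have "g + cnj q = 1" using q2 by (simp add: g_def)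
    ultimately have "g - q * z - (cnj g * z - cnj q) = 1 - z" by simp
    then have "1 - \<beta> z = (1 - z) / (g - q * z)"
      using ac(1)[OF z] by (simp add: \<beta>_def diff_divide_distrib[symmetric] field_simps)
    then have "A (\<beta> z) = 1 - of_real s * ((1 - z) / (of_real p * v z))" by (simp add: A_def den)
    also have "\<dots> = \<psi> z" using d s v0[OF z] by (simp add: \<psi>_def p_def)
    finally show ?thesis ..
  qed
  show "\<psi> z \<in> ball (1 - of_real s) s" if "z \<in> unit_disc" for z
  proof -
    have "dist (1 - of_real s) (\<psi> z) = cmod (of_real s * \<beta> z)"
      by (simp add: \<psi>A[OF that] A_def dist_norm algebra_simps norm_minus_commute)
    also have "\<dots> < s" using s ac(2)[OF that] by (simp add: norm_mult)
    finally show ?thesis by simp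
  qed
  show "\<psi> holomorphic_on unit_disc"
    unfolding \<psi>_def using v0 by (auto simp: v_def intro!: holomorphic_intros)
  define F where "F = hardy2_of (\<lambda>z. hardy2_fun f (A z))"
  have Ff: "hardy2_fun F z = hardy2_fun f (A z)" if "z \<in> unit_disc" for z
    unfolding F_def A_def by (rule affine_composition_bound(1)[OF s that])
  have Fn: "norm F \<le> 1 / sqrt s * norm f"
    unfolding F_def A_def by (rule affine_composition_bound(2)[OF s])
  define G where "G = of_real p *\<^sub>C hardy2_of (\<lambda>z. 1 / (g - q * z) * hardy2_fun F (\<beta> z))"
  have Gf: "hardy2_fun G z = hardy2_fun f (\<psi> z) / v z" if z: "z \<in> unit_disc" for z
    unfolding G_def hardy2_fun_scaleC ac(4)[OF z] Ff[OF ac(2)[OF z]] \<psi>A[OF z]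
    using p by (simp add: den)
  have Geq: "hardy2_of (\<lambda>z. hardy2_fun f (\<psi> z) / v z) = G"
  proof -
    have "hardy2_of (\<lambda>z. hardy2_fun f (\<psi> z) / v z) = hardy2_of (hardy2_fun G)"
      unfolding hardy2_of_def by (rule arg_cong[where f=Abs_hardy2]) (auto simp: Gf)
    then show ?thesis by simp
  qed
  show "z \<in> unit_disc \<Longrightarrow> hardy2_fun (hardy2_of (\<lambda>z. hardy2_fun f (\<psi> z) / v z)) z = hardy2_fun f (\<psi> z) / v z"
    unfolding Geq by (rule Gf)
  have "norm G \<le> p * (1 / sqrt p * norm F)"
    unfolding G_def norm_scaleC using mult_left_mono[OF ac(5)[of F], of p] p by simp
  also have "\<dots> \<le> p * (1 / sqrt p * (1 / sqrt s * norm f))"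
    using Fn p by (intro mult_left_mono) auto
  also have "\<dots> = 1 / sqrt d * norm f"
  proof -
    \<comment> \<open>The scalar \<open>p\<close> turns the weight \<open>1 / (g - q * z)\<close>
      into \<open>1 / v z\<close>; the two root factors come from the automorphism and from the
      affine map.\<close>
    have "p * (1 / sqrt p * (1 / sqrt s)) = sqrt p / sqrt s"
      using p real_div_sqrt[of p] by (simp add: divide_simps)
    also have "\<dots> = 1 / sqrt d" using s d by (simp add: p_def real_sqrt_divide)
    finally have "p * (1 / sqrt p * (1 / sqrt s)) * norm f = 1 / sqrt d * norm f" by simp
    then show ?thesis by (simp only: mult.assoc)
  qed
  finally show "norm (hardy2_of (\<lambda>z. hardy2_fun f (\<psi> z) / v z)) \<le> 1 / sqrt d * norm f"
    unfolding Geq .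
qed

section \<open>The map near its boundary fixed point\<close>

locale repelling_map =
  fixes \<phi> :: "complex \<Rightarrow> complex" and d :: real
  assumes elf: "essentially_linear_fractional \<phi>"
    and value_one: "has_boundary_value \<phi> 1 1"
    and deriv_one: "has_boundary_value (deriv \<phi>) 1 (complex_of_real d)"
    and d_gt_1: "d > 1"
begin

lemma hol: "\<phi> holomorphic_on unit_disc" and into: "z \<in> unit_disc \<Longrightarrow> \<phi> z \<in> unit_disc"
  using elf unfolding essentially_linear_fractional_def selfmap_def by blast+

lemma radial: "(\<lambda>n. 1 - of_real (t / real (n + 1)) :: complex) \<longlonglongrightarrow> 1"
  "0 < t \<Longrightarrow> t \<le> 1 \<Longrightarrow> 1 - of_real (t / real (n + 1)) \<in> unit_disc"
proof -
  have "(\<lambda>n. 1 - of_real (t * (1 / real (Suc n))) :: complex) \<longlonglongrightarrow> 1 - of_real (t * 0)"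
    by (intro tendsto_intros LIMSEQ_Suc[OF lim_1_over_n])
  then show "(\<lambda>n. 1 - of_real (t / real (n + 1)) :: complex) \<longlonglongrightarrow> 1" by simp
  show "1 - of_real (t / real (n + 1)) \<in> unit_disc" if "0 < t" "t \<le> 1"
  proof -
    have "0 < t / real (n + 1)" "t / real (n + 1) \<le> 1" using that by (auto simp: field_simps)
    moreover have "cmod (1 - of_real (t / real (n + 1))) = \<bar>1 - t / real (n + 1)\<bar>"
      by (metis norm_of_real of_real_1 of_real_diff)
    ultimately show ?thesis by simp
  qed
qed

lemma boundary_sequence:
  assumes "has_boundary_value f 1 l" "\<And>n. z n \<in> unit_disc" "z \<longlonglongrightarrow> 1"
  shows "(\<lambda>n. f (z n)) \<longlonglongrightarrow> l"
proof -
  have "z n \<noteq> 1" for n using assms(2)[of n] by auto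
  then have "filterlim z (at 1 within unit_disc) sequentially"
    using assms(2,3) by (auto simp: filterlim_at)
  then show ?thesis using assms(1) unfolding has_boundary_value_def by (rule filterlim_compose[rotated])
qed

text \<open>Both distinguished boundary points are \<open>1\<close>. Radial limits place
  \<open>1\<close> in the closure of the tangent disc, hence at the point of tangency, and place
  \<open>1\<close> in the cluster set at \<open>1\<close>. Being tangent at \<open>1\<close> forces
  the centre to be \<open>1 - r\<close>.\<close>

lemma tangent_disc_data:
  shows "\<exists>r. 0 < r \<and> r < 1 \<and> (\<forall>z\<in>unit_disc. \<phi> z \<in> ball (1 - of_real r) r)"
    and cluster_unique: "\<zeta> \<in> sphere 0 1 \<Longrightarrow> 1 \<in> cluster_set \<phi> \<zeta> \<Longrightarrow> \<zeta> = 1"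
    and third_deriv_extends: "extends_continuously_to ((deriv ^^ 3) \<phi>) 1"
proof -
  obtain \<eta> D \<zeta>0 where \<eta>: "\<eta> \<in> sphere 0 1" and D: "internally_tangent_disc \<eta> D" "\<phi> ` unit_disc \<subseteq> D"
    and \<zeta>0: "{\<zeta>\<in>sphere 0 1. \<eta> \<in> cluster_set \<phi> \<zeta>} = {\<zeta>0}"
    and ext: "extends_continuously_to ((deriv ^^ 3) \<phi>) \<zeta>0"
    using elf unfolding essentially_linear_fractional_def by blast
  obtain c r where r: "0 < r" and Dc: "D = ball c r" and sub: "ball c r \<subset> unit_disc"
    and tan: "sphere c r \<inter> sphere 0 1 = {\<eta>}"
    using D(1) unfolding internally_tangent_disc_def by blast
  define z where "z n = 1 - complex_of_real (1 / real (n + 1))" for n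
  have z: "z n \<in> unit_disc" "z \<longlonglongrightarrow> 1" for n
    unfolding z_def using radial(1)[of 1] radial(2)[of 1 n] by auto
  have \<phi>z: "(\<lambda>n. \<phi> (z n)) \<longlonglongrightarrow> 1" by (rule boundary_sequence[OF value_one z])
  have "1 \<in> closure (ball c r)"
    unfolding closure_sequential
  proof (intro exI[of _ "\<lambda>n. \<phi> (z n)"] conjI allI)
    show "\<phi> (z n) \<in> ball c r" for n using z(1) D(2) Dc by blast
  qed (rule \<phi>z)
  then have c1: "dist c 1 \<le> r" using r by simp
  have "1 \<notin> ball c r" using sub by auto
  then have c1: "dist c 1 = r" using c1 by simp
  have "closure (ball c r) \<subseteq> closure unit_disc" by (intro closure_mono) (use sub in auto)
  then have "cball c r \<subseteq> cball 0 1" using r by simp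
  then have cr: "cmod c + r \<le> 1" using r by (simp add: cball_subset_cball_iff)
  have "1 \<in> sphere c r \<inter> sphere 0 1" using c1 by simp
  then have \<eta>1: "\<eta> = 1" using tan by simp
  have n1: "cmod (1 - c) = r" using c1 by (simp add: dist_norm norm_minus_commute)
  have cc: "cmod c = 1 - r" using norm_triangle_ineq2[of 1 c] n1 cr by simp
  have "Re c = 1 - r"
  proof -
    have "(cmod (1 - c))\<^sup>2 = 1 - 2 * Re c + (cmod c)\<^sup>2"
      unfolding cmod_power2 by (simp add: power2_eq_square algebra_simps)
    then show ?thesis unfolding n1 cc by (simp add: power2_eq_square algebra_simps)
  qed
  moreover have "Im c = 0"
  proof -
    have "(cmod c)\<^sup>2 = (Re c)\<^sup>2 + (Im c)\<^sup>2" by (rule cmod_power2)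
    then show ?thesis using \<open>Re c = 1 - r\<close> cc by simp
  qed
  ultimately have ceq: "c = 1 - of_real r" by (simp add: complex_eq_iff)
  have "r \<noteq> 1" using sub ceq by auto
  moreover have "r \<le> 1" using cc norm_ge_zero[of c] by linarith
  ultimately have "r < 1" by simp
  then show "\<exists>r. 0 < r \<and> r < 1 \<and> (\<forall>z\<in>unit_disc. \<phi> z \<in> ball (1 - of_real r) r)"
    using r D(2) Dc ceq by (intro exI[of _ r]) auto
  have "1 \<in> cluster_set \<phi> 1"
    unfolding cluster_set_def using z \<phi>z by auto
  then have "\<zeta>0 = 1" using \<zeta>0 \<eta>1 by auto
  then show "\<zeta> \<in> sphere 0 1 \<Longrightarrow> 1 \<in> cluster_set \<phi> \<zeta> \<Longrightarrow> \<zeta> = 1"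
    "extends_continuously_to ((deriv ^^ 3) \<phi>) 1"
    using \<zeta>0 \<eta>1 ext by auto
qed

text \<open>The third derivative is bounded near \<open>1\<close> by continuity, and integrating it
  bounds the second. Taylor's formula is applied at interior base points \<open>w n\<close> tending
  to \<open>1\<close>, and its bounds pass to the limit.\<close>

lemma expansion:
  obtains b :: complex and C \<delta> :: real where "C > 0" "0 < \<delta>" "\<delta> \<le> 1"
    "\<And>z. z \<in> unit_disc \<Longrightarrow> cmod (1 - z) < \<delta> \<Longrightarrow>
      cmod (\<phi> z - (1 - of_real d * (1 - z) + b * (1 - z)\<^sup>2)) \<le> C * cmod (1 - z) ^ 3"
    "\<And>z. z \<in> unit_disc \<Longrightarrow> cmod (1 - z) < \<delta> \<Longrightarrow> cmod (deriv \<phi> z - of_real d) \<le> C * cmod (1 - z)"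
proof -
  obtain g where g: "continuous_on (insert 1 unit_disc) g" "\<And>z. z \<in> unit_disc \<Longrightarrow> g z = (deriv ^^ 3) \<phi> z"
    using third_deriv_extends unfolding extends_continuously_to_def by blast
  have "continuous (at 1 within insert 1 unit_disc) g"
    using g(1) by (simp add: continuous_on_eq_continuous_within)
  then obtain \<delta>' where \<delta>': "\<delta>' > 0" "\<And>z. z \<in> insert 1 unit_disc \<Longrightarrow> dist z 1 < \<delta>' \<Longrightarrow> dist (g z) (g 1) < 1"
    unfolding continuous_within_eps_delta by (metis zero_less_one)
  define \<delta> where "\<delta> = min \<delta>' 1"
  have \<delta>: "0 < \<delta>" "\<delta> \<le> 1" using \<delta>'(1) by (auto simp: \<delta>_def)
  define B where "B = cmod (g 1) + 1"
  define S where "S = unit_disc \<inter> ball 1 \<delta>"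
  have S: "convex S" "open S" unfolding S_def by (auto intro: convex_Int)
  have B: "cmod ((deriv ^^ 3) \<phi> z) \<le> B" if "z \<in> S" for z
  proof -
    have "dist (g z) (g 1) < 1" using that by (intro \<delta>'(2)) (auto simp: S_def \<delta>_def dist_commute)
    then show ?thesis
      using norm_triangle_ineq2[of "g z" "g 1"] g(2)[of z] that by (auto simp: B_def dist_norm S_def)
  qed
  have B0: "B \<ge> 0" by (simp add: B_def)
  have der: "((deriv ^^ i) \<phi> has_field_derivative (deriv ^^ Suc i) \<phi> x) (at x within S)" if "x \<in> S" for i x
  proof -
    have "(deriv ^^ i) \<phi> holomorphic_on S"
      by (rule holomorphic_on_subset[OF holomorphic_higher_deriv[OF hol open_ball]]) (auto simp: S_def)
    then have "((deriv ^^ i) \<phi> has_field_derivative deriv ((deriv ^^ i) \<phi>) x) (at x)"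
      by (rule holomorphic_derivI[OF _ S(2) that])
    then show ?thesis by (simp add: has_field_derivative_at_within)
  qed
  have taylor: "cmod ((deriv ^^ k) \<phi> z - (\<Sum>i\<le>n. (deriv ^^ (k + i)) \<phi> x * (z - x) ^ i / fact i))
      \<le> B' * cmod (z - x) ^ Suc n / fact n"
    if "z \<in> S" "x \<in> S" and B': "\<And>y. y \<in> S \<Longrightarrow> cmod ((deriv ^^ (k + Suc n)) \<phi> y) \<le> B'" for k n z x B'
  proof -
    have "((deriv ^^ (k + i)) \<phi> has_field_derivative (deriv ^^ (k + Suc i)) \<phi> y) (at y within S)" if "y \<in> S" for i y
      using der[OF that, of "k + i"] by simp
    from complex_Taylor[OF S(1), where f="\<lambda>i. (deriv ^^ (k + i)) \<phi>", OF this B' that(2,1)]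
    show ?thesis by simp
  qed
  define w where "w n = 1 - complex_of_real ((\<delta> / 2) / real (n + 1))" for n
  have w1: "w \<longlonglongrightarrow> 1" unfolding w_def by (rule radial(1))
  have wU: "w n \<in> unit_disc" for n unfolding w_def using \<delta> by (intro radial(2)) auto
  have wS: "w n \<in> S" for n
  proof -
    have "dist 1 (w n) = \<bar>(\<delta> / 2) / real (n + 1)\<bar>"
      unfolding w_def dist_norm by (simp only: diff_diff_eq2 add_diff_cancel_left' norm_of_real)
    also have "\<dots> \<le> \<delta> / 2" using \<delta> by (simp add: field_simps)
    also have "\<dots> < \<delta>" using \<delta> by simp
    finally show ?thesis using wU by (simp add: S_def)
  qed
  have diam: "cmod (z - x) \<le> 2" if "z \<in> S" "x \<in> S" for z x
    using that norm_triangle_ineq4[of z x] by (auto simp: S_def)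
  define M where "M = cmod ((deriv ^^ 2) \<phi> (w 0)) + 2 * B"
  have M: "cmod ((deriv ^^ 2) \<phi> z) \<le> M" if z: "z \<in> S" for z
  proof -
    have "cmod ((deriv ^^ 2) \<phi> z - (deriv ^^ 2) \<phi> (w 0)) \<le> B * cmod (z - w 0)"
      using taylor[OF z wS, of 2 0 B 0] B by (simp add: numeral_3_eq_3 numeral_2_eq_2)
    also have "\<dots> \<le> B * 2" using diam[OF z wS] B0 by (intro mult_left_mono) auto
    finally show ?thesis
      using norm_triangle_ineq2[of "(deriv ^^ 2) \<phi> z" "(deriv ^^ 2) \<phi> (w 0)"] by (simp add: M_def)
  qed
  have M0: "M \<ge> 0" using B0 by (simp add: M_def)
  have D1: "cmod (deriv \<phi> z - of_real d) \<le> M * cmod (1 - z)" if z: "z \<in> S" for z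
  proof -
    have "cmod (deriv \<phi> z - deriv \<phi> (w n)) \<le> M * cmod (z - w n)" for n
      using taylor[OF z wS, of 1 0 M n] M by (simp add: numeral_2_eq_2)
    moreover have "(\<lambda>n. cmod (deriv \<phi> z - deriv \<phi> (w n))) \<longlonglongrightarrow> cmod (deriv \<phi> z - of_real d)"
      by (intro tendsto_intros boundary_sequence[OF deriv_one wU w1])
    moreover have "(\<lambda>n. M * cmod (z - w n)) \<longlonglongrightarrow> M * cmod (z - 1)"
      by (intro tendsto_intros w1)
    ultimately have "cmod (deriv \<phi> z - of_real d) \<le> M * cmod (z - 1)"
      by (intro LIMSEQ_le) auto
    then show ?thesis by (simp add: norm_minus_commute)
  qed
  \<comment> \<open>The second-order coefficient is a subsequential limit of bounded second
    derivatives. This suffices, since the Taylor bound holds at every \<open>w n\<close>.\<close>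
  have cM: "\<forall>n. (\<lambda>n. (deriv ^^ 2) \<phi> (w n)) n \<in> cball 0 M" using M wS by simp
  obtain L s where s: "strict_mono (s :: nat \<Rightarrow> nat)" and L: "((\<lambda>n. (deriv ^^ 2) \<phi> (w n)) \<circ> s) \<longlonglongrightarrow> L"
    using mp[OF spec[OF compact_cball[of "0::complex" M, unfolded compact_def]] cM] by blast
  define b where "b = L / 2"
  have ws: "(\<lambda>n. w (s n)) \<longlonglongrightarrow> 1" using LIMSEQ_subseq_LIMSEQ[OF w1 s] by (simp add: o_def)
  have D2: "cmod (\<phi> z - (1 - of_real d * (1 - z) + b * (1 - z)\<^sup>2)) \<le> B * cmod (1 - z) ^ 3" if z: "z \<in> S" for z
  proof -
    have le: "cmod (\<phi> z - (\<phi> (w (s n)) + deriv \<phi> (w (s n)) * (z - w (s n)) +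
        (deriv ^^ 2) \<phi> (w (s n)) * (z - w (s n))\<^sup>2 / 2)) \<le> B * cmod (z - w (s n)) ^ 3 / 2" for n
      using taylor[OF z wS, of 0 2 B "s n"] B by (simp add: numeral_2_eq_2 numeral_3_eq_3)
    have l1: "(\<lambda>n. cmod (\<phi> z - (\<phi> (w (s n)) + deriv \<phi> (w (s n)) * (z - w (s n)) +
        (deriv ^^ 2) \<phi> (w (s n)) * (z - w (s n))\<^sup>2 / 2))) \<longlonglongrightarrow>
        cmod (\<phi> z - (1 + of_real d * (z - 1) + L * (z - 1)\<^sup>2 / 2))"
      using L[unfolded o_def] by (intro tendsto_intros ws boundary_sequence[OF deriv_one wU ws]
        boundary_sequence[OF value_one wU ws]) auto
    have l2: "(\<lambda>n. B * cmod (z - w (s n)) ^ 3 / 2) \<longlonglongrightarrow> B * cmod (z - 1) ^ 3 / 2"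
      by (intro tendsto_intros ws) auto
    have "cmod (\<phi> z - (1 + of_real d * (z - 1) + L * (z - 1)\<^sup>2 / 2)) \<le> B * cmod (z - 1) ^ 3 / 2"
      by (rule LIMSEQ_le[OF l1 l2]) (use le in auto)
    also have "1 + of_real d * (z - 1) + L * (z - 1)\<^sup>2 / 2 = 1 - of_real d * (1 - z) + b * (1 - z)\<^sup>2"
      by (simp add: b_def power2_commute[of z 1] algebra_simps)
    also have "B * cmod (z - 1) ^ 3 / 2 \<le> B * cmod (1 - z) ^ 3"
      using B0 by (simp add: norm_minus_commute mult_left_mono)
    finally show ?thesis .
  qed
  show thesis
  proof (rule that[of "B + M + 1" \<delta> b])
    show "B + M + 1 > 0" "0 < \<delta>" "\<delta> \<le> 1" using B0 M0 \<delta> by auto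
    fix z assume z: "z \<in> unit_disc" "cmod (1 - z) < \<delta>"
    then have zS: "z \<in> S" by (simp add: S_def dist_norm)
    show "cmod (\<phi> z - (1 - of_real d * (1 - z) + b * (1 - z)\<^sup>2)) \<le> (B + M + 1) * cmod (1 - z) ^ 3"
      by (rule order_trans[OF D2[OF zS]]) (use M0 in \<open>intro mult_right_mono; simp\<close>)
    show "cmod (deriv \<phi> z - of_real d) \<le> (B + M + 1) * cmod (1 - z)"
      by (rule order_trans[OF D1[OF zS]]) (use B0 in \<open>intro mult_right_mono; simp\<close>)
  qed
qed

lemma repels:
  obtains \<delta> where "\<delta> > 0"
    "\<And>z. z \<in> unit_disc \<Longrightarrow> cmod (1 - z) < \<delta> \<Longrightarrow> (1 + d) / 2 * cmod (1 - z) \<le> cmod (1 - \<phi> z)"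
proof -
  obtain b C \<delta> where C: "C > 0" and \<delta>: "0 < \<delta>" "\<delta> \<le> 1" and
    ex: "\<And>z. z \<in> unit_disc \<Longrightarrow> cmod (1 - z) < \<delta> \<Longrightarrow>
      cmod (\<phi> z - (1 - of_real d * (1 - z) + b * (1 - z)\<^sup>2)) \<le> C * cmod (1 - z) ^ 3"
    using expansion by metis
  define K where "K = cmod b + C"
  have K: "K > 0" using C by (simp add: K_def add_nonneg_pos)
  \<comment> \<open>Within this radius the quadratic and cubic terms together cost at most
    \<open>(d - 1) / 2 * cmod (1 - z)\<close>, leaving the factor \<open>(1 + d) / 2\<close>, which
    exceeds \<open>1\<close>.\<close>
  define \<delta>' where "\<delta>' = min \<delta> ((d - 1) / (2 * K))"
  show thesis
  proof (rule that[of \<delta>'])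
    show "\<delta>' > 0" using \<delta> K d_gt_1 by (simp add: \<delta>'_def)
    fix z assume z: "z \<in> unit_disc" "cmod (1 - z) < \<delta>'"
    let ?t = "1 - z"
    have t1: "cmod ?t \<le> 1" "cmod ?t < \<delta>" using z \<delta> by (auto simp: \<delta>'_def)
    have "cmod ?t ^ 3 = cmod ?t ^ 2 * cmod ?t" by (simp add: power2_eq_square power3_eq_cube)
    also have "\<dots> \<le> cmod ?t ^ 2 * 1" using t1 by (intro mult_left_mono) auto
    finally have "C * cmod ?t ^ 3 \<le> C * (cmod ?t)\<^sup>2" using C by simp
    then have "cmod (\<phi> z - (1 - of_real d * ?t + b * ?t\<^sup>2)) \<le> C * (cmod ?t)\<^sup>2" using ex[OF z(1) t1(2)] by linarith
    moreover have "of_real d * ?t = (1 - \<phi> z) + b * ?t\<^sup>2 + (\<phi> z - (1 - of_real d * ?t + b * ?t\<^sup>2))"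
      by simp
    then have "cmod (of_real d * ?t) \<le> cmod (1 - \<phi> z) + cmod (b * ?t\<^sup>2) + cmod (\<phi> z - (1 - of_real d * ?t + b * ?t\<^sup>2))"
      by (metis norm_triangle_ineq norm_triangle_mono order_refl)
    ultimately have "d * cmod ?t \<le> cmod (1 - \<phi> z) + K * (cmod ?t)\<^sup>2"
      using d_gt_1 unfolding norm_mult norm_power norm_of_real K_def distrib_right by linarith
    moreover have "K * (cmod ?t)\<^sup>2 \<le> (d - 1) / 2 * cmod ?t"
    proof -
      have "K * cmod ?t \<le> K * ((d - 1) / (2 * K))" using z K by (intro mult_left_mono) (auto simp: \<delta>'_def)
      then have "K * cmod ?t \<le> (d - 1) / 2" using K by simp
      from mult_right_mono[OF this norm_ge_zero[of ?t]] show ?thesis by (simp add: power2_eq_square mult.assoc)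
    qed
    ultimately show "(1 + d) / 2 * cmod ?t \<le> cmod (1 - \<phi> z)" by (simp add: field_simps)
  qed
qed

text \<open>Near \<open>1\<close> this is repulsion. Elsewhere a failure would produce points away
  from \<open>1\<close> whose images tend to \<open>1\<close>; their limit is either an interior
  point mapped to \<open>1\<close> or a second boundary point with \<open>1\<close> in its cluster
  set, and both are excluded.\<close>

lemma boundary_distance:
  obtains \<kappa> where "\<kappa> > 0" "\<And>z. z \<in> unit_disc \<Longrightarrow> \<kappa> * cmod (1 - z) \<le> cmod (1 - \<phi> z)"
proof -
  obtain \<delta> where \<delta>: "\<delta> > 0"
    "\<And>z. z \<in> unit_disc \<Longrightarrow> cmod (1 - z) < \<delta> \<Longrightarrow> (1 + d) / 2 * cmod (1 - z) \<le> cmod (1 - \<phi> z)"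
    using repels by metis
  have "\<exists>m>0. \<forall>z\<in>unit_disc. \<delta> \<le> cmod (1 - z) \<longrightarrow> m \<le> cmod (1 - \<phi> z)"
  proof (rule ccontr)
    assume "\<not> ?thesis"
    then have "\<forall>n. \<exists>z\<in>unit_disc. \<delta> \<le> cmod (1 - z) \<and> cmod (1 - \<phi> z) < 1 / real (n + 1)"
      by (metis not_less of_nat_0_less_iff zero_less_divide_1_iff add_gr_0 zero_less_one)
    then have "\<forall>n. \<exists>z. z \<in> unit_disc \<and> \<delta> \<le> cmod (1 - z) \<and> cmod (1 - \<phi> z) < 1 / real (n + 1)"
      by (simp add: Bex_def)
    from choice[OF this] obtain z where
      z: "\<And>n. z n \<in> unit_disc" "\<And>n. \<delta> \<le> cmod (1 - z n)" "\<And>n. cmod (1 - \<phi> (z n)) < 1 / real (n + 1)"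
      by blast
    have "(\<lambda>n. 1 - \<phi> (z n)) \<longlonglongrightarrow> 0"
      by (rule Lim_null_comparison[OF _ LIMSEQ_Suc[OF lim_1_over_n]])
         (use z(3) in \<open>simp add: less_imp_le add.commute\<close>)
    from tendsto_diff[OF tendsto_const[of 1] this] have \<phi>z: "(\<lambda>n. \<phi> (z n)) \<longlonglongrightarrow> 1" by simp
    have "\<forall>n. z n \<in> cball 0 1" using z(1) by (auto intro: less_imp_le)
    then obtain \<zeta> s where \<zeta>: "\<zeta> \<in> cball 0 1" and s: "strict_mono (s :: nat \<Rightarrow> nat)" and l: "(z \<circ> s) \<longlonglongrightarrow> \<zeta>"
      using compact_cball[of "0::complex" 1] unfolding compact_def by blast
    have \<phi>l: "(\<lambda>n. \<phi> ((z \<circ> s) n)) \<longlonglongrightarrow> 1" using LIMSEQ_subseq_LIMSEQ[OF \<phi>z s] by (simp add: o_def)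
    have "\<delta> \<le> cmod (1 - \<zeta>)"
      by (rule LIMSEQ_le_const[of "\<lambda>n. cmod (1 - (z \<circ> s) n)"]) (use z(2) l in \<open>auto intro!: tendsto_intros simp: o_def\<close>)
    then have "\<zeta> \<noteq> 1" using \<delta> by auto
    show False
    proof (cases "cmod \<zeta> < 1")
      case True
      have "isCont \<phi> \<zeta>"
        using hol True holomorphic_on_imp_continuous_on continuous_on_interior by fastforce
      then have "(\<lambda>n. \<phi> ((z \<circ> s) n)) \<longlonglongrightarrow> \<phi> \<zeta>" using l isCont_tendsto_compose by blast
      then have "\<phi> \<zeta> = 1" using \<phi>l LIMSEQ_unique by blast
      then show False using into[of \<zeta>] True by simp
    next
      case False
      then have "\<zeta> \<in> sphere 0 1" using \<zeta> by simp
      moreover have "1 \<in> cluster_set \<phi> \<zeta>"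
        unfolding cluster_set_def using z(1) l \<phi>l by (auto intro!: exI[of _ "z \<circ> s"])
      ultimately show False using cluster_unique \<open>\<zeta> \<noteq> 1\<close> by blast
    qed
  qed
  then obtain m where m: "m > 0" "\<And>z. z \<in> unit_disc \<Longrightarrow> \<delta> \<le> cmod (1 - z) \<Longrightarrow> m \<le> cmod (1 - \<phi> z)" by blast
  show thesis
  proof (rule that[of "min 1 (m / 2)"])
    show "min 1 (m / 2) > 0" using m by simp
    fix z assume z: "z \<in> unit_disc"
    show "min 1 (m / 2) * cmod (1 - z) \<le> cmod (1 - \<phi> z)"
    proof (cases "cmod (1 - z) < \<delta>")
      case True
      have "min 1 (m / 2) * cmod (1 - z) \<le> (1 + d) / 2 * cmod (1 - z)"
        using d_gt_1 by (intro mult_right_mono) auto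
      then show ?thesis using \<delta>(2)[OF z True] by linarith
    next
      case False
      have "cmod (1 - z) \<le> 2" using norm_triangle_ineq4[of 1 z] z by simp
      then have "min 1 (m / 2) * cmod (1 - z) \<le> (m / 2) * 2" using m by (intro mult_mono) auto
      then show ?thesis using m(2)[OF z] False by simp
    qed
  qed
qed

end

text \<open>With \<open>S = 1 / (1 - w)\<close>, the ratio of \<open>1 - |w|^2\<close> to
  \<open>|1 - w|^2\<close> is \<open>2 * Re S - 1\<close>, and the tangent disc is the half-plane
  \<open>Re S > 1 / (2 * r)\<close>.\<close>

lemma tangent_disc_depth:
  assumes r: "0 < r" and w: "w \<in> ball (1 - of_real r) r"
  shows "(1 / r - 1) * (cmod (1 - w))\<^sup>2 \<le> 1 - (cmod w)\<^sup>2"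
proof -
  have "(cmod (1 - of_real r - w))\<^sup>2 < r\<^sup>2"
    using w r by (intro power_strict_mono) (auto simp: dist_norm)
  moreover have "(cmod (1 - of_real r - w))\<^sup>2 = (cmod (1 - w))\<^sup>2 - 2 * r * Re (1 - w) + r\<^sup>2"
    unfolding cmod_power2 by (simp add: power2_eq_square algebra_simps)
  ultimately have "(cmod (1 - w))\<^sup>2 \<le> r * (2 * Re (1 - w))" by (simp add: algebra_simps)
  then have "(cmod (1 - w))\<^sup>2 / r \<le> 2 * Re (1 - w)" using r by (simp add: field_simps)
  moreover have "1 - (cmod w)\<^sup>2 = 2 * Re (1 - w) - (cmod (1 - w))\<^sup>2"
    unfolding cmod_power2 by (simp add: power2_eq_square algebra_simps)
  ultimately show ?thesis by (simp add: algebra_simps)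
qed

text \<open>Points of depth \<open>h\<close> lie in the convex disc of radius
  \<open>1 - h / 2\<close>. Around each point of that disc, Cauchy's estimate on a circle of radius
  \<open>h / 4\<close>, where values are at most \<open>2 * norm f / sqrt h\<close>, bounds the
  derivative.\<close>

lemma hardy2_difference_bound:
  assumes h: "0 < h" "h \<le> 1" and a: "h \<le> 1 - (cmod a)\<^sup>2" and b: "h \<le> 1 - (cmod b)\<^sup>2"
  shows "cmod (hardy2_fun f a - hardy2_fun f b) \<le> 8 * norm f / (h * sqrt h) * cmod (a - b)"
proof -
  define \<rho> where "\<rho> = 1 - h / 2"
  have \<rho>: "0 \<le> \<rho>" "\<rho> < 1" using h by (auto simp: \<rho>_def)
  have in\<rho>: "cmod x \<le> \<rho>" if "h \<le> 1 - (cmod x)\<^sup>2" for x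
  proof -
    have "(cmod x)\<^sup>2 \<le> 1 - h" using that by simp
    also have "\<dots> \<le> \<rho>\<^sup>2" using zero_le_power2[of h] by (simp add: \<rho>_def power2_eq_square algebra_simps)
    finally show ?thesis using \<rho>(1) by (rule power2_le_imp_le)
  qed
  have der: "cmod (deriv (hardy2_fun f) z) \<le> 8 * norm f / (h * sqrt h)" if z: "z \<in> cball 0 \<rho>" for z
  proof -
    have sub: "cball z (h / 4) \<subseteq> unit_disc"
    proof
      fix x assume x: "x \<in> cball z (h / 4)"
      have "cmod x \<le> cmod z + cmod (x - z)" using norm_triangle_ineq[of z "x - z"] by simp
      then show "x \<in> unit_disc" using x z h by (simp add: \<rho>_def dist_norm norm_minus_commute)
    qed
    have "cmod ((deriv ^^ 1) (hardy2_fun f) z) \<le> fact 1 * (norm f * 2 / sqrt h) / (h / 4) ^ 1"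
    proof (rule Cauchy_inequality)
      show "hardy2_fun f holomorphic_on ball z (h / 4)"
        by (rule holomorphic_on_subset[OF hardy2_fun_holomorphic]) (use sub in auto)
      show "continuous_on (cball z (h / 4)) (hardy2_fun f)"
        by (rule continuous_on_subset[OF holomorphic_on_imp_continuous_on[OF hardy2_fun_holomorphic] sub])
      fix x assume x: "cmod (z - x) = h / 4"
      have "cmod x \<le> cmod z + cmod (x - z)" using norm_triangle_ineq[of z "x - z"] by simp
      then have c: "cmod x \<le> 1 - h / 4" using x z by (simp add: \<rho>_def norm_minus_commute)
      then have c1: "cmod x < 1" using h by simp
      have "(cmod x)\<^sup>2 \<le> cmod x" using c1 by (simp add: power2_eq_square mult_left_le)
      then have hh: "h / 4 \<le> 1 - (cmod x)\<^sup>2" using c by linarith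
      have "cmod (hardy2_fun f x) \<le> norm f / sqrt (1 - (cmod x)\<^sup>2)" by (rule hardy2_eval_bound[OF c1])
      also have "\<dots> \<le> norm f / sqrt (h / 4)"
        using hh h by (intro divide_left_mono real_sqrt_le_mono mult_pos_pos) auto
      finally show "cmod (hardy2_fun f x) \<le> norm f * 2 / sqrt h" by (simp add: real_sqrt_divide)
    qed (use h in auto)
    then show ?thesis by (simp add: field_simps)
  qed
  show ?thesis
  proof (rule field_differentiable_bound[OF convex_cball[of 0 \<rho>]])
    fix x :: complex assume x: "x \<in> cball 0 \<rho>"
    show "(hardy2_fun f has_field_derivative deriv (hardy2_fun f) x) (at x within cball 0 \<rho>)"
      by (rule has_field_derivative_at_within, rule holomorphic_derivI[OF hardy2_fun_holomorphic open_ball])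
         (use x \<rho> in auto)
  qed (use der in\<rho>[OF a] in\<rho>[OF b] in auto)
qed

section \<open>Comparison with the linear fractional model\<close>

context repelling_map
begin

text \<open>In the coordinate \<open>S = 1 / (1 - z)\<close> the map is
  \<open>S / d + b / d^2 + o(1)\<close> near \<open>1\<close>, and its image satisfies
  \<open>Re S > 1 / (2 * r)\<close>. Comparing real parts in the limit along a vertical line gives
  the strict inequality that \<open>model_operator_bound\<close> requires.\<close>

lemma model_parameter:
  fixes b :: complex and C \<delta> r :: real
  assumes C: "C > 0" "0 < \<delta>" and ex: "\<And>z. z \<in> unit_disc \<Longrightarrow> cmod (1 - z) < \<delta> \<Longrightarrow>
      cmod (\<phi> z - (1 - of_real d * (1 - z) + b * (1 - z)\<^sup>2)) \<le> C * cmod (1 - z) ^ 3"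
    and r: "0 < r" "r < 1" "\<And>z. z \<in> unit_disc \<Longrightarrow> \<phi> z \<in> ball (1 - of_real r) r"
  shows "2 * Re (b / of_real (d\<^sup>2)) > 1 - 1 / d"
proof -
  \<comment> \<open>The offset costs \<open>2 * \<eta> / d\<close>, which is half of the available
    gap \<open>1 / r - 1\<close>.\<close>
  define \<eta> where "\<eta> = d * (1 / r - 1) / 4"
  have \<eta>: "\<eta> > 0" using r d_gt_1 by (simp add: \<eta>_def)
  \<comment> \<open>A tangential approach: \<open>z = 1 - 1 / s n\<close> tends to \<open>1\<close>
    along a horocycle just inside the circle. On a radial approach \<open>Re S\<close> would be
    unbounded and the comparison of real parts would say nothing.\<close>
  define s where "s n = Complex (1/2 + \<eta>) (real (Suc n))" for n
  define t where "t n = 1 / s n" for n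
  have s0: "s n \<noteq> 0" for n by (simp add: s_def complex_eq_iff)
  have t0: "t n \<noteq> 0" for n using s0 by (simp add: t_def)
  have tU: "1 - t n \<in> unit_disc" for n
  proof -
    have "(cmod (s n - 1))\<^sup>2 < (cmod (s n))\<^sup>2"
      unfolding cmod_power2 using \<eta> by (simp add: s_def power2_eq_square algebra_simps)
    then have "cmod (s n - 1) < cmod (s n)" by (rule power2_less_imp_less) simp
    moreover have "1 - t n = (s n - 1) / s n" using s0 by (simp add: t_def field_simps)
    ultimately show ?thesis using s0 by (simp add: norm_divide)
  qed
  have tl: "t \<longlonglongrightarrow> 0"
  proof (rule Lim_null_comparison[OF _ LIMSEQ_inverse_real_of_nat])
    have "real (Suc n) \<le> cmod (s n)" for n using abs_Im_le_cmod[of "s n"] by (simp add: s_def)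
    then show "\<forall>\<^sub>F n in sequentially. cmod (t n) \<le> inverse (real (Suc n))"
      by (intro always_eventually allI) (simp add: t_def norm_divide inverse_eq_divide frac_le)
  qed
  define R where "R n = \<phi> (1 - t n) - (1 - of_real d * t n + b * (t n)\<^sup>2)" for n
  have Rl: "(\<lambda>n. R n / (t n)\<^sup>2) \<longlonglongrightarrow> 0"
  proof (rule Lim_null_comparison)
    have "\<forall>\<^sub>F n in sequentially. cmod (t n) < \<delta>"
      using tendstoD[OF tl C(2)] by simp
    then show "\<forall>\<^sub>F n in sequentially. cmod (R n / (t n)\<^sup>2) \<le> C * cmod (t n)"
    proof eventually_elim
      case (elim n)
      have "cmod (R n) \<le> C * cmod (t n) ^ 3" using ex[OF tU[of n]] elim by (simp add: R_def)
      then show ?case using t0[of n]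
        by (simp add: norm_divide norm_power norm_mult divide_le_eq power2_eq_square power3_eq_cube mult.assoc)
    qed
    show "(\<lambda>n. C * cmod (t n)) \<longlonglongrightarrow> 0" by (intro tendsto_mult_right_zero tendsto_norm_zero tl)
  qed
  have \<phi>1: "1 - \<phi> (1 - t n) \<noteq> 0" for n using into[OF tU[of n]] by auto
  have q: "(\<lambda>n. (1 - \<phi> (1 - t n)) / t n) \<longlonglongrightarrow> of_real d"
  proof -
    have "(\<lambda>n. of_real d - b * t n - (R n / (t n)\<^sup>2) * t n) \<longlonglongrightarrow> of_real d - b * 0 - 0 * 0"
      by (intro tendsto_intros tl Rl)
    moreover have "of_real d - b * t n - (R n / (t n)\<^sup>2) * t n = (1 - \<phi> (1 - t n)) / t n" for n
      using t0[of n] by (simp add: R_def field_simps power2_eq_square)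
    ultimately show ?thesis by simp
  qed
  have "(\<lambda>n. 1 / (1 - \<phi> (1 - t n)) - s n / of_real d) \<longlonglongrightarrow> b / of_real (d\<^sup>2)"
  proof -
    have "(\<lambda>n. (b + R n / (t n)\<^sup>2) / (of_real d * ((1 - \<phi> (1 - t n)) / t n))) \<longlonglongrightarrow> (b + 0) / (of_real d * of_real d)"
      using d_gt_1 by (intro tendsto_intros Rl q) auto
    moreover have "(b + R n / (t n)\<^sup>2) / (of_real d * ((1 - \<phi> (1 - t n)) / t n)) =
        1 / (1 - \<phi> (1 - t n)) - s n / of_real d" for n
    proof -
      have st: "s n = 1 / t n" using s0 by (simp add: t_def)
      have e: "b * (t n)\<^sup>2 + R n = of_real d * t n - (1 - \<phi> (1 - t n))" by (simp add: R_def)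
      have "(b + R n / (t n)\<^sup>2) = (b * (t n)\<^sup>2 + R n) / (t n)\<^sup>2" using t0[of n] by (simp add: field_simps)
      moreover have "((D * x - y) / x\<^sup>2) / (D * (y / x)) = 1 / y - (1 / x) / D"
        if "x \<noteq> 0" "y \<noteq> 0" "D \<noteq> 0" for x y D :: complex
        using that by (simp add: field_simps power2_eq_square)
      ultimately show ?thesis unfolding e st using t0[of n] \<phi>1[of n] d_gt_1 by simp
    qed
    ultimately show ?thesis by (simp add: power2_eq_square)
  qed
  from tendsto_Re[OF this] have "(\<lambda>n. Re (1 / (1 - \<phi> (1 - t n)) - s n / of_real d)) \<longlonglongrightarrow> Re (b / of_real (d\<^sup>2))" .
  moreover have "1 / (2 * r) - (1/2 + \<eta>) / d \<le> Re (1 / (1 - \<phi> (1 - t n)) - s n / of_real d)" for n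
  proof -
    let ?w = "\<phi> (1 - t n)"
    have "(cmod (1 - ?w))\<^sup>2 \<le> 2 * r * Re (1 - ?w)"
    proof -
      have "(1 / r - 1) * (cmod (1 - ?w))\<^sup>2 \<le> 1 - (cmod ?w)\<^sup>2"
        by (rule tangent_disc_depth[OF r(1) r(3)[OF tU]])
      also have "1 - (cmod ?w)\<^sup>2 = 2 * Re (1 - ?w) - (cmod (1 - ?w))\<^sup>2"
        unfolding cmod_power2 by (simp add: power2_eq_square algebra_simps)
      finally have "(cmod (1 - ?w))\<^sup>2 / r \<le> 2 * Re (1 - ?w)" by (simp add: algebra_simps)
      then show ?thesis using r by (simp add: field_simps)
    qed
    moreover have "Re (1 / (1 - ?w)) = Re (1 - ?w) / (cmod (1 - ?w))\<^sup>2"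
      by (simp add: Re_divide cmod_power2)
    moreover have N: "(cmod (1 - ?w))\<^sup>2 > 0" using \<phi>1[of n] by simp
    ultimately have "(cmod (1 - ?w))\<^sup>2 * 1 \<le> (cmod (1 - ?w))\<^sup>2 * (2 * r * Re (1 / (1 - ?w)))"
      by simp
    then have "1 \<le> 2 * r * Re (1 / (1 - ?w))" using N by (simp only: mult_le_cancel_left_pos)
    then have "1 / (2 * r) \<le> Re (1 / (1 - ?w))" using r by (simp add: field_simps)
    then show ?thesis by (simp add: s_def)
  qed
  ultimately have le: "1 / (2 * r) - (1/2 + \<eta>) / d \<le> Re (b / of_real (d\<^sup>2))"
    by (intro LIMSEQ_le_const) auto
  have eq: "2 * (1 / (2 * r) - (1/2 + \<eta>) / d) = 1 / r - 1 / d - (1 / r - 1) / 2"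
    using d_gt_1 r by (simp add: \<eta>_def field_simps)
  have "1 / r - 1 / d - (1 / r - 1) / 2 \<le> 2 * Re (b / of_real (d\<^sup>2))"
    unfolding eq[symmetric] using le by (intro mult_left_mono) auto
  moreover have "(1 / r - 1) / 2 > 0" using r by simp
  ultimately show ?thesis by argo
qed

text \<open>The parameter \<open>e = b / d^2\<close> is forced by second-order agreement of
  \<open>\<psi>\<close> with \<open>\<phi>\<close> at \<open>1\<close>. Near \<open>1\<close> the
  exponents of evaluation and of the matching error cancel; away from \<open>1\<close> both image
  points have depth bounded below, so evaluation alone gives the bound.\<close>

lemma comparison:
  obtains v \<psi> :: "complex \<Rightarrow> complex" and C \<kappa> m :: real where
    "C > 0" "0 < \<kappa>" "\<kappa> < 1" "m > 0" "\<psi> holomorphic_on unit_disc" "v holomorphic_on unit_disc"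
    "\<And>z. z \<in> unit_disc \<Longrightarrow> m \<le> cmod (v z)"
    "\<And>z. z \<in> unit_disc \<Longrightarrow> \<psi> z \<in> unit_disc"
    "\<And>z. z \<in> unit_disc \<Longrightarrow> \<kappa> * (cmod (1 - z))\<^sup>2 \<le> 1 - (cmod (\<phi> z))\<^sup>2"
    "\<And>z. z \<in> unit_disc \<Longrightarrow> \<kappa> * (cmod (1 - z))\<^sup>2 \<le> 1 - (cmod (\<psi> z))\<^sup>2"
    "\<And>f z. z \<in> unit_disc \<Longrightarrow> hardy2_fun (hardy2_of (\<lambda>z. hardy2_fun f (\<psi> z) / v z)) z = hardy2_fun f (\<psi> z) / v z"
    "\<And>f. norm (hardy2_of (\<lambda>z. hardy2_fun f (\<psi> z) / v z)) \<le> 1 / sqrt d * norm f"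
    "\<And>f z. z \<in> unit_disc \<Longrightarrow> cmod (hardy2_fun f (\<phi> z) - hardy2_fun f (\<psi> z) / v z) \<le> C * norm f"
proof -
  obtain b :: complex and C0 \<delta> :: real where C0: "C0 > 0" and \<delta>: "0 < \<delta>" "\<delta> \<le> 1" and
    ex: "\<And>z. z \<in> unit_disc \<Longrightarrow> cmod (1 - z) < \<delta> \<Longrightarrow>
      cmod (\<phi> z - (1 - of_real d * (1 - z) + b * (1 - z)\<^sup>2)) \<le> C0 * cmod (1 - z) ^ 3"
    using expansion by metis
  obtain r where r: "0 < r" "r < 1" and rin: "\<And>z. z \<in> unit_disc \<Longrightarrow> \<phi> z \<in> ball (1 - of_real r) r"
    using tangent_disc_data by blast
  obtain \<kappa>0 where \<kappa>0: "\<kappa>0 > 0" "\<And>z. z \<in> unit_disc \<Longrightarrow> \<kappa>0 * cmod (1 - z) \<le> cmod (1 - \<phi> z)"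
    using boundary_distance by metis
  define e where "e = b / of_real (d\<^sup>2)"
  have e: "2 * Re e > 1 - 1 / d" unfolding e_def by (rule model_parameter[OF C0 \<delta>(1) ex r rin])
  have d0: "d > 0" using d_gt_1 by simp
  have be: "b = of_real (d\<^sup>2) * e" using d0 by (simp add: e_def)
  define v where "v z = 1 + of_real d * e * (1 - z)" for z
  define \<psi> where "\<psi> z = 1 - of_real d * (1 - z) / v z" for z
  define s where "s = 1 / (2 * Re e + 1 / d)"
  note mo = model_operator_bound[OF d0 e, folded v_def s_def, folded \<psi>_def]
  define E where "E = d * cmod e"
  have E: "E \<ge> 0" using d0 by (simp add: E_def)
  have t2: "cmod (1 - z) \<le> 2" if "z \<in> unit_disc" for z using norm_triangle_ineq4[of 1 z] that by simp
  have \<psi>U: "\<psi> z \<in> unit_disc" if z: "z \<in> unit_disc" for z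
  proof -
    have "cmod (\<psi> z) \<le> cmod (1 - of_real s) + cmod (\<psi> z - (1 - of_real s))"
      using norm_triangle_ineq[of "1 - of_real s" "\<psi> z - (1 - of_real s)"] by simp
    also have "cmod (1 - of_real s) = 1 - s"
      using mo(2) by (metis abs_of_nonneg diff_ge_0_iff_ge less_imp_le norm_of_real of_real_1 of_real_diff)
    also have "cmod (\<psi> z - (1 - of_real s)) < s" using mo(4)[OF z] by (simp add: dist_norm norm_minus_commute)
    finally show ?thesis by simp
  qed
  \<comment> \<open>Near \<open>1\<close> the value \<open>v z\<close> is within \<open>1/2\<close>
    of \<open>1\<close>. Away from \<open>1\<close>, the identity
    \<open>d * (1 - z) = (1 - \<psi> z) * v z\<close> with
    \<open>cmod (1 - \<psi> z) \<le> 2\<close> gives the second bound.\<close>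
  define m where "m = min (1/2) (d / (4 * (E + 1)))"
  have m: "m > 0" using d0 E by (simp add: m_def)
  have vlow: "m \<le> cmod (v z)" if z: "z \<in> unit_disc" for z
  proof (cases "cmod (1 - z) \<le> 1 / (2 * (E + 1))")
    case True
    have "cmod (of_real d * e * (1 - z)) = E * cmod (1 - z)" using d0 by (simp add: norm_mult E_def)
    also have "\<dots> \<le> (E + 1) * (1 / (2 * (E + 1)))" using True E by (intro mult_mono) auto
    also have "\<dots> = 1/2" using E by simp
    finally have "1/2 \<le> cmod (v z)"
      using norm_diff_ineq[of 1 "of_real d * e * (1 - z)"] by (simp add: v_def)
    then show ?thesis by (simp add: m_def)
  next
    case False
    have "d * (1 / (2 * (E + 1))) \<le> d * cmod (1 - z)" using False d0 by (intro mult_left_mono) auto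
    also have "d * cmod (1 - z) = cmod (of_real d * (1 - z))" using d0 by (simp add: norm_mult)
    also have "of_real d * (1 - z) = (1 - \<psi> z) * v z" using mo(3)[OF z] by (simp add: \<psi>_def)
    also have "cmod ((1 - \<psi> z) * v z) \<le> 2 * cmod (v z)"
      unfolding norm_mult using t2[OF \<psi>U[OF z]] by (intro mult_right_mono) auto
    finally have *: "d * (1 / (2 * (E + 1))) \<le> 2 * cmod (v z)" .
    have "d / (4 * (E + 1)) = d * (1 / (2 * (E + 1))) / 2" by simp
    also have "\<dots> \<le> 2 * cmod (v z) / 2" by (rule divide_right_mono[OF *]) simp
    finally have "d / (4 * (E + 1)) \<le> cmod (v z)" by simp
    then show ?thesis by (simp add: m_def)
  qed
  have vup: "cmod (v z) \<le> 1 + 2 * E" if z: "z \<in> unit_disc" for z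
  proof -
    have "cmod (v z) \<le> 1 + E * cmod (1 - z)"
      using norm_triangle_ineq[of 1 "of_real d * e * (1 - z)"] d0 by (simp add: v_def norm_mult E_def)
    also have "E * cmod (1 - z) \<le> E * 2" using t2[OF z] E by (intro mult_left_mono) auto
    finally show ?thesis by simp
  qed
  define \<kappa>1 where "\<kappa>1 = (1 / r - 1) * \<kappa>0\<^sup>2"
  define \<kappa>2 where "\<kappa>2 = (1 / s - 1) * (d / (1 + 2 * E))\<^sup>2"
  have \<kappa>12: "\<kappa>1 > 0" "\<kappa>2 > 0"
    using r \<kappa>0 mo(1,2) d0 E by (auto simp: \<kappa>1_def \<kappa>2_def intro!: mult_pos_pos zero_less_power divide_pos_pos)
  define \<kappa> where "\<kappa> = min (1/2) (min \<kappa>1 \<kappa>2)"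
  have \<kappa>: "0 < \<kappa>" "\<kappa> < 1" using \<kappa>12 by (auto simp: \<kappa>_def)
  have k\<phi>: "\<kappa> * (cmod (1 - z))\<^sup>2 \<le> 1 - (cmod (\<phi> z))\<^sup>2" if z: "z \<in> unit_disc" for z
  proof -
    have "\<kappa> * (cmod (1 - z))\<^sup>2 \<le> \<kappa>1 * (cmod (1 - z))\<^sup>2" by (intro mult_right_mono) (auto simp: \<kappa>_def)
    also have "\<dots> = (1 / r - 1) * (\<kappa>0 * cmod (1 - z))\<^sup>2" by (simp add: \<kappa>1_def power_mult_distrib)
    also have "\<dots> \<le> (1 / r - 1) * (cmod (1 - \<phi> z))\<^sup>2"
      using \<kappa>0 z r by (intro mult_left_mono power_mono) auto
    also have "\<dots> \<le> 1 - (cmod (\<phi> z))\<^sup>2" by (rule tangent_disc_depth[OF r(1) rin[OF z]])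
    finally show ?thesis .
  qed
  have k\<psi>: "\<kappa> * (cmod (1 - z))\<^sup>2 \<le> 1 - (cmod (\<psi> z))\<^sup>2" if z: "z \<in> unit_disc" for z
  proof -
    have v0: "cmod (v z) > 0" using mo(3)[OF z] by simp
    have "\<kappa> * (cmod (1 - z))\<^sup>2 \<le> \<kappa>2 * (cmod (1 - z))\<^sup>2" by (intro mult_right_mono) (auto simp: \<kappa>_def)
    also have "\<dots> = (1 / s - 1) * (d / (1 + 2 * E) * cmod (1 - z))\<^sup>2"
      by (simp add: \<kappa>2_def power_mult_distrib power_divide)
    also have "\<dots> \<le> (1 / s - 1) * (cmod (1 - \<psi> z))\<^sup>2"
    proof (intro mult_left_mono power_mono)
      have "d / (1 + 2 * E) * cmod (1 - z) \<le> d / cmod (v z) * cmod (1 - z)"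
        using vup[OF z] v0 d0 E by (intro mult_right_mono divide_left_mono mult_pos_pos) auto
      also have "\<dots> = cmod (1 - \<psi> z)" using d0 by (simp add: \<psi>_def norm_divide norm_mult)
      finally show "d / (1 + 2 * E) * cmod (1 - z) \<le> cmod (1 - \<psi> z)" .
    qed (use mo(1,2) d0 E in auto)
    also have "\<dots> \<le> 1 - (cmod (\<psi> z))\<^sup>2" by (rule tangent_disc_depth[OF mo(1) mo(4)[OF z]])
    finally show ?thesis .
  qed
  have ev: "cmod (hardy2_fun f w) \<le> norm f / (sqrt \<kappa> * cmod (1 - z))"
    if "z \<in> unit_disc" "w \<in> unit_disc" "\<kappa> * (cmod (1 - z))\<^sup>2 \<le> 1 - (cmod w)\<^sup>2" for f z w
  proof -
    have t: "cmod (1 - z) > 0" using that(1) by auto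
    have "cmod (hardy2_fun f w) \<le> norm f / sqrt (1 - (cmod w)\<^sup>2)"
      using that by (intro hardy2_eval_bound) simp
    also have "\<dots> \<le> norm f / sqrt (\<kappa> * (cmod (1 - z))\<^sup>2)"
    proof (rule divide_left_mono)
      have "0 < \<kappa> * (cmod (1 - z))\<^sup>2" using \<kappa> t by simp
      then show "0 < sqrt (1 - (cmod w)\<^sup>2) * sqrt (\<kappa> * (cmod (1 - z))\<^sup>2)"
        using that(3) by (intro mult_pos_pos) auto
    qed (use that(3) in auto)
    finally show ?thesis using t by (simp add: real_sqrt_mult)
  qed
  define C1 where "C1 = C0 + d * E\<^sup>2 / m"
  have C1: "C1 > 0" using C0 d0 m by (simp add: C1_def add_pos_nonneg)
  have near: "cmod (hardy2_fun f (\<phi> z) - hardy2_fun f (\<psi> z) / v z) \<le> (8 * C1 / (\<kappa> * sqrt \<kappa>) + E / (m * sqrt \<kappa>)) * norm f"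
    if z: "z \<in> unit_disc" "cmod (1 - z) < \<delta>" for f z
  proof -
    let ?t = "1 - z" and ?h = "\<kappa> * (cmod (1 - z))\<^sup>2"
    have t: "cmod ?t > 0" "cmod ?t \<le> 1" using z \<delta> by auto
    have v0: "v z \<noteq> 0" "cmod (v z) > 0" using mo(3)[OF z(1)] by auto
    have diff: "cmod (\<phi> z - \<psi> z) \<le> C1 * cmod ?t ^ 3"
    proof -
      \<comment> \<open>The expansion of \<open>\<psi>\<close> at \<open>1\<close> with exact cubic
        remainder; its quadratic coefficient is \<open>b\<close> by the choice of
        \<open>e\<close>.\<close>
      have "\<psi> z = 1 - of_real d * ?t + b * ?t\<^sup>2 - of_real d * (of_real d * e)\<^sup>2 * ?t ^ 3 / v z"
      proof -
        have "of_real d * ?t = (of_real d * ?t - b * ?t\<^sup>2) * v z + of_real d * (of_real d * e)\<^sup>2 * ?t ^ 3"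
          unfolding v_def be by (simp add: power2_eq_square power3_eq_cube algebra_simps)
        then have "of_real d * ?t / v z = of_real d * ?t - b * ?t\<^sup>2 + of_real d * (of_real d * e)\<^sup>2 * ?t ^ 3 / v z"
          using v0 by (simp add: field_simps)
        then show ?thesis by (simp add: \<psi>_def)
      qed
      then have eq: "\<phi> z - \<psi> z = (\<phi> z - (1 - of_real d * ?t + b * ?t\<^sup>2)) + of_real d * (of_real d * e)\<^sup>2 * ?t ^ 3 / v z"
        by simp
      have "cmod (\<phi> z - \<psi> z) \<le> C0 * cmod ?t ^ 3 + cmod (of_real d * (of_real d * e)\<^sup>2 * ?t ^ 3 / v z)"
        unfolding eq by (rule norm_triangle_le[OF add_mono[OF ex[OF z] order_refl]])
      also have "cmod (of_real d * (of_real d * e)\<^sup>2 * ?t ^ 3 / v z) = d * E\<^sup>2 * cmod ?t ^ 3 / cmod (v z)"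
        using d0 by (simp add: norm_divide norm_mult norm_power E_def)
      also have "\<dots> \<le> d * E\<^sup>2 * cmod ?t ^ 3 / m"
        using vlow[OF z(1)] m v0 d0 by (intro divide_left_mono mult_nonneg_nonneg mult_pos_pos) auto
      finally show ?thesis by (simp add: C1_def algebra_simps)
    qed
    have h: "0 < ?h" "?h \<le> 1" using \<kappa> t by (auto intro!: mult_le_one power_le_one)
    \<comment> \<open>The depth \<open>?h\<close> is of order \<open>|?t|^2\<close>, so the
      denominator is of order \<open>|?t|^3\<close> and cancels the bound on
      \<open>\<phi> z - \<psi> z\<close>.\<close>
    have "cmod (hardy2_fun f (\<phi> z) - hardy2_fun f (\<psi> z)) \<le> 8 * norm f / (?h * sqrt ?h) * cmod (\<phi> z - \<psi> z)"
      by (rule hardy2_difference_bound[OF h k\<phi>[OF z(1)] k\<psi>[OF z(1)]])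
    also have "\<dots> \<le> 8 * norm f / (?h * sqrt ?h) * (C1 * cmod ?t ^ 3)"
      using h by (intro mult_left_mono diff) auto
    also have "\<dots> = 8 * C1 / (\<kappa> * sqrt \<kappa>) * norm f"
      using t \<kappa> by (simp add: real_sqrt_mult power2_eq_square power3_eq_cube field_simps)
    finally have one: "cmod (hardy2_fun f (\<phi> z) - hardy2_fun f (\<psi> z)) \<le> 8 * C1 / (\<kappa> * sqrt \<kappa>) * norm f" .
    \<comment> \<open>Inserting the weight costs a factor of order \<open>|?t|\<close>, which meets
      the evaluation bound of order \<open>1 / |?t|\<close>.\<close>
    have "hardy2_fun f (\<psi> z) - hardy2_fun f (\<psi> z) / v z = hardy2_fun f (\<psi> z) * (of_real d * e * ?t) / v z"
      using v0 by (simp add: v_def field_simps)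
    then have "cmod (hardy2_fun f (\<psi> z) - hardy2_fun f (\<psi> z) / v z) = cmod (hardy2_fun f (\<psi> z)) * (E * cmod ?t) / cmod (v z)"
      using d0 by (simp add: norm_divide norm_mult E_def)
    also have "\<dots> \<le> (norm f / (sqrt \<kappa> * cmod ?t)) * (E * cmod ?t) / m"
      using ev[OF z(1) \<psi>U[OF z(1)] k\<psi>[OF z(1)], of f] vlow[OF z(1)] m E
      by (intro frac_le mult_right_mono) (use \<kappa> in auto)
    also have "\<dots> = E / (m * sqrt \<kappa>) * norm f" using t \<kappa> m by (simp add: field_simps)
    finally have "cmod (hardy2_fun f (\<psi> z) - hardy2_fun f (\<psi> z) / v z) \<le> E / (m * sqrt \<kappa>) * norm f" .
    moreover have "cmod (hardy2_fun f (\<phi> z) - hardy2_fun f (\<psi> z) / v z) \<le>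
        cmod (hardy2_fun f (\<phi> z) - hardy2_fun f (\<psi> z)) + cmod (hardy2_fun f (\<psi> z) - hardy2_fun f (\<psi> z) / v z)"
      using norm_triangle_ineq[of "hardy2_fun f (\<phi> z) - hardy2_fun f (\<psi> z)"
          "hardy2_fun f (\<psi> z) - hardy2_fun f (\<psi> z) / v z"] by simp
    ultimately show ?thesis using one unfolding distrib_right by linarith
  qed
  have far: "cmod (hardy2_fun f (\<phi> z) - hardy2_fun f (\<psi> z) / v z) \<le> ((1 + 1 / m) / (sqrt \<kappa> * \<delta>)) * norm f"
    if z: "z \<in> unit_disc" "\<not> cmod (1 - z) < \<delta>" for f z
  proof -
    have B: "cmod (hardy2_fun f w) \<le> norm f / (sqrt \<kappa> * \<delta>)"
      if "w \<in> unit_disc" "\<kappa> * (cmod (1 - z))\<^sup>2 \<le> 1 - (cmod w)\<^sup>2" for w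
      by (rule order_trans[OF ev[OF z(1) that]])
         (use z(2) \<delta> \<kappa> in \<open>auto intro!: divide_left_mono mult_pos_pos mult_left_mono\<close>)
    have "cmod (hardy2_fun f (\<psi> z) / v z) \<le> (norm f / (sqrt \<kappa> * \<delta>)) / m"
      unfolding norm_divide using B[OF \<psi>U[OF z(1)] k\<psi>[OF z(1)]] vlow[OF z(1)] m \<kappa> \<delta> by (intro frac_le) auto
    then have "cmod (hardy2_fun f (\<phi> z) - hardy2_fun f (\<psi> z) / v z) \<le> norm f / (sqrt \<kappa> * \<delta>) + (norm f / (sqrt \<kappa> * \<delta>)) / m"
      using norm_triangle_ineq4[of "hardy2_fun f (\<phi> z)" "hardy2_fun f (\<psi> z) / v z"] B[OF into[OF z(1)] k\<phi>[OF z(1)]]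
      by linarith
    also have "\<dots> = ((1 + 1 / m) / (sqrt \<kappa> * \<delta>)) * norm f" using m \<kappa> \<delta> by (simp add: field_simps)
    finally show ?thesis .
  qed
  define C where "C = 8 * C1 / (\<kappa> * sqrt \<kappa>) + E / (m * sqrt \<kappa>) + (1 + 1 / m) / (sqrt \<kappa> * \<delta>)"
  have nn: "0 \<le> 8 * C1 / (\<kappa> * sqrt \<kappa>) + E / (m * sqrt \<kappa>)" "0 < (1 + 1 / m) / (sqrt \<kappa> * \<delta>)"
    using C1 \<kappa> m \<delta> E by (auto intro!: add_nonneg_nonneg divide_nonneg_nonneg divide_pos_pos add_pos_pos)
  show thesis
  proof (rule that[of C \<kappa> m \<psi> v])
    show "C > 0" using nn by (simp add: C_def)
    show "v holomorphic_on unit_disc" unfolding v_def by (intro holomorphic_intros)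
    fix f z assume z: "z \<in> unit_disc"
    show "cmod (hardy2_fun f (\<phi> z) - hardy2_fun f (\<psi> z) / v z) \<le> C * norm f"
    proof (cases "cmod (1 - z) < \<delta>")
      case True
      show ?thesis by (rule order_trans[OF near[OF z True]], rule mult_right_mono) (use nn in \<open>auto simp: C_def\<close>)
    next
      case False
      show ?thesis by (rule order_trans[OF far[OF z False]], rule mult_right_mono) (use nn in \<open>auto simp: C_def\<close>)
    qed
  qed (use \<kappa> m mo vlow \<psi>U k\<phi> k\<psi> in auto)
qed

end

section \<open>Coefficients, monomials and Taylor tails\<close>

lemma summand_le_norm_hardy2: "cmod (hardy2_coeff f n) \<le> norm f"
proof -
  have "(\<Sum>k\<in>{n}. (cmod (hardy2_coeff f k))\<^sup>2) \<le> (\<Sum>k. (cmod (hardy2_coeff f k))\<^sup>2)"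
    by (rule sum_le_suminf[OF summable_hardy2_coeff]) auto
  then have "(cmod (hardy2_coeff f n))\<^sup>2 \<le> (norm f)\<^sup>2" by (simp add: hardy2_norm_square)
  then show ?thesis by (rule power2_le_imp_le) simp
qed

lemma bounded_linear_hardy2_coeff: "bounded_linear (\<lambda>f. hardy2_coeff f n)"
  by (rule bounded_linear_intro[where K=1])
     (auto simp: hardy2_coeff_add hardy2_coeff_scaleR summand_le_norm_hardy2)

definition monomial :: "nat \<Rightarrow> hardy2"
  where "monomial n = hardy2_of (\<lambda>z. z ^ n)"

lemma monomial_fun: "z \<in> unit_disc \<Longrightarrow> hardy2_fun (monomial n) z = z ^ n"
  unfolding monomial_def
  by (rule hardy2_of_bounded(1)[where K=1]) (auto intro!: holomorphic_intros simp: norm_power power_le_one less_imp_le)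

lemma monomial_coeff: "hardy2_coeff (monomial n) k = (if k = n then 1 else 0)"
proof (rule hardy2_coeff_unique)
  fix z :: complex assume z: "z \<in> unit_disc"
  have "(\<lambda>k. if k = n then z ^ n else 0) sums z ^ n" by (rule sums_single)
  moreover have "(\<lambda>k. if k = n then z ^ n else 0) = (\<lambda>k. (if k = n then 1 else 0) * z ^ k)" by auto
  ultimately show "(\<lambda>k. (if k = n then 1 else 0) * z ^ k) sums hardy2_fun (monomial n) z"
    using monomial_fun[OF z] by simp
qed

definition tail :: "nat \<Rightarrow> hardy2 \<Rightarrow> hardy2"
  where "tail M f = f - (\<Sum>n<M. hardy2_coeff f n *\<^sub>C monomial n)"

lemma hardy2_coeff_sum: "hardy2_coeff (sum h A) k = (\<Sum>i\<in>A. hardy2_coeff (h i) k)"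
  by (induction A rule: infinite_finite_induct) (auto simp: hardy2_coeff_add hardy2_coeff_zero)

lemma tail_coeff: "hardy2_coeff (tail M f) k = (if k < M then 0 else hardy2_coeff f k)"
  by (simp add: tail_def hardy2_coeff_diff hardy2_coeff_sum hardy2_coeff_scaleC monomial_coeff if_distrib cong: if_cong)

lemma hardy2_coeff_eqI: "(\<And>n. hardy2_coeff f n = hardy2_coeff g n) \<Longrightarrow> f = g"
  using hardy2_eqI0[of "f - g"] by (simp add: hardy2_coeff_diff)

lemma tail_add: "tail M (f + g) = tail M f + tail M g"
  by (rule hardy2_coeff_eqI) (simp add: tail_coeff hardy2_coeff_add)

lemma tail_scaleC: "tail M (c *\<^sub>C f) = c *\<^sub>C tail M f"
  by (rule hardy2_coeff_eqI) (simp add: tail_coeff hardy2_coeff_scaleC)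

lemma norm_tail_le: "norm (tail M f) \<le> norm f"
proof -
  have "(norm (tail M f))\<^sup>2 \<le> (norm f)\<^sup>2"
    unfolding hardy2_norm_square by (intro suminf_le summable_hardy2_coeff) (simp add: tail_coeff)
  then show ?thesis by (rule power2_le_imp_le) simp
qed

section \<open>The operator up to small norm and finite rank\<close>

context repelling_map
begin

text \<open>\<open>Y\<close> is the weighted model operator and \<open>K\<close> the pointwise
  bounded difference. Smallness of \<open>K\<close> on functions with many vanishing coefficients
  replaces compactness: such functions are uniformly small wherever \<open>\<phi>\<close> and
  \<open>\<psi>\<close> stay in a fixed smaller disc, and the remaining arc near \<open>1\<close> is
  short.\<close>

lemma composition_decomposition:
  obtains Y :: "hardy2 \<Rightarrow> hardy2" and K :: "hardy2 \<Rightarrow> hardy2" and C :: real where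
    "\<And>f. norm (Y f) \<le> 1 / sqrt d * norm f" "\<And>f. norm (K f) \<le> C * norm f"
    "\<And>f z. z \<in> unit_disc \<Longrightarrow> hardy2_fun (Y f + K f) z = hardy2_fun f (\<phi> z)"
    "\<And>\<epsilon>. \<epsilon> > 0 \<Longrightarrow> \<exists>M. \<forall>f. (\<forall>n<M. hardy2_coeff f n = 0) \<longrightarrow> norm (K f) \<le> \<epsilon> * norm f"
proof -
  obtain v \<psi> :: "complex \<Rightarrow> complex" and C \<kappa> m :: real where
    C: "C > 0" and \<kappa>: "0 < \<kappa>" "\<kappa> < 1" and m: "m > 0" and \<psi>h: "\<psi> holomorphic_on unit_disc" and vh: "v holomorphic_on unit_disc"
    and vm: "\<And>z. z \<in> unit_disc \<Longrightarrow> m \<le> cmod (v z)"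
    and \<psi>U: "\<And>z. z \<in> unit_disc \<Longrightarrow> \<psi> z \<in> unit_disc"
    and k\<phi>: "\<And>z. z \<in> unit_disc \<Longrightarrow> \<kappa> * (cmod (1 - z))\<^sup>2 \<le> 1 - (cmod (\<phi> z))\<^sup>2"
    and k\<psi>: "\<And>z. z \<in> unit_disc \<Longrightarrow> \<kappa> * (cmod (1 - z))\<^sup>2 \<le> 1 - (cmod (\<psi> z))\<^sup>2"
    and Yf: "\<And>f z. z \<in> unit_disc \<Longrightarrow> hardy2_fun (hardy2_of (\<lambda>z. hardy2_fun f (\<psi> z) / v z)) z = hardy2_fun f (\<psi> z) / v z"
    and Yn: "\<And>f. norm (hardy2_of (\<lambda>z. hardy2_fun f (\<psi> z) / v z)) \<le> 1 / sqrt d * norm f"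
    and Kb: "\<And>f z. z \<in> unit_disc \<Longrightarrow> cmod (hardy2_fun f (\<phi> z) - hardy2_fun f (\<psi> z) / v z) \<le> C * norm f"
    by (rule comparison) blast
  have v0: "v z \<noteq> 0" if "z \<in> unit_disc" for z using vm[OF that] m by auto
  define k where "k f z = hardy2_fun f (\<phi> z) - hardy2_fun f (\<psi> z) / v z" for f z
  have kh: "k f holomorphic_on unit_disc" for f
  proof -
    have "(\<lambda>z. hardy2_fun f (\<phi> z)) holomorphic_on unit_disc" "(\<lambda>z. hardy2_fun f (\<psi> z)) holomorphic_on unit_disc"
      using holomorphic_on_compose_gen[OF hol hardy2_fun_holomorphic] into
        holomorphic_on_compose_gen[OF \<psi>h hardy2_fun_holomorphic] \<psi>U by (auto simp: o_def image_subset_iff)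
    then show ?thesis unfolding k_def using v0 vh by (intro holomorphic_intros) auto
  qed
  define Y where "Y f = hardy2_of (\<lambda>z. hardy2_fun f (\<psi> z) / v z)" for f
  define K where "K f = hardy2_of (k f)" for f
  have kb: "cmod (k f z) \<le> C * norm f" if "z \<in> unit_disc" for f z unfolding k_def by (rule Kb[OF that])
  show thesis
  proof (rule that[of Y K C])
    show "norm (Y f) \<le> 1 / sqrt d * norm f" for f unfolding Y_def by (rule Yn)
    show "norm (K f) \<le> C * norm f" for f unfolding K_def by (rule hardy2_of_bounded(2)[OF kh kb])
    show "hardy2_fun (Y f + K f) z = hardy2_fun f (\<phi> z)" if z: "z \<in> unit_disc" for f z
    proof -
      have "hardy2_fun (K f) z = k f z" unfolding K_def by (rule hardy2_of_bounded(1)[OF kh kb z])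
      then show ?thesis using Yf[OF z] by (simp add: hardy2_fun_add Y_def k_def)
    qed
    fix \<epsilon> :: real assume \<epsilon>: "\<epsilon> > 0"
    \<comment> \<open>The arc near \<open>1\<close> then contributes at most
      \<open>\<epsilon>\<^sup>2 / 2\<close> to the squared norm, relative to \<open>norm f\<close>;
      the rest of the circle contributes a further \<open>\<epsilon>\<^sup>2 / 4\<close>.\<close>
    define \<delta> where "\<delta> = min 1 (\<epsilon>\<^sup>2 / (2 * C\<^sup>2))"
    have \<delta>: "0 < \<delta>" "\<delta> \<le> 1" "C\<^sup>2 * \<delta> \<le> \<epsilon>\<^sup>2 / 2"
    proof -
      show "0 < \<delta>" "\<delta> \<le> 1" using \<epsilon> C by (auto simp: \<delta>_def)
      have "C\<^sup>2 * \<delta> \<le> C\<^sup>2 * (\<epsilon>\<^sup>2 / (2 * C\<^sup>2))" by (intro mult_left_mono) (auto simp: \<delta>_def)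
      then show "C\<^sup>2 * \<delta> \<le> \<epsilon>\<^sup>2 / 2" using C by simp
    qed
    \<comment> \<open>For \<open>z\<close> at distance at least \<open>\<delta>\<close> from
      \<open>1\<close>, both \<open>\<phi> z\<close> and \<open>\<psi> z\<close> lie in the disc of
      this radius, where the evaluation of a tail carries a factor
      \<open>\<rho> ^ M\<close>.\<close>
    define \<rho> where "\<rho> = sqrt (1 - \<kappa> * \<delta>\<^sup>2)"
    have kd: "0 < \<kappa> * \<delta>\<^sup>2" "\<kappa> * \<delta>\<^sup>2 < 1"
    proof -
      show "0 < \<kappa> * \<delta>\<^sup>2" using \<kappa> \<delta> by simp
      have "\<kappa> * \<delta>\<^sup>2 \<le> \<kappa> * 1" using \<delta> \<kappa> by (intro mult_left_mono power_le_one) auto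
      also have "\<dots> < 1" using \<kappa> by simp
      finally show "\<kappa> * \<delta>\<^sup>2 < 1" .
    qed
    have \<rho>: "0 \<le> \<rho>" "\<rho> < 1" "\<rho>\<^sup>2 = 1 - \<kappa> * \<delta>\<^sup>2" using kd by (auto simp: \<rho>_def)
    define \<eta> where "\<eta> M = (1 + 1 / m) * (\<rho> ^ M / sqrt (\<kappa> * \<delta>\<^sup>2))" for M
    have "\<eta> \<longlonglongrightarrow> (1 + 1 / m) * (0 / sqrt (\<kappa> * \<delta>\<^sup>2))"
      unfolding \<eta>_def using kd \<rho> by (intro tendsto_intros LIMSEQ_power_zero) auto
    then have "\<forall>\<^sub>F M in sequentially. dist (\<eta> M) 0 < \<epsilon> / 2"
      using \<epsilon> by (intro tendstoD) auto
    then obtain M where M: "\<bar>\<eta> M\<bar> < \<epsilon> / 2" by (auto simp: eventually_sequentially)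
    have "norm (K f) \<le> \<epsilon> * norm f" if low: "\<forall>n<M. hardy2_coeff f n = 0" for f
    proof -
      have small: "cmod (k f z) \<le> (\<epsilon> / 2) * norm f" if z: "z \<in> unit_disc" "\<delta> \<le> cmod (z - 1)" for z
      proof -
        have ev: "cmod (hardy2_fun f w) \<le> norm f * (\<rho> ^ M / sqrt (\<kappa> * \<delta>\<^sup>2))"
          if w: "w \<in> unit_disc" "\<kappa> * (cmod (1 - z))\<^sup>2 \<le> 1 - (cmod w)\<^sup>2" for w
        proof -
          have "\<kappa> * \<delta>\<^sup>2 \<le> \<kappa> * (cmod (1 - z))\<^sup>2"
            using z(2) \<delta> \<kappa> by (intro mult_left_mono power_mono) (auto simp: norm_minus_commute)
          then have h: "\<kappa> * \<delta>\<^sup>2 \<le> 1 - (cmod w)\<^sup>2" using w(2) by linarith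
          then have w\<rho>: "cmod w \<le> \<rho>" unfolding \<rho>_def by (intro real_le_rsqrt) simp
          have "cmod (hardy2_fun f w) \<le> norm f * (cmod w ^ M / sqrt (1 - (cmod w)\<^sup>2))"
            using w(1) low by (intro hardy2_eval_tail_bound) auto
          also have "\<dots> \<le> norm f * (\<rho> ^ M / sqrt (\<kappa> * \<delta>\<^sup>2))"
            using h kd w\<rho> \<rho>(1) by (intro mult_left_mono frac_le power_mono real_sqrt_le_mono) auto
          finally show ?thesis .
        qed
        define X where "X = norm f * (\<rho> ^ M / sqrt (\<kappa> * \<delta>\<^sup>2))"
        have "cmod (hardy2_fun f (\<psi> z) / v z) \<le> X / m"
          unfolding norm_divide X_def using ev[OF \<psi>U[OF z(1)] k\<psi>[OF z(1)]] vm[OF z(1)] m \<rho>(1) \<kappa>(1) by (intro frac_le) auto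
        then have "cmod (k f z) \<le> X + X / m"
          using norm_triangle_ineq4[of "hardy2_fun f (\<phi> z)" "hardy2_fun f (\<psi> z) / v z"] ev[OF into[OF z(1)] k\<phi>[OF z(1)]]
          unfolding k_def X_def by linarith
        also have "\<dots> = \<eta> M * norm f" unfolding X_def \<eta>_def distrib_right by (simp add: mult_ac)
        also have "\<dots> \<le> (\<epsilon> / 2) * norm f" using M by (intro mult_right_mono) auto
        finally show ?thesis .
      qed
      have "(norm (K f))\<^sup>2 \<le> ((\<epsilon> / 2) * norm f)\<^sup>2 + (C * norm f)\<^sup>2 * \<delta>"
        unfolding K_def by (rule hardy2_of_bounded_small[OF kh kb small \<delta>(1,2)])
      also have "\<dots> = (\<epsilon>\<^sup>2 / 4 + C\<^sup>2 * \<delta>) * (norm f)\<^sup>2"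
        by (simp add: power_mult_distrib power_divide algebra_simps)
      also have "\<dots> \<le> \<epsilon>\<^sup>2 * (norm f)\<^sup>2"
      proof (rule mult_right_mono)
        show "\<epsilon>\<^sup>2 / 4 + C\<^sup>2 * \<delta> \<le> \<epsilon>\<^sup>2" using \<delta>(3) zero_le_power2[of \<epsilon>] by linarith
      qed simp
      also have "\<dots> = (\<epsilon> * norm f)\<^sup>2" by (simp add: power_mult_distrib)
      finally show ?thesis by (rule power2_le_imp_le) (use \<epsilon> in simp)
    qed
    then show "\<exists>M. \<forall>f. (\<forall>n<M. hardy2_coeff f n = 0) \<longrightarrow> norm (K f) \<le> \<epsilon> * norm f" by blast
  qed
qed

text \<open>\<open>Y f + K f\<close> is the witness that the definite description requires;
  uniqueness holds because values on the disc determine an element.\<close>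

lemma composition_operator_fun:
  assumes "z \<in> unit_disc"
  shows "hardy2_fun (composition_operator \<phi> f) z = hardy2_fun f (\<phi> z)"
proof -
  obtain g where g: "\<forall>z\<in>unit_disc. hardy2_fun g z = hardy2_fun f (\<phi> z)"
    by (rule composition_decomposition) metis
  have "\<exists>!g. \<forall>z\<in>unit_disc. hardy2_fun g z = hardy2_fun f (\<phi> z)"
    using g by (intro ex1I[of _ g]) (auto intro!: hardy2_eqI)
  from theI'[OF this] show ?thesis
    using assms unfolding composition_operator_def by blast
qed

lemma composition_operator_eqI:
  "(\<And>z. z \<in> unit_disc \<Longrightarrow> hardy2_fun g z = hardy2_fun f (\<phi> z)) \<Longrightarrow> composition_operator \<phi> f = g"
  by (intro hardy2_eqI) (simp add: composition_operator_fun)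

lemma composition_operator_linear:
  "composition_operator \<phi> (f + g) = composition_operator \<phi> f + composition_operator \<phi> g"
  "composition_operator \<phi> (c *\<^sub>C f) = c *\<^sub>C composition_operator \<phi> f"
  using into by (auto intro!: composition_operator_eqI
      simp: hardy2_fun_add hardy2_fun_scaleC composition_operator_fun)

lemma bounded_clinear_composition_operator: "bounded_clinear (composition_operator \<phi>)"
proof -
  obtain Y K :: "hardy2 \<Rightarrow> hardy2" and C where Y: "\<And>f. norm (Y f) \<le> 1 / sqrt d * norm f"
    and K: "\<And>f. norm (K f) \<le> C * norm f"
    and YK: "\<And>f z. z \<in> unit_disc \<Longrightarrow> hardy2_fun (Y f + K f) z = hardy2_fun f (\<phi> z)"
    by (rule composition_decomposition) blast
  have "norm (composition_operator \<phi> f) \<le> (1 / sqrt d + C) * norm f" for f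
    using norm_triangle_ineq[of "Y f" "K f"] Y[of f] K[of f] composition_operator_eqI[OF YK, of f]
    unfolding distrib_right by simp
  then show ?thesis by (intro bounded_clinearI) (auto simp: composition_operator_linear)
qed

text \<open>The essential norm is at most \<open>1 / sqrt d\<close>: on tails the \<open>K\<close>
  part costs no more than the gap \<open>q - 1 / sqrt d\<close>, and passing to a tail does not
  increase the norm.\<close>

lemma composition_operator_tail_bound:
  assumes q: "1 / sqrt d < q"
  obtains M where "\<And>f. norm (composition_operator \<phi> (tail M f)) \<le> q * norm f"
proof -
  obtain Y K :: "hardy2 \<Rightarrow> hardy2" where Y: "\<And>f. norm (Y f) \<le> 1 / sqrt d * norm f"
    and YK: "\<And>f z. z \<in> unit_disc \<Longrightarrow> hardy2_fun (Y f + K f) z = hardy2_fun f (\<phi> z)"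
    and K: "\<And>\<epsilon>. \<epsilon> > 0 \<Longrightarrow> \<exists>M. \<forall>f. (\<forall>n<M. hardy2_coeff f n = 0) \<longrightarrow> norm (K f) \<le> \<epsilon> * norm f"
    by (rule composition_decomposition) blast
  obtain M where M: "\<And>f. (\<And>n. n < M \<Longrightarrow> hardy2_coeff f n = 0) \<Longrightarrow> norm (K f) \<le> (q - 1 / sqrt d) * norm f"
    using K[of "q - 1 / sqrt d"] q by auto
  have q0: "q \<ge> 0" using q d_gt_1 by (smt (verit) divide_nonneg_nonneg real_sqrt_ge_zero)
  show thesis
  proof (rule that)
    fix f
    let ?g = "tail M f"
    have "norm (composition_operator \<phi> ?g) \<le> norm (Y ?g) + norm (K ?g)"
      using norm_triangle_ineq[of "Y ?g" "K ?g"] composition_operator_eqI[OF YK, of ?g] by simp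
    also have "\<dots> \<le> 1 / sqrt d * norm ?g + (q - 1 / sqrt d) * norm ?g"
      by (intro add_mono Y M) (simp add: tail_coeff)
    also have "\<dots> = q * norm ?g" by (simp add: algebra_simps)
    also have "\<dots> \<le> q * norm f" by (intro mult_left_mono norm_tail_le q0)
    finally show "norm (composition_operator \<phi> ?g) \<le> q * norm f" .
  qed
qed

text \<open>The operator agrees with its composition with \<open>tail M\<close> on the functions
  whose first \<open>M\<close> coefficients vanish. That composition has norm below
  \<open>cmod \<mu>\<close>, and the monomials of degree below \<open>M\<close> span a
  complement.\<close>

lemma fredholm_outside:
  assumes \<mu>: "1 / sqrt d < cmod \<mu>"
  shows "fredholm (\<lambda>f. composition_operator \<phi> f - \<mu> *\<^sub>C f)"
    and "inj (\<lambda>f. composition_operator \<phi> f - \<mu> *\<^sub>C f) \<Longrightarrow>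
      invertible_operator (\<lambda>f. composition_operator \<phi> f - \<mu> *\<^sub>C f)"
proof -
  define q where "q = (1 / sqrt d + cmod \<mu>) / 2"
  have q: "1 / sqrt d < q" "q < cmod \<mu>" using \<mu> by (auto simp: q_def)
  have q0: "0 \<le> q" using q(1) d_gt_1 by (smt (verit) divide_nonneg_nonneg real_sqrt_ge_zero)
  obtain M where M: "\<And>f. norm (composition_operator \<phi> (tail M f)) \<le> q * norm f"
    using composition_operator_tail_bound[OF q(1)] by metis
  define H where "H = {f. \<forall>n<M. hardy2_coeff f n = 0}"
  have A: "bounded_clinear (\<lambda>f. composition_operator \<phi> (tail M f))"
    by (rule bounded_clinearI[OF _ _ M]) (simp_all add: tail_add tail_scaleC composition_operator_linear)
  have cl: "closed H"
  proof -
    have "closed {f. hardy2_coeff f n = 0}" for n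
      by (intro closed_Collect_eq continuous_intros bounded_linear.continuous_on[OF bounded_linear_hardy2_coeff])
    then have "closed (\<Inter>n<M. {f. hardy2_coeff f n = 0})" by blast
    then show ?thesis unfolding H_def by (simp add: Collect_ball_eq[symmetric] Ball_def flip: Collect_all_eq)
  qed
  have sub: "complex_vs.subspace H"
    by (auto simp: complex_vs.subspace_def H_def hardy2_coeff_zero hardy2_coeff_add hardy2_coeff_scaleC)
  have TA: "composition_operator \<phi> f = composition_operator \<phi> (tail M f)" if "f \<in> H" for f
  proof -
    have "tail M f = f" using that by (intro hardy2_coeff_eqI) (auto simp: tail_coeff H_def)
    then show ?thesis by simp
  qed
  have dec: "\<exists>h\<in>H. f - h \<in> complex_vs.span (monomial ` {..<M})" for f
  proof
    show "tail M f \<in> H" by (simp add: H_def tail_coeff)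
    have "f - tail M f = (\<Sum>n<M. hardy2_coeff f n *\<^sub>C monomial n)" by (simp add: tail_def)
    also have "\<dots> \<in> complex_vs.span (monomial ` {..<M})"
      by (intro complex_vs.span_sum complex_vs.span_scale complex_vs.span_base) auto
    finally show "f - tail M f \<in> complex_vs.span (monomial ` {..<M})" .
  qed
  have fin: "finite (monomial ` {..<M})" by simp
  note fp = fredholm_finite_rank_perturbation[OF bounded_clinear_composition_operator A M q0 q(2) cl sub TA fin dec]
  show "fredholm (\<lambda>f. composition_operator \<phi> f - \<mu> *\<^sub>C f)"
    "inj (\<lambda>f. composition_operator \<phi> f - \<mu> *\<^sub>C f) \<Longrightarrow>
      invertible_operator (\<lambda>f. composition_operator \<phi> f - \<mu> *\<^sub>C f)"
    by (rule fp(1); assumption) (rule fp(2); assumption)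
qed

end

section \<open>Forward and backward orbits\<close>

context repelling_map
begin

text \<open>A preimage near \<open>1\<close> is found by Newton's iteration with the derivative
  frozen at \<open>d\<close>, started at the solution \<open>1 - (1 - w) / d\<close> of the
  linearised equation. The non-tangential cone condition on \<open>w\<close> keeps the ball of
  iteration inside the unit disc.\<close>

lemma inverse_branch:
  obtains C \<delta> where "C > 0" "\<delta> > 0"
    "\<And>w. 1 - w \<noteq> 0 \<Longrightarrow> cmod (1 - w) < \<delta> \<Longrightarrow> cmod (1 - w) \<le> 2 * Re (1 - w) \<Longrightarrow>
      \<exists>z\<in>unit_disc. \<phi> z = w \<and> cmod ((1 - z) - (1 - w) / of_real d) \<le> C * (cmod (1 - w))\<^sup>2"
proof -
  obtain b :: complex and C0 \<delta>0 :: real where C0: "C0 > 0" and \<delta>0: "0 < \<delta>0" "\<delta>0 \<le> 1" and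
    ex: "\<And>z. z \<in> unit_disc \<Longrightarrow> cmod (1 - z) < \<delta>0 \<Longrightarrow>
      cmod (\<phi> z - (1 - of_real d * (1 - z) + b * (1 - z)\<^sup>2)) \<le> C0 * cmod (1 - z) ^ 3"
    and ex': "\<And>z. z \<in> unit_disc \<Longrightarrow> cmod (1 - z) < \<delta>0 \<Longrightarrow> cmod (deriv \<phi> z - of_real d) \<le> C0 * cmod (1 - z)"
    using expansion by metis
  have d0: "d > 0" using d_gt_1 by simp
  have over_d: "x / d \<le> x" if "x \<ge> 0" for x
  proof -
    have "x / d \<le> x / 1" using that d_gt_1 by (intro divide_left_mono) auto
    then show ?thesis by simp
  qed
  define K where "K = cmod b + C0"
  have K: "K > 0" using C0 by (simp add: K_def add_nonneg_pos)
  \<comment> \<open>The first step moves by at most \<open>K * (cmod \<tau>)\<^sup>2\<close>; with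
    contraction ratio \<open>1/2\<close> a ball of twice this radius is invariant.\<close>
  define C where "C = 2 * K"
  \<comment> \<open>The first entry makes the radius of the ball at most
    \<open>cmod \<tau> / (4 * d)\<close>, so real parts stay positive. The next two keep the ball in
    the range of the expansion and close to \<open>1\<close>, and the last gives the ratio
    \<open>1/2\<close>.\<close>
  define \<delta> where "\<delta> = min (1 / (4 * d * C)) (min (\<delta>0 / 2) (min (1/10) (1 / (4 * C0))))"
  show thesis
  proof (rule that[of C \<delta>])
    show "C > 0" "\<delta> > 0" using K d0 \<delta>0 C0 by (auto simp: C_def \<delta>_def)
    fix w :: complex assume w0: "1 - w \<noteq> 0" and w: "cmod (1 - w) < \<delta>" and cone: "cmod (1 - w) \<le> 2 * Re (1 - w)"
    define \<tau> where "\<tau> = 1 - w"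
    have \<tau>0: "cmod \<tau> > 0" using w0 by (simp add: \<tau>_def)
    have \<tau>: "cmod \<tau> < 1 / (4 * d * C)" "2 * cmod \<tau> < \<delta>0" "10 * cmod \<tau> < 1" "4 * cmod \<tau> < 1 / C0"
      using w C0 by (auto simp: \<tau>_def \<delta>_def field_simps)
    have C\<tau>: "C * (cmod \<tau>)\<^sup>2 \<le> cmod \<tau> / (4 * d)"
    proof -
      have "C * cmod \<tau> \<le> 1 / (4 * d)" using \<tau>(1) K d0 by (simp add: C_def field_simps)
      from mult_right_mono[OF this norm_ge_zero[of \<tau>]] show ?thesis by (simp add: power2_eq_square mult.assoc)
    qed
    have td: "cmod \<tau> / d \<le> cmod \<tau>" by (rule over_d) simp
    define z0 where "z0 = 1 - \<tau> / of_real d"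
    define S where "S = cball z0 (C * (cmod \<tau>)\<^sup>2)"
    have S: "z \<in> unit_disc \<and> cmod (1 - z) < \<delta>0 \<and> cmod (1 - z) \<le> 2 * cmod \<tau>" if z: "z \<in> S" for z
    proof -
      let ?t = "1 - z"
      have dz: "cmod (?t - \<tau> / of_real d) \<le> C * (cmod \<tau>)\<^sup>2"
        using z by (simp add: S_def z0_def dist_norm algebra_simps)
      have "cmod ?t \<le> cmod (\<tau> / of_real d) + cmod (?t - \<tau> / of_real d)"
        using norm_triangle_ineq[of "\<tau> / of_real d" "?t - \<tau> / of_real d"] by simp
      then have t1: "cmod ?t \<le> (5/4) * (cmod \<tau> / d)"
        using dz C\<tau> d0 by (simp add: norm_divide)
      have "Re \<tau> / d - Re ?t \<le> cmod (?t - \<tau> / of_real d)"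
        using abs_Re_le_cmod[of "?t - \<tau> / of_real d"] by simp
      moreover have "cmod \<tau> / (2 * d) \<le> Re \<tau> / d" using cone d0 by (simp add: \<tau>_def field_simps)
      ultimately have "cmod \<tau> / (2 * d) - cmod \<tau> / (4 * d) \<le> Re ?t" using dz C\<tau> by linarith
      then have t2: "cmod \<tau> / d \<le> 4 * Re ?t" using d0 by (simp add: field_simps)
      have t3: "cmod ?t < 1/5" using t1 td \<tau>(3) by linarith
      have "(cmod ?t)\<^sup>2 \<le> (1/5) * (5 * Re ?t)"
        unfolding power2_eq_square using t1 t2 t3 by (intro mult_mono) auto
      moreover have "0 < Re ?t"
      proof -
        have "0 < cmod \<tau> / d" using \<tau>0 d0 by simp
        then show ?thesis using t2 by linarith
      qed
      moreover have "(cmod z)\<^sup>2 = 1 - 2 * Re ?t + (cmod ?t)\<^sup>2"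
        unfolding cmod_power2 by (simp add: power2_eq_square algebra_simps)
      ultimately have "(cmod z)\<^sup>2 < 1\<^sup>2" by simp
      then have "cmod z < 1" by (rule power2_less_imp_less) simp
      then show ?thesis using t1 td \<tau>(2) \<tau>0 by (auto intro: order_trans) (use t1 td \<tau>(2) \<tau>0 in linarith)+
    qed
    have z0S: "z0 \<in> S" using K by (simp add: S_def C_def)
    define \<Phi> where "\<Phi> z = z - (\<phi> z - w) / of_real d" for z
    have lip: "cmod (\<Phi> x - \<Phi> y) \<le> 1/2 * cmod (x - y)" if "x \<in> S" "y \<in> S" for x y
    proof (rule field_differentiable_bound[of S])
      show "convex S" unfolding S_def by simp
      fix z assume z: "z \<in> S"
      have "(\<phi> has_field_derivative deriv \<phi> z) (at z)"
        using S[OF z] by (intro holomorphic_derivI[OF hol open_ball]) auto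
      then have "(\<Phi> has_field_derivative (1 - deriv \<phi> z / of_real d)) (at z)"
        unfolding \<Phi>_def using d0 by (auto intro!: derivative_eq_intros)
      then show "(\<Phi> has_field_derivative (1 - deriv \<phi> z / of_real d)) (at z within S)"
        by (rule has_field_derivative_at_within)
      have "cmod (1 - deriv \<phi> z / of_real d) = cmod ((deriv \<phi> z - of_real d) / of_real d)"
        using d0 by (simp add: diff_divide_distrib norm_minus_commute)
      also have "\<dots> = cmod (deriv \<phi> z - of_real d) / d" using d0 by (simp add: norm_divide)
      also have "\<dots> \<le> cmod (deriv \<phi> z - of_real d)" by (rule over_d) simp
      also have "\<dots> \<le> C0 * cmod (1 - z)" using S[OF z] by (intro ex') auto
      also have "\<dots> \<le> C0 * (2 * cmod \<tau>)" using S[OF z] C0 by (intro mult_left_mono) auto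
      also have "\<dots> \<le> 1/2" using \<tau>(4) C0 by (simp add: field_simps)
      finally show "cmod (1 - deriv \<phi> z / of_real d) \<le> 1/2" .
    qed (use that in auto)
    have start: "cmod (\<Phi> z0 - z0) \<le> K * (cmod \<tau>)\<^sup>2"
    proof -
      let ?t = "1 - z0"
      have t: "?t = \<tau> / of_real d" by (simp add: z0_def)
      have ct: "cmod ?t \<le> cmod \<tau>" using td d0 by (simp add: t norm_divide)
      have "w = 1 - of_real d * ?t" using d0 by (simp add: t \<tau>_def)
      then have e: "\<phi> z0 - w = (\<phi> z0 - (1 - of_real d * ?t + b * ?t\<^sup>2)) + b * ?t\<^sup>2" by simp
      have "cmod (\<phi> z0 - w) \<le> C0 * cmod ?t ^ 3 + cmod b * (cmod ?t)\<^sup>2"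
        unfolding e using S[OF z0S] by (intro norm_triangle_le add_mono ex) (auto simp: norm_mult norm_power)
      also have "C0 * cmod ?t ^ 3 \<le> C0 * (cmod ?t)\<^sup>2"
      proof -
        have "cmod ?t ^ 3 = (cmod ?t)\<^sup>2 * cmod ?t" by (simp add: power2_eq_square power3_eq_cube)
        also have "\<dots> \<le> (cmod ?t)\<^sup>2 * 1" using ct \<tau>(3) by (intro mult_left_mono) auto
        finally show ?thesis using C0 by simp
      qed
      finally have "cmod (\<phi> z0 - w) \<le> K * (cmod ?t)\<^sup>2" by (simp add: K_def algebra_simps)
      also have "\<dots> \<le> K * (cmod \<tau>)\<^sup>2" using ct K by (intro mult_left_mono power_mono) auto
      finally have "cmod (\<phi> z0 - w) \<le> K * (cmod \<tau>)\<^sup>2" .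
      moreover have "cmod (\<Phi> z0 - z0) = cmod (\<phi> z0 - w) / d" using d0 by (simp add: \<Phi>_def norm_divide)
      moreover have "cmod (\<phi> z0 - w) / d \<le> cmod (\<phi> z0 - w)" by (rule over_d) simp
      ultimately show ?thesis by linarith
    qed
    have "\<exists>!z\<in>S. \<Phi> z = z"
    proof (rule Banach_fix)
      show "complete S" "S \<noteq> {}" using z0S by (auto simp: S_def complete_eq_closed)
      show "\<Phi> ` S \<subseteq> S"
      proof
        fix y assume "y \<in> \<Phi> ` S"
        then obtain x where x: "x \<in> S" "y = \<Phi> x" by blast
        have "cmod (\<Phi> x - z0) \<le> cmod (\<Phi> x - \<Phi> z0) + cmod (\<Phi> z0 - z0)"
          using norm_triangle_ineq[of "\<Phi> x - \<Phi> z0" "\<Phi> z0 - z0"] by simp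
        also have "\<dots> \<le> 1/2 * (C * (cmod \<tau>)\<^sup>2) + K * (cmod \<tau>)\<^sup>2"
          using lip[OF x(1) z0S] start x(1) by (simp add: S_def dist_norm norm_minus_commute)
        also have "\<dots> = C * (cmod \<tau>)\<^sup>2" by (simp add: C_def)
        finally show "y \<in> S" using x(2) by (simp add: S_def dist_norm norm_minus_commute)
      qed
      show "dist (\<Phi> x) (\<Phi> y) \<le> 1/2 * dist x y" if "x \<in> S" "y \<in> S" for x y
        using lip[OF that] by (simp add: dist_norm)
    qed auto
    then obtain z where z: "z \<in> S" "\<Phi> z = z" by blast
    have "\<phi> z = w" using z(2) d0 by (simp add: \<Phi>_def)
    moreover have "cmod ((1 - z) - (1 - w) / of_real d) \<le> C * (cmod (1 - w))\<^sup>2"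
      using z(1) by (simp add: S_def z0_def \<tau>_def dist_norm algebra_simps)
    ultimately show "\<exists>z\<in>unit_disc. \<phi> z = w \<and> cmod ((1 - z) - (1 - w) / of_real d) \<le> C * (cmod (1 - w))\<^sup>2"
      using S[OF z(1)] by blast
  qed
qed

text \<open>The rescaled distances \<open>d ^ k * (1 - x k)\<close> change at step \<open>k\<close>
  by an amount of order \<open>t^2 / d ^ k\<close>. These changes sum geometrically, so for small
  \<open>t\<close> the orbit stays close to its linear model and inside the cone of
  \<open>inverse_branch\<close>.\<close>

lemma backward_orbit:
  assumes \<epsilon>: "0 < \<epsilon>" "\<epsilon> \<le> 1/8"
  obtains T where "T > 0" "T \<le> 1/8"
    "\<And>t. 0 < t \<Longrightarrow> t \<le> T \<Longrightarrow> \<exists>x :: nat \<Rightarrow> complex. x 0 = 1 - of_real t \<and>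
      (\<forall>k. x k \<in> unit_disc \<and> \<phi> (x (Suc k)) = x k \<and> cmod (of_real (d ^ k) * (1 - x k) - of_real t) \<le> \<epsilon> * t)"
proof -
  obtain C \<delta> where C: "C > 0" and \<delta>: "\<delta> > 0" and
    inv: "\<And>w. 1 - w \<noteq> 0 \<Longrightarrow> cmod (1 - w) < \<delta> \<Longrightarrow> cmod (1 - w) \<le> 2 * Re (1 - w) \<Longrightarrow>
      \<exists>z\<in>unit_disc. \<phi> z = w \<and> cmod ((1 - z) - (1 - w) / of_real d) \<le> C * (cmod (1 - w))\<^sup>2"
    using inverse_branch by metis
  have d0: "d > 0" using d_gt_1 by simp
  have dd: "0 < 1 - 1 / d" using d_gt_1 by simp
  \<comment> \<open>The last entry bounds the change at step \<open>k\<close> by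
    \<open>\<epsilon> * t * (1 - 1 / d) / d ^ k\<close>, whose sum over all \<open>k\<close> is
    \<open>\<epsilon> * t\<close>.\<close>
  define T where "T = min (1/8) (min (\<delta> / 4) (\<epsilon> * (1 - 1 / d) / (4 * C * d)))"
  show thesis
  proof (rule that[of T])
    show "T > 0" using C \<delta> \<epsilon> d0 dd by (auto simp: T_def)
    show "T \<le> 1/8" unfolding T_def by (rule min.cobounded1)
    fix t assume t: "0 < t" "t \<le> T"
    have t\<delta>: "4 * t \<le> \<delta>" using t by (simp add: T_def)
    have tC: "4 * C * d * t \<le> \<epsilon> * (1 - 1 / d)"
    proof -
      have "t \<le> \<epsilon> * (1 - 1 / d) / (4 * C * d)" using t by (simp add: T_def)
      then show ?thesis using C d0 by (simp add: pos_le_divide_eq mult_ac)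
    qed
    \<comment> \<open>The invariant carries the partial geometric sum instead of its limit
      \<open>\<epsilon> * t\<close>, which leaves room for the next change.\<close>
    define P where "P k x \<longleftrightarrow> x \<in> unit_disc \<and> cmod (of_real (d ^ k) * (1 - x) - of_real t) \<le> \<epsilon> * t * (1 - (1 / d) ^ k)" for k x
    have start: "P 0 (1 - of_real t)"
    proof -
      have "cmod (1 - of_real t) = \<bar>1 - t\<bar>" by (metis norm_of_real of_real_1 of_real_diff)
      then show ?thesis using t by (simp add: P_def T_def)
    qed
    have Pb: "cmod (of_real (d ^ k) * (1 - x) - of_real t) \<le> \<epsilon> * t" if "P k x" for k x
    proof -
      have "\<epsilon> * t * (1 - (1 / d) ^ k) \<le> \<epsilon> * t * 1" using \<epsilon> t d0 by (intro mult_left_mono) auto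
      then show ?thesis using that by (simp add: P_def)
    qed
    have "\<exists>f. \<forall>n. P n (f n) \<and> \<phi> (f (Suc n)) = f n"
    proof (rule dependent_nat_choice)
      show "\<exists>x. P 0 x" using start by blast
      fix w k assume Pk: "P k w"
      define u where "u = of_real (d ^ k) * (1 - w)"
      have dk: "d ^ k > 0" "d ^ k \<ge> 1" using d0 d_gt_1 by auto
      have ut: "cmod (u - of_real t) \<le> \<epsilon> * t" using Pb[OF Pk] by (simp add: u_def)
      have ut8: "cmod (u - of_real t) \<le> t / 8"
        using ut mult_right_mono[OF \<epsilon>(2), of t] t by linarith
      have u1: "cmod u \<le> (9/8) * t"
        using norm_triangle_ineq[of "of_real t" "u - of_real t"] ut8 t by simp
      have u2: "(7/8) * t \<le> Re u" using abs_Re_le_cmod[of "u - of_real t"] ut8 by simp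
      have wu: "1 - w = u / of_real (d ^ k)" using d0 by (simp add: u_def)
      have cw: "cmod (1 - w) = cmod u / d ^ k" using dk d0 by (simp add: wu norm_divide norm_power)
      have "1 - w \<noteq> 0" using u2 t d0 unfolding wu by auto
      moreover have "cmod (1 - w) < \<delta>"
      proof -
        have "cmod (1 - w) \<le> cmod u" unfolding cw using divide_left_mono[of 1 "d ^ k" "cmod u"] dk by simp
        then show ?thesis using u1 t\<delta> t by linarith
      qed
      moreover have "cmod (1 - w) \<le> 2 * Re (1 - w)"
      proof -
        have "Re (1 - w) = Re u / d ^ k" unfolding wu by (simp only: Re_divide_of_real)
        moreover have "cmod u \<le> 2 * Re u" using u1 u2 t by linarith
        ultimately show ?thesis unfolding cw using dk divide_right_mono[of "cmod u" "2 * Re u" "d ^ k"] by simp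
      qed
      ultimately obtain z where z: "z \<in> unit_disc" "\<phi> z = w"
        "cmod ((1 - z) - (1 - w) / of_real d) \<le> C * (cmod (1 - w))\<^sup>2" using inv by blast
      have "cmod (of_real (d ^ Suc k) * (1 - z) - u) \<le> \<epsilon> * t * ((1 / d) ^ k - (1 / d) ^ Suc k)"
      proof -
        have "of_real (d ^ Suc k) * (1 - z) - u = of_real (d ^ Suc k) * ((1 - z) - (1 - w) / of_real d)"
          using d0 by (simp add: u_def right_diff_distrib) (simp add: field_simps)
        then have "cmod (of_real (d ^ Suc k) * (1 - z) - u) = d ^ Suc k * cmod ((1 - z) - (1 - w) / of_real d)"
          using d0 by (simp only: norm_mult norm_of_real) simp
        also have "\<dots> \<le> d ^ Suc k * (C * (cmod (1 - w))\<^sup>2)" using z(3) d0 by (intro mult_left_mono) auto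
        also have "\<dots> = C * d * (cmod u)\<^sup>2 / d ^ k"
          unfolding cw using d0 by (simp add: field_simps power2_eq_square)
        also have "\<dots> \<le> C * d * (4 * t\<^sup>2) / d ^ k"
        proof -
          have "(cmod u)\<^sup>2 \<le> (2 * t)\<^sup>2" using u1 t by (intro power_mono) auto
          then show ?thesis using C d0 by (intro divide_right_mono mult_left_mono) (auto simp: power_mult_distrib)
        qed
        also have "\<dots> = (4 * C * d * t) * t / d ^ k" by (simp add: power2_eq_square)
        also have "\<dots> \<le> (\<epsilon> * (1 - 1 / d)) * t / d ^ k"
          using tC t d0 by (intro divide_right_mono mult_right_mono) auto
        also have "\<dots> = \<epsilon> * t * ((1 / d) ^ k - (1 / d) ^ Suc k)"
        proof -
          have "(1 / d) ^ k - (1 / d) ^ Suc k = (1 - 1 / d) / d ^ k"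
            by (simp add: power_one_over diff_divide_distrib)
          then show ?thesis by (simp only:) (simp add: mult_ac)
        qed
        finally show ?thesis .
      qed
      moreover have "cmod (u - of_real t) \<le> \<epsilon> * t * (1 - (1 / d) ^ k)" using Pk by (simp add: P_def u_def)
      ultimately have "cmod (of_real (d ^ Suc k) * (1 - z) - of_real t) \<le>
          \<epsilon> * t * ((1 / d) ^ k - (1 / d) ^ Suc k) + \<epsilon> * t * (1 - (1 / d) ^ k)"
        using norm_triangle_le[of "of_real (d ^ Suc k) * (1 - z) - u" "u - of_real t"] by simp
      also have "\<dots> = \<epsilon> * t * (1 - (1 / d) ^ Suc k)" by (simp add: algebra_simps)
      finally show "\<exists>z. P (Suc k) z \<and> \<phi> z = w" using z by (auto simp: P_def)
    qed
    then obtain x where x: "\<And>n. P n (x n)" "\<And>n. \<phi> (x (Suc n)) = x n" by blast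
    have "x 0 = 1 - of_real t" using x(1)[of 0] by (simp add: P_def) (metis diff_diff_eq2 add_diff_cancel_left')
    then show "\<exists>x :: nat \<Rightarrow> complex. x 0 = 1 - of_real t \<and>
      (\<forall>k. x k \<in> unit_disc \<and> \<phi> (x (Suc k)) = x k \<and> cmod (of_real (d ^ k) * (1 - x k) - of_real t) \<le> \<epsilon> * t)"
      using x Pb P_def by (intro exI[of _ x]) blast
  qed
qed

lemma iterate_into: "z \<in> unit_disc \<Longrightarrow> (\<phi> ^^ n) z \<in> unit_disc"
  by (induction n) (use into in auto)

end

section \<open>The interior fixed point and its multiplier\<close>

locale repelling_map_fixed = repelling_map +
  fixes \<omega> :: complex
  assumes dw: "denjoy_wolff_point \<phi> \<omega>"
begin

lemma iterates_tendsto: "z \<in> unit_disc \<Longrightarrow> (\<lambda>n. (\<phi> ^^ n) z) \<longlonglongrightarrow> \<omega>"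
  using dw by (simp add: denjoy_wolff_point_def)

text \<open>A limit on the circle would have depth zero and hence, by
  \<open>tangent_disc_depth\<close>, be \<open>1\<close>. But an orbit that stays near
  \<open>1\<close> moves away from it at each step, so it cannot converge to
  \<open>1\<close>.\<close>

lemma fixed_point_inside: "\<omega> \<in> unit_disc"
proof (rule ccontr)
  assume "\<omega> \<notin> unit_disc"
  then have \<omega>1: "cmod \<omega> = 1" using dw by (simp add: denjoy_wolff_point_def)
  obtain r where r: "0 < r" "r < 1" "\<And>z. z \<in> unit_disc \<Longrightarrow> \<phi> z \<in> ball (1 - of_real r) r"
    using tangent_disc_data by blast
  obtain \<delta> where \<delta>: "\<delta> > 0"
    "\<And>z. z \<in> unit_disc \<Longrightarrow> cmod (1 - z) < \<delta> \<Longrightarrow> (1 + d) / 2 * cmod (1 - z) \<le> cmod (1 - \<phi> z)"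
    using repels by metis
  define y where "y n = (\<phi> ^^ n) 0" for n
  have yU: "y n \<in> unit_disc" for n unfolding y_def by (rule iterate_into) simp
  have yl: "y \<longlonglongrightarrow> \<omega>" unfolding y_def using iterates_tendsto[of 0] by simp
  have yS: "y (Suc n) = \<phi> (y n)" for n by (simp add: y_def)
  have "(1 / r - 1) * (cmod (1 - \<omega>))\<^sup>2 \<le> 1 - (cmod \<omega>)\<^sup>2"
  proof (rule LIMSEQ_le)
    show "(\<lambda>n. (1 / r - 1) * (cmod (1 - y (Suc n)))\<^sup>2) \<longlonglongrightarrow> (1 / r - 1) * (cmod (1 - \<omega>))\<^sup>2"
      "(\<lambda>n. 1 - (cmod (y (Suc n)))\<^sup>2) \<longlonglongrightarrow> 1 - (cmod \<omega>)\<^sup>2"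
      by (intro tendsto_intros LIMSEQ_Suc[OF yl])+
    show "\<exists>N. \<forall>n\<ge>N. (1 / r - 1) * (cmod (1 - y (Suc n)))\<^sup>2 \<le> 1 - (cmod (y (Suc n)))\<^sup>2"
      unfolding yS using tangent_disc_depth[OF r(1) r(3)[OF yU]] by blast
  qed
  moreover have "1 / r - 1 > 0" using r by simp
  ultimately have "\<omega> = 1" using \<omega>1 by (simp add: mult_le_0_iff)
  then have "(\<lambda>n. cmod (1 - y n)) \<longlonglongrightarrow> 0"
    using tendsto_norm[OF tendsto_diff[OF tendsto_const[of 1] yl]] by simp
  then have "\<forall>\<^sub>F n in sequentially. cmod (1 - y n) < \<delta>"
    using \<delta>(1) by (rule order_tendstoD)
  then obtain N where N: "\<And>n. n \<ge> N \<Longrightarrow> cmod (1 - y n) < \<delta>" by (auto simp: eventually_sequentially)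
  have mono: "cmod (1 - y (N + n)) \<ge> cmod (1 - y N)" for n
  proof (induction n)
    case (Suc n)
    have "1 * cmod (1 - y (N + n)) \<le> (1 + d) / 2 * cmod (1 - y (N + n))"
      using d_gt_1 by (intro mult_right_mono) auto
    also have "\<dots> \<le> cmod (1 - y (N + Suc n))" using \<delta>(2)[OF yU N, of "N + n"] by (simp add: yS)
    finally show ?case using Suc by simp
  qed simp
  have "cmod (1 - y N) \<le> 0"
  proof (rule LIMSEQ_le_const[OF \<open>(\<lambda>n. cmod (1 - y n)) \<longlonglongrightarrow> 0\<close>])
    show "\<exists>M. \<forall>n\<ge>M. cmod (1 - y N) \<le> cmod (1 - y n)"
      using mono by (metis le_Suc_ex)
  qed
  then show False using yU[of N] by auto
qed

lemma fixed_point: "\<phi> \<omega> = \<omega>"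
proof -
  have c: "isCont \<phi> \<omega>"
    using holomorphic_on_imp_continuous_on[OF hol] fixed_point_inside
      continuous_on_eq_continuous_at[OF open_ball, of 0 1 \<phi>] by blast
  have "(\<lambda>n. \<phi> ((\<phi> ^^ n) 0)) \<longlonglongrightarrow> \<phi> \<omega>"
    by (rule isCont_tendsto_compose[OF c iterates_tendsto]) simp
  moreover have "(\<lambda>n. \<phi> ((\<phi> ^^ n) 0)) \<longlonglongrightarrow> \<omega>"
    using LIMSEQ_Suc[OF iterates_tendsto[of 0]] by simp
  ultimately show ?thesis using LIMSEQ_unique by blast
qed

lemma iterate_holomorphic: "(\<phi> ^^ n) holomorphic_on unit_disc"
proof (induction n)
  case 0
  then show ?case by (simp add: id_def)
next
  case (Suc n)
  then show ?case
    using holomorphic_on_compose_gen[OF Suc hol] iterate_into by (simp add: image_subset_iff o_def)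
qed

text \<open>The first Taylor coefficient of \<open>\<phi>\<^sup>n\<close> at \<open>\<omega>\<close> is \<open>\<phi>'(\<omega>)\<^sup>n\<close>; bounded pointwise convergence forces it to tend to \<open>0\<close>.\<close>

lemma multiplier_less_1: "cmod (deriv \<phi> \<omega>) < 1"
proof -
  \<comment> \<open>The largest scale for which the rescaled disc centred at \<open>\<omega>\<close>
    fits in the unit disc, so that means on circles about \<open>0\<close> apply to the iterates
    near \<open>\<omega>\<close>.\<close>
  define s where "s = 1 - cmod \<omega>"
  have s: "s > 0" using fixed_point_inside by (simp add: s_def)
  have inside: "\<omega> + of_real s * z \<in> unit_disc" if "z \<in> unit_disc" for z
  proof -
    have "cmod (\<omega> + of_real s * z) \<le> cmod \<omega> + s * cmod z"
      by (rule order_trans[OF norm_triangle_ineq]) (use s in \<open>simp add: norm_mult\<close>)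
    also have "s * cmod z < s * 1" using that s by (intro mult_strict_left_mono) auto
    finally show ?thesis by (simp add: s_def)
  qed
  define f where "f n z = (\<phi> ^^ n) (\<omega> + of_real s * z) - \<omega>" for n z
  have fh: "f n holomorphic_on unit_disc" for n
  proof -
    have "((\<phi> ^^ n) \<circ> (\<lambda>z. \<omega> + of_real s * z)) holomorphic_on unit_disc"
      by (rule holomorphic_on_compose_gen[OF _ iterate_holomorphic])
         (use inside in \<open>auto intro!: holomorphic_intros simp: image_subset_iff\<close>)
    then show ?thesis unfolding f_def by (intro holomorphic_intros) (simp add: o_def)
  qed
  have dn: "((\<phi> ^^ n) has_field_derivative deriv \<phi> \<omega> ^ n) (at \<omega>)" for n
  proof (induction n)
    case 0
    then show ?case using DERIV_ident by (simp add: id_def)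
  next
    case (Suc n)
    have "(\<phi> ^^ n) \<omega> = \<omega>" by (induction n) (simp_all add: fixed_point)
    moreover have "(\<phi> has_field_derivative deriv \<phi> \<omega>) (at \<omega>)"
      by (rule holomorphic_derivI[OF hol open_ball fixed_point_inside])
    ultimately show ?case using DERIV_chain[OF _ Suc, of \<phi> "deriv \<phi> \<omega>"] by (simp add: o_def mult.commute)
  qed
  have coeff: "maclaurin_coeff (f n) 1 = deriv \<phi> \<omega> ^ n * of_real s" for n
  proof -
    have "((\<phi> ^^ n) has_field_derivative deriv \<phi> \<omega> ^ n) (at (\<omega> + of_real s * 0))" using dn by simp
    moreover have "((\<lambda>z. \<omega> + of_real s * z) has_field_derivative of_real s) (at 0)"
      by (auto intro!: derivative_eq_intros)
    ultimately have "((\<lambda>z. (\<phi> ^^ n) (\<omega> + of_real s * z)) has_field_derivative deriv \<phi> \<omega> ^ n * of_real s) (at 0)"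
      by (rule DERIV_chain2[where f="\<phi> ^^ n" and g="\<lambda>z. \<omega> + of_real s * z"])
    then have "(f n has_field_derivative deriv \<phi> \<omega> ^ n * of_real s) (at 0)"
      unfolding f_def by (auto intro!: derivative_eq_intros)
    then show ?thesis by (simp add: maclaurin_coeff_def DERIV_imp_deriv)
  qed
  have fb: "cmod (f n z) \<le> 2" if "z \<in> unit_disc" for n z
    using norm_triangle_ineq4[of "(\<phi> ^^ n) (\<omega> + of_real s * z)" \<omega>] iterate_into[OF inside[OF that], of n] fixed_point_inside
    by (simp add: f_def)
  have "(\<lambda>n. integral {-pi..pi} (\<lambda>\<theta>. (cmod (f n (circle_point (1/2) \<theta>)))\<^sup>2)) \<longlonglongrightarrow> integral {-pi..pi} (\<lambda>\<theta>. 0)"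
  proof (rule dominated_convergence(2)[where h="\<lambda>\<theta>. 4"])
    show "(\<lambda>\<theta>. (cmod (f n (circle_point (1/2) \<theta>)))\<^sup>2) integrable_on {-pi..pi}" for n
      by (rule circle_integrable[OF fh]) auto
    show "norm ((cmod (f n (circle_point (1/2) \<theta>)))\<^sup>2) \<le> 4" for n \<theta>
      using power_mono[OF fb[of "circle_point (1/2) \<theta>" n], of 2] by simp
    fix \<theta> :: real
    have "(\<lambda>n. f n (circle_point (1/2) \<theta>)) \<longlonglongrightarrow> \<omega> - \<omega>"
      unfolding f_def by (intro tendsto_diff tendsto_const iterates_tendsto inside) simp
    then have "(\<lambda>n. (cmod (f n (circle_point (1/2) \<theta>)))\<^sup>2) \<longlonglongrightarrow> (cmod (\<omega> - \<omega>))\<^sup>2"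
      by (intro tendsto_intros)
    then show "(\<lambda>n. (cmod (f n (circle_point (1/2) \<theta>)))\<^sup>2) \<longlonglongrightarrow> 0" by simp
  qed (intro integrable_continuous_real continuous_intros)
  then have "(\<lambda>n. circle_mean (f n) (1/2)) \<longlonglongrightarrow> 0"
    unfolding circle_mean_def using tendsto_divide[OF _ tendsto_const[of "2 * pi"]] by fastforce
  moreover have "cmod (deriv \<phi> \<omega>) ^ (2 * n) * (s\<^sup>2 / 4) \<le> circle_mean (f n) (1/2)" for n
  proof -
    have sums: "(\<lambda>k. (cmod (maclaurin_coeff (f n) k))\<^sup>2 * (1/2) ^ (2 * k)) sums circle_mean (f n) (1/2)"
      by (rule circle_mean_sums[OF fh]) auto
    have "(\<Sum>k\<in>{1}. (cmod (maclaurin_coeff (f n) k))\<^sup>2 * (1/2) ^ (2 * k)) \<le> (\<Sum>k. (cmod (maclaurin_coeff (f n) k))\<^sup>2 * (1/2) ^ (2 * k))"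
      by (rule sum_le_suminf[OF sums_summable[OF sums]]) auto
    also have "\<dots> = circle_mean (f n) (1/2)" using sums_unique[OF sums] by simp
    finally have "(cmod (deriv \<phi> \<omega> ^ n * of_real s))\<^sup>2 / 4 \<le> circle_mean (f n) (1/2)"
      by (simp add: coeff[unfolded One_nat_def] power2_eq_square)
    moreover have "(cmod (deriv \<phi> \<omega> ^ n * of_real s))\<^sup>2 = cmod (deriv \<phi> \<omega>) ^ (2 * n) * s\<^sup>2"
      by (simp add: norm_mult norm_power power_mult_distrib power_mult[symmetric] mult.commute)
    ultimately show ?thesis by simp
  qed
  ultimately have lim0: "(\<lambda>n. cmod (deriv \<phi> \<omega>) ^ (2 * n) * (s\<^sup>2 / 4)) \<longlonglongrightarrow> 0"
    using s by (intro Lim_null_comparison[of "\<lambda>n. cmod (deriv \<phi> \<omega>) ^ (2 * n) * (s\<^sup>2 / 4)" "\<lambda>n. circle_mean (f n) (1/2)"]) auto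
  have "\<forall>\<^sub>F n in sequentially. cmod (deriv \<phi> \<omega>) ^ (2 * n) * (s\<^sup>2 / 4) < s\<^sup>2 / 4"
    by (rule order_tendstoD(2)[OF lim0]) (use s in simp)
  then obtain n where "cmod (deriv \<phi> \<omega>) ^ (2 * n) * (s\<^sup>2 / 4) < 1 * (s\<^sup>2 / 4)" by (auto simp: eventually_sequentially)
  then have "cmod (deriv \<phi> \<omega>) ^ (2 * n) < 1"
    by (rule mult_right_less_imp_less) (use s in simp)
  then show ?thesis using one_le_power[of "cmod (deriv \<phi> \<omega>)" "2 * n"] by linarith
qed

text \<open>Any rate strictly between the modulus of the multiplier and \<open>1\<close> holds near
  \<open>\<omega>\<close>. The rate is common to all orbits and only \<open>C\<close> depends on the
  start; this lets one order \<open>m\<close> of vanishing serve every orbit.\<close>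

lemma forward_orbit_geometric:
  obtains \<theta> where "0 < \<theta>" "\<theta> < 1"
    "\<And>z. z \<in> unit_disc \<Longrightarrow> \<exists>C>0. \<forall>k. cmod ((\<phi> ^^ k) z - \<omega>) \<le> C * \<theta> ^ k"
proof -
  define \<theta> where "\<theta> = (1 + cmod (deriv \<phi> \<omega>)) / 2"
  have \<theta>: "0 < \<theta>" "\<theta> < 1" "cmod (deriv \<phi> \<omega>) < \<theta>"
    using multiplier_less_1 norm_ge_zero[of "deriv \<phi> \<omega>"] by (auto simp: \<theta>_def simp del: norm_ge_zero)
  have "(\<phi> has_field_derivative deriv \<phi> \<omega>) (at \<omega>)"
    by (rule holomorphic_derivI[OF hol open_ball fixed_point_inside])
  then have "((\<lambda>z. cmod ((\<phi> z - \<phi> \<omega>) / (z - \<omega>))) \<longlongrightarrow> cmod (deriv \<phi> \<omega>)) (at \<omega>)"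
    unfolding has_field_derivative_iff by (rule tendsto_norm)
  then have "\<forall>\<^sub>F z in at \<omega>. cmod ((\<phi> z - \<phi> \<omega>) / (z - \<omega>)) < \<theta>"
    using \<theta>(3) by (rule order_tendstoD)
  then obtain \<delta> where \<delta>: "\<delta> > 0" "\<And>z. z \<noteq> \<omega> \<Longrightarrow> dist z \<omega> < \<delta> \<Longrightarrow> cmod ((\<phi> z - \<phi> \<omega>) / (z - \<omega>)) < \<theta>"
    by (auto simp: eventually_at)
  have step: "cmod (\<phi> z - \<omega>) \<le> \<theta> * cmod (z - \<omega>)" if "dist z \<omega> < \<delta>" for z
    using \<delta>(2)[OF _ that] by (cases "z = \<omega>") (auto simp: fixed_point norm_divide field_simps)
  show thesis
  proof (rule that[OF \<theta>(1,2)])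
    fix z assume z: "z \<in> unit_disc"
    define y where "y n = (\<phi> ^^ n) z" for n
    have "\<forall>\<^sub>F n in sequentially. dist (y n) \<omega> < \<delta>"
      unfolding y_def using iterates_tendsto[OF z] \<delta>(1) by (rule tendstoD)
    then obtain N where N: "\<And>n. n \<ge> N \<Longrightarrow> dist (y n) \<omega> < \<delta>" by (auto simp: eventually_sequentially)
    have geo: "cmod (y (N + n) - \<omega>) \<le> \<theta> ^ n * cmod (y N - \<omega>)" for n
    proof (induction n)
      case (Suc n)
      have "cmod (y (N + Suc n) - \<omega>) \<le> \<theta> * cmod (y (N + n) - \<omega>)"
        using step[OF N, of "N + n"] by (simp add: y_def)
      also have "\<dots> \<le> \<theta> * (\<theta> ^ n * cmod (y N - \<omega>))" using Suc \<theta> by (intro mult_left_mono) auto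
      finally show ?case by (simp add: mult.assoc)
    qed simp
    have y2: "cmod (y n - \<omega>) \<le> 2" for n
      using norm_triangle_ineq4[of "y n" \<omega>] iterate_into[OF z, of n] fixed_point_inside by (simp add: y_def)
    have "cmod (y k - \<omega>) \<le> 2 / \<theta> ^ N * \<theta> ^ k" for k
    proof (cases "k \<ge> N")
      case True
      then obtain n where n: "k = N + n" using le_Suc_ex by blast
      \<comment> \<open>The factor \<open>1 / \<theta> ^ N\<close> absorbs the steps before the
        orbit enters the contracting neighbourhood; there the trivial distance bound
        \<open>2\<close> is used.\<close>
      have "cmod (y k - \<omega>) \<le> \<theta> ^ n * 2"
        unfolding n using geo[of n] y2[of N] \<theta> by (meson mult_left_mono order_trans less_imp_le zero_le_power)
      also have "\<dots> = 2 / \<theta> ^ N * \<theta> ^ k" using \<theta> by (simp add: n power_add)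
      finally show ?thesis .
    next
      case False
      then have "\<theta> ^ N \<le> \<theta> ^ k" using \<theta> by (intro power_decreasing) auto
      then have "2 * 1 \<le> 2 * (\<theta> ^ k / \<theta> ^ N)" using \<theta> by (intro mult_left_mono) auto
      then show ?thesis using y2[of k] by simp
    qed
    then show "\<exists>C>0. \<forall>k. cmod ((\<phi> ^^ k) z - \<omega>) \<le> C * \<theta> ^ k"
      using \<theta> by (intro exI[of _ "2 / \<theta> ^ N"]) (auto simp: y_def)
  qed
qed

end

section \<open>Eigenfunctionals carried by orbits\<close>

text \<open>Gaussian elimination: an equation with a nonzero coefficient is solved for that unknown
  and substituted into the others, which removes one equation and one unknown.\<close>

lemma underdetermined_system:
  fixes l :: "'j \<Rightarrow> 'b \<Rightarrow> complex"
  assumes "finite B" "finite J" "card B < card J"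
  shows "\<exists>a. (\<exists>j\<in>J. a j \<noteq> 0) \<and> (\<forall>b\<in>B. (\<Sum>j\<in>J. a j * l j b) = 0)"
  using assms
proof (induction B arbitrary: J l rule: finite_induct)
  case empty
  then show ?case by (intro exI[of _ "\<lambda>_. 1"]) (auto simp: card_gt_0_iff)
next
  case (insert b B)
  show ?case
  proof (cases "\<forall>j\<in>J. l j b = 0")
    case True
    have "card B < card J" using insert by simp
    then obtain a where "\<exists>j\<in>J. a j \<noteq> 0" "\<forall>b\<in>B. (\<Sum>j\<in>J. a j * l j b) = 0"
      using insert.IH[OF insert.prems(1)] by metis
    then show ?thesis using True by (intro exI[of _ a]) auto
  next
    case False
    then obtain j0 where j0: "j0 \<in> J" "l j0 b \<noteq> 0" by blast
    define l' where "l' j c = l j c - (l j b / l j0 b) * l j0 c" for j c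
    have "card B < card (J - {j0})" using insert j0 by simp
    then obtain a where a: "\<exists>j\<in>J - {j0}. a j \<noteq> 0" "\<forall>c\<in>B. (\<Sum>j\<in>J - {j0}. a j * l' j c) = 0"
      using insert.IH[of "J - {j0}" l'] insert.prems by auto
    define s where "s = (\<Sum>j\<in>J - {j0}. a j * l j b) / l j0 b"
    define a' where "a' j = (if j = j0 then - s else a j)" for j
    have sum: "(\<Sum>j\<in>J. a' j * l j c) = (\<Sum>j\<in>J - {j0}. a j * l j c) - s * l j0 c" for c
      unfolding sum.remove[OF insert.prems(1) j0(1)] a'_def by simp
    have eq: "(\<Sum>j\<in>J - {j0}. a j * l j c) - s * l j0 c = (\<Sum>j\<in>J - {j0}. a j * l' j c)" for c
      unfolding s_def l'_def by (simp add: right_diff_distrib sum_subtractf sum_divide_distrib sum_distrib_right mult.assoc)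
    have "(\<Sum>j\<in>J. a' j * l j c) = 0" if "c \<in> insert b B" for c
    proof (cases "c = b")
      case True
      then show ?thesis unfolding sum using j0(2) by (simp add: s_def)
    next
      case False
      then show ?thesis unfolding sum eq using a(2) that by auto
    qed
    moreover have "\<exists>j\<in>J. a' j \<noteq> 0" using a(1) by (auto simp: a'_def)
    ultimately show ?thesis by blast
  qed
qed

text \<open>
  Test with \<open>P = q * ((z - 1) * (z - \<omega>))\<^sup>n\<close>, where \<open>q\<close> kills the finitely many other points away
  from \<open>1\<close> and \<open>\<omega>\<close>, and let \<open>n\<close> tend to infinity.
\<close>

lemma isolated_weight_zero:
  fixes c z :: "'i \<Rightarrow> nat \<Rightarrow> complex"
  assumes I: "finite I" and zb: "\<And>i k. i \<in> I \<Longrightarrow> cmod (z i k) \<le> 1"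
    and lim: "\<And>i. i \<in> I \<Longrightarrow> z i \<longlonglongrightarrow> 1 \<or> z i \<longlonglongrightarrow> \<omega>"
    and summ: "\<And>i. i \<in> I \<Longrightarrow> summable (\<lambda>k. cmod (c i k) * cmod (z i k - \<omega>) ^ m)"
    and i0: "i0 \<in> I" and p: "p = z i0 k0" "p \<noteq> 1" "p \<noteq> \<omega>"
    and uniq: "\<And>i k. i \<in> I \<Longrightarrow> z i k = p \<Longrightarrow> i = i0 \<and> k = k0"
    and zero: "\<And>P. P holomorphic_on UNIV \<Longrightarrow> (\<Sum>i\<in>I. \<Sum>k. c i k * ((z i k - \<omega>) ^ m * P (z i k))) = 0"
  shows "c i0 k0 = 0"
proof -
  define H where "H x = (x - 1) * (x - \<omega>)" for x
  define h where "h = cmod (H p)"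
  have h: "h > 0" using p by (simp add: h_def H_def)
  \<comment> \<open>The function \<open>H\<close> tends to \<open>0\<close> along every sequence, so
    only finitely many points other than \<open>p\<close> have \<open>H\<close> larger than half its
    modulus at \<open>p\<close>; the factor \<open>q\<close> vanishes at these.\<close>
  define Z where "Z = {x. \<exists>i\<in>I. \<exists>k. x = z i k \<and> x \<noteq> p \<and> h / 2 < cmod (H x)}"
  have "\<exists>K. \<forall>k\<ge>K. cmod (H (z i k)) < h / 2" if i: "i \<in> I" for i
  proof -
    have "(\<lambda>k. H (z i k)) \<longlonglongrightarrow> 0"
      using lim[OF i] unfolding H_def
    proof
      assume l: "z i \<longlonglongrightarrow> 1"
      have "(\<lambda>k. (z i k - 1) * (z i k - \<omega>)) \<longlonglongrightarrow> (1 - 1) * (1 - \<omega>)" by (intro tendsto_intros l)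
      then show "(\<lambda>k. (z i k - 1) * (z i k - \<omega>)) \<longlonglongrightarrow> 0" by simp
    next
      assume l: "z i \<longlonglongrightarrow> \<omega>"
      have "(\<lambda>k. (z i k - 1) * (z i k - \<omega>)) \<longlonglongrightarrow> (\<omega> - 1) * (\<omega> - \<omega>)" by (intro tendsto_intros l)
      then show "(\<lambda>k. (z i k - 1) * (z i k - \<omega>)) \<longlonglongrightarrow> 0" by simp
    qed
    from tendstoD[OF this, of "h / 2"] show ?thesis using h by (simp add: eventually_sequentially)
  qed
  then obtain K where K: "\<And>i k. i \<in> I \<Longrightarrow> k \<ge> K i \<Longrightarrow> cmod (H (z i k)) < h / 2" by metis
  have "Z \<subseteq> (\<Union>i\<in>I. z i ` {..<K i})"
  proof
    fix x assume "x \<in> Z"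
    then obtain i k where ik: "i \<in> I" "x = z i k" "h / 2 < cmod (H x)" unfolding Z_def by blast
    then have "k < K i" using K[of i k] by (metis not_le order_less_asym)
    then show "x \<in> (\<Union>i\<in>I. z i ` {..<K i})" using ik by blast
  qed
  then have finZ: "finite Z" by (rule finite_subset) (use I in auto)
  have Zb: "cmod x \<le> 1" if "x \<in> Z" for x using that zb by (auto simp: Z_def)
  define q where "q y = (\<Prod>x\<in>Z. y - x)" for y
  define B where "B = (2::real) ^ card Z"
  have qb: "cmod (q y) \<le> B" if "cmod y \<le> 1" for y
  proof -
    have "cmod (q y) = (\<Prod>x\<in>Z. cmod (y - x))" by (simp add: q_def prod_norm)
    also have "\<dots> \<le> (\<Prod>x\<in>Z. 2)"
    proof (intro prod_mono conjI)
      fix x assume "x \<in> Z"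
      then show "cmod (y - x) \<le> 2" using norm_triangle_ineq4[of y x] that Zb[of x] by linarith
    qed simp
    finally show ?thesis by (simp add: B_def)
  qed
  have qp: "q p \<noteq> 0" using finZ by (auto simp: q_def Z_def)
  define w where "w i k = cmod (c i k) * cmod (z i k - \<omega>) ^ m" for i k
  define D where "D = (\<Sum>i\<in>I. \<Sum>k. w i k) * B"
  \<comment> \<open>Every term except the one at \<open>p\<close> is at most its weight times
    \<open>B * (h / 2) ^ n\<close>. Against the factor \<open>h ^ n\<close> of the term at
    \<open>p\<close> this gains \<open>2 ^ n\<close>.\<close>
  have main: "cmod (c i0 k0 * ((p - \<omega>) ^ m * q p)) * h ^ n \<le> D * (h / 2) ^ n" for n
  proof -
    define T where "T i k = c i k * ((z i k - \<omega>) ^ m * (q (z i k) * H (z i k) ^ n))" for i k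
    define T' where "T' i k = (if i = i0 \<and> k = k0 then 0 else T i k)" for i k
    have T'b: "cmod (T' i k) \<le> w i k * (B * (h / 2) ^ n)" if i: "i \<in> I" for i k
    proof (cases "i = i0 \<and> k = k0 \<or> z i k \<in> Z")
      case True
      then have "T' i k = 0"
      proof
        assume "z i k \<in> Z"
        then have "q (z i k) = 0" using finZ by (auto simp: q_def)
        then show ?thesis by (simp add: T'_def T_def)
      qed (simp add: T'_def)
      then show ?thesis using h by (simp add: w_def B_def)
    next
      case False
      then have "z i k \<noteq> p" using uniq[OF i] by blast
      then have "cmod (H (z i k)) \<le> h / 2" using False i by (auto simp: Z_def not_less)
      then have "cmod (q (z i k)) * cmod (H (z i k)) ^ n \<le> B * (h / 2) ^ n"
        using qb[OF zb[OF i]] by (intro mult_mono power_mono) (auto simp: B_def)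
      then have "w i k * (cmod (q (z i k)) * cmod (H (z i k)) ^ n) \<le> w i k * (B * (h / 2) ^ n)"
        by (intro mult_left_mono) (auto simp: w_def)
      moreover have "T' i k = T i k" using False by (auto simp: T'_def)
      ultimately show ?thesis by (simp add: T_def norm_mult norm_power w_def mult.assoc)
    qed
    have ws: "summable (\<lambda>k. w i k * (B * (h / 2) ^ n))" if "i \<in> I" for i
      using summ[OF that] unfolding w_def by (rule summable_mult2)
    have T's: "summable (\<lambda>k. cmod (T' i k))" if "i \<in> I" for i
      by (rule summable_comparison_test'[OF ws[OF that]]) (use T'b[OF that] in auto)
    have T'n: "cmod (\<Sum>k. T' i k) \<le> (\<Sum>k. w i k) * (B * (h / 2) ^ n)" if i: "i \<in> I" for i
    proof -
      have "cmod (\<Sum>k. T' i k) \<le> (\<Sum>k. cmod (T' i k))" by (rule summable_norm[OF T's[OF i]])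
      also have "\<dots> \<le> (\<Sum>k. w i k * (B * (h / 2) ^ n))" by (rule suminf_le[OF T'b[OF i] T's[OF i] ws[OF i]])
      also have "\<dots> = (\<Sum>k. w i k) * (B * (h / 2) ^ n)"
        using summ[OF i] unfolding w_def by (rule suminf_mult2[symmetric])
      finally show ?thesis .
    qed
    have split: "(\<Sum>k. T i k) = (\<Sum>k. T' i k) + (if i = i0 then T i0 k0 else 0)" if i: "i \<in> I" for i
    proof -
      have "(\<lambda>k. if k = k0 then (if i = i0 then T i0 k0 else 0) else 0) sums (if i = i0 then T i0 k0 else 0)"
        by (rule sums_single)
      from sums_add[OF summable_sums[OF summable_norm_cancel[OF T's[OF i]]] this]
      have "(\<lambda>k. T' i k + (if k = k0 then (if i = i0 then T i0 k0 else 0) else 0)) sums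
          ((\<Sum>k. T' i k) + (if i = i0 then T i0 k0 else 0))" .
      moreover have "T' i k + (if k = k0 then (if i = i0 then T i0 k0 else 0) else 0) = T i k" for k
        by (simp add: T'_def)
      ultimately show ?thesis by (simp add: sums_iff)
    qed
    have "(\<Sum>i\<in>I. \<Sum>k. T i k) = 0"
      unfolding T_def by (rule zero) (auto simp: q_def H_def intro!: holomorphic_intros)
    then have "(\<Sum>i\<in>I. (\<Sum>k. T' i k) + (if i = i0 then T i0 k0 else 0)) = 0"
      using split by simp
    then have "T i0 k0 = - (\<Sum>i\<in>I. \<Sum>k. T' i k)"
      using I i0 by (simp add: sum.distrib add_eq_0_iff2)
    then have "cmod (T i0 k0) \<le> (\<Sum>i\<in>I. cmod (\<Sum>k. T' i k))" by (simp add: norm_sum)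
    also have "\<dots> \<le> (\<Sum>i\<in>I. (\<Sum>k. w i k) * (B * (h / 2) ^ n))" by (intro sum_mono T'n)
    also have "\<dots> = D * (h / 2) ^ n" by (simp add: D_def sum_distrib_right mult.assoc)
    finally show ?thesis by (simp add: T_def p(1)[symmetric] norm_mult norm_power h_def mult.assoc)
  qed
  define A where "A = cmod (c i0 k0 * ((p - \<omega>) ^ m * q p))"
  have "A \<le> D * (1/2) ^ n" for n
  proof -
    have "A * h ^ n \<le> D * (1/2) ^ n * h ^ n" using main[of n] by (simp add: A_def power_divide)
    then show ?thesis using h by simp
  qed
  moreover have "(\<lambda>n. D * (1/2) ^ n) \<longlonglongrightarrow> D * 0" by (intro tendsto_intros LIMSEQ_power_zero) auto
  ultimately have "A \<le> D * 0" by (intro LIMSEQ_le_const) auto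
  then have "A = 0" by (simp add: A_def)
  then show ?thesis using p(3) qp by (simp add: A_def)
qed

section \<open>Dividing out zeros: the backward shift centred at a point\<close>

definition difference_quotient :: "complex \<Rightarrow> (complex \<Rightarrow> complex) \<Rightarrow> complex \<Rightarrow> complex"
  where "difference_quotient a f z = (if z = a then deriv f a else (f z - f a) / (z - a))"

lemma difference_quotient_holomorphic:
  "f holomorphic_on S \<Longrightarrow> open S \<Longrightarrow> difference_quotient a f holomorphic_on S"
  using pole_lemma_open[of f S a] unfolding difference_quotient_def[abs_def] by blast

lemma iterated_difference_quotient_holomorphic:
  "f holomorphic_on S \<Longrightarrow> open S \<Longrightarrow> (difference_quotient a ^^ m) f holomorphic_on S"
  by (induction m) (auto intro: difference_quotient_holomorphic)

lemma difference_quotient_expansion: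
  "f z = (\<Sum>i<m. (difference_quotient a ^^ i) f a * (z - a) ^ i) + (z - a) ^ m * (difference_quotient a ^^ m) f z"
proof (induction m)
  case (Suc m)
  have "g z = g a + (z - a) * difference_quotient a g z" for g
    by (simp add: difference_quotient_def)
  note e = this[of "(difference_quotient a ^^ m) f"]
  show ?case by (subst Suc, subst e) (simp add: distrib_left mult_ac)
qed simp

text \<open>Each quotient removes one factor \<open>z - a\<close>; at \<open>a\<close> itself the
  product rule gives the value of the remaining factor.\<close>

lemma difference_quotient_unique:
  assumes "open S" "a \<in> S" "h holomorphic_on S" "\<And>z. z \<in> S \<Longrightarrow> f z = (z - a) ^ m * h z" "z \<in> S"
  shows "(difference_quotient a ^^ m) f z = h z"
  using assms(4,5)
proof (induction m arbitrary: f z)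
  case (Suc m)
  define g where "g z = (z - a) ^ m * h z" for z
  have gh: "g holomorphic_on S" unfolding g_def by (intro holomorphic_intros assms)
  have fa: "f x = (x - a) * g x" if "x \<in> S" for x using Suc.prems(1)[OF that] by (simp add: g_def)
  have "difference_quotient a f x = (x - a) ^ m * h x" if x: "x \<in> S" for x
  proof (cases "x = a")
    case True
    have "(g has_field_derivative deriv g a) (at a)"
      by (rule holomorphic_derivI[OF gh assms(1,2)])
    then have "((\<lambda>x. (x - a) * g x) has_field_derivative g a) (at a)"
      by (auto intro!: derivative_eq_intros)
    then have "(f has_field_derivative g a) (at a)"
      by (rule has_field_derivative_transform_within_open[OF _ assms(1,2)]) (simp add: fa)
    then show ?thesis using True by (simp add: difference_quotient_def DERIV_imp_deriv g_def)
  next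
    case False
    then show ?thesis using fa[OF x] fa[OF assms(2)] by (simp add: difference_quotient_def g_def)
  qed
  from Suc.IH[OF this Suc.prems(2)] show ?case by (simp add: funpow_Suc_right del: funpow.simps)
qed simp

lemma iterated_difference_quotient_linear:
  assumes "f holomorphic_on S" "g holomorphic_on S" "open S" "a \<in> S"
  shows "(difference_quotient a ^^ m) (\<lambda>z. f z + c * g z) =
    (\<lambda>z. (difference_quotient a ^^ m) f z + c * (difference_quotient a ^^ m) g z)"
proof (induction m)
  case (Suc m)
  define F G where "F = (difference_quotient a ^^ m) f" and "G = (difference_quotient a ^^ m) g"
  have "F field_differentiable at a" "G field_differentiable at a"
    using iterated_difference_quotient_holomorphic assms holomorphic_on_imp_differentiable_at
    unfolding F_def G_def by blast+
  then have "deriv (\<lambda>z. F z + c * G z) a = deriv F a + c * deriv G a"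
    by (intro DERIV_imp_deriv) (auto intro!: derivative_eq_intros field_differentiable_derivI)
  then have "difference_quotient a (\<lambda>z. F z + c * G z) = (\<lambda>z. difference_quotient a F z + c * difference_quotient a G z)"
    by (simp add: fun_eq_iff difference_quotient_def diff_divide_distrib add_divide_distrib right_diff_distrib)
  then show ?case using Suc by (simp add: F_def G_def)
qed simp

context repelling_map_fixed
begin

lemma hardy2_of_shifted_power:
  assumes "z \<in> unit_disc"
  shows "hardy2_fun (hardy2_of (\<lambda>z. (z - \<omega>) ^ k)) z = (z - \<omega>) ^ k"
proof (rule hardy2_of_bounded(1)[OF _ _ assms, where K="2 ^ k"])
  show "(\<lambda>z. (z - \<omega>) ^ k) holomorphic_on unit_disc" by (intro holomorphic_intros)
  fix z assume "z \<in> unit_disc"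
  then have "cmod (z - \<omega>) \<le> 2" using norm_triangle_ineq4[of z \<omega>] fixed_point_inside by simp
  then show "cmod ((z - \<omega>) ^ k) \<le> 2 ^ k" by (simp add: norm_power power_mono)
qed

text \<open>The Taylor remainder of order \<open>m\<close> at \<open>\<omega>\<close>. It projects
  onto the functions vanishing to order \<open>m\<close> there, and so extends functionals defined
  on those to the whole space.\<close>

definition remainder :: "nat \<Rightarrow> hardy2 \<Rightarrow> complex \<Rightarrow> complex"
  where "remainder m f z = (z - \<omega>) ^ m * (difference_quotient \<omega> ^^ m) (hardy2_fun f) z"

lemma remainder_add_scaleC: "remainder m (f + c *\<^sub>C g) z = remainder m f z + c * remainder m g z"
proof -
  have "hardy2_fun (f + c *\<^sub>C g) = (\<lambda>z. hardy2_fun f z + c * hardy2_fun g z)"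
    by (simp add: fun_eq_iff hardy2_fun_add hardy2_fun_scaleC)
  then show ?thesis
    using iterated_difference_quotient_linear[OF hardy2_fun_holomorphic hardy2_fun_holomorphic open_ball fixed_point_inside]
    by (simp add: remainder_def algebra_simps)
qed

lemma remainder_eq:
  assumes "h holomorphic_on unit_disc" "\<And>z. z \<in> unit_disc \<Longrightarrow> hardy2_fun f z = (z - \<omega>) ^ m * h z" "z \<in> unit_disc"
  shows "remainder m f z = hardy2_fun f z"
  unfolding remainder_def
  using difference_quotient_unique[OF open_ball fixed_point_inside assms(1), of "hardy2_fun f" m z] assms by simp

text \<open>The two-sided sum of \<open>\<mu>^(-k) f(z_k)\<close>, with \<open>x k\<close> in the
  role of \<open>z_(-k)\<close>. The forward series starts at the first iterate because
  \<open>x 0\<close> is counted in the backward one.\<close>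

definition orbit_functional :: "complex \<Rightarrow> nat \<Rightarrow> (nat \<Rightarrow> complex) \<Rightarrow> hardy2 \<Rightarrow> complex"
  where "orbit_functional \<mu> m x f = (\<Sum>k. \<mu> ^ k * remainder m f (x k)) +
    (\<Sum>k. (1 / \<mu>) ^ Suc k * remainder m f ((\<phi> ^^ Suc k) (x 0)))"

text \<open>The series conditions for all \<open>f\<close> make the functional well defined and
  linear. The two absolute conditions on the bare weights serve the test functions of
  \<open>isolated_weight_zero\<close>.\<close>

definition summing_orbit :: "complex \<Rightarrow> nat \<Rightarrow> (nat \<Rightarrow> complex) \<Rightarrow> bool"
  where "summing_orbit \<mu> m x \<longleftrightarrow> (\<forall>k. x k \<in> unit_disc \<and> \<phi> (x (Suc k)) = x k) \<and> x \<longlonglongrightarrow> 1 \<and>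
    (\<forall>f. summable (\<lambda>k. \<mu> ^ k * remainder m f (x k))) \<and>
    (\<forall>f. summable (\<lambda>k. (1 / \<mu>) ^ Suc k * remainder m f ((\<phi> ^^ Suc k) (x 0)))) \<and>
    summable (\<lambda>k. cmod (\<mu> ^ k) * cmod (x k - \<omega>) ^ m) \<and>
    summable (\<lambda>k. cmod ((1 / \<mu>) ^ Suc k) * cmod ((\<phi> ^^ Suc k) (x 0) - \<omega>) ^ m)"

lemma orbit_functional_add_scaleC:
  assumes "summing_orbit \<mu> m x"
  shows "orbit_functional \<mu> m x (f + c *\<^sub>C g) = orbit_functional \<mu> m x f + c * orbit_functional \<mu> m x g"
proof -
  have s1: "summable (\<lambda>k. \<mu> ^ k * remainder m f (x k))"
    and s2: "summable (\<lambda>k. (1 / \<mu>) ^ Suc k * remainder m f ((\<phi> ^^ Suc k) (x 0)))" for f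
    using assms unfolding summing_orbit_def by blast+
  have "(\<lambda>k. \<mu> ^ k * remainder m f (x k) + c * (\<mu> ^ k * remainder m g (x k))) sums
      ((\<Sum>k. \<mu> ^ k * remainder m f (x k)) + c * (\<Sum>k. \<mu> ^ k * remainder m g (x k)))"
    by (intro sums_add sums_mult summable_sums s1)
  moreover have "(\<lambda>k. (1 / \<mu>) ^ Suc k * remainder m f ((\<phi> ^^ Suc k) (x 0)) +
        c * ((1 / \<mu>) ^ Suc k * remainder m g ((\<phi> ^^ Suc k) (x 0)))) sums
      ((\<Sum>k. (1 / \<mu>) ^ Suc k * remainder m f ((\<phi> ^^ Suc k) (x 0))) +
        c * (\<Sum>k. (1 / \<mu>) ^ Suc k * remainder m g ((\<phi> ^^ Suc k) (x 0))))"
    by (intro sums_add sums_mult summable_sums s2)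
  ultimately show ?thesis
    unfolding orbit_functional_def remainder_add_scaleC by (simp add: sums_iff algebra_simps)
qed

text \<open>Composition with \<open>\<phi>\<close> shifts the orbit by one step, which multiplies
  the two-sided sum by \<open>\<mu>\<close>. Functions vanishing to order \<open>m\<close> equal
  their remainders, and this class is preserved because \<open>\<phi>\<close> fixes
  \<open>\<omega>\<close>.\<close>

lemma orbit_functional_range:
  assumes x: "summing_orbit \<mu> m x" and \<mu>: "\<mu> \<noteq> 0" and h: "h holomorphic_on unit_disc"
    and f: "\<And>z. z \<in> unit_disc \<Longrightarrow> hardy2_fun f z = (z - \<omega>) ^ m * h z"
  shows "orbit_functional \<mu> m x (composition_operator \<phi> f - \<mu> *\<^sub>C f) = 0"
proof -
  let ?F = "hardy2_fun f"
  have xU: "x k \<in> unit_disc" and x\<phi>: "\<phi> (x (Suc k)) = x k" for k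
    using x unfolding summing_orbit_def by blast+
  define y where "y k = (\<phi> ^^ Suc k) (x 0)" for k
  have yU: "y k \<in> unit_disc" for k unfolding y_def by (rule iterate_into[OF xU])
  have rf: "remainder m f z = ?F z" if "z \<in> unit_disc" for z by (rule remainder_eq[OF h f that])
  have rC: "remainder m (composition_operator \<phi> f) z = ?F (\<phi> z)" if z: "z \<in> unit_disc" for z
  proof -
    \<comment> \<open>\<open>\<phi> z - \<omega>\<close> is \<open>z - \<omega>\<close> times its
      difference quotient, so the zero of order \<open>m\<close> survives composition.\<close>
    define h' where "h' z = difference_quotient \<omega> \<phi> z ^ m * h (\<phi> z)" for z
    have h': "h' holomorphic_on unit_disc"
    proof -
      have "(\<lambda>z. h (\<phi> z)) holomorphic_on unit_disc"
        using holomorphic_on_compose_gen[OF hol h] into by (simp add: o_def image_subset_iff)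
      then show ?thesis
        unfolding h'_def by (intro holomorphic_intros difference_quotient_holomorphic[OF hol open_ball])
    qed
    have "hardy2_fun (composition_operator \<phi> f) z = (z - \<omega>) ^ m * h' z" if "z \<in> unit_disc" for z
    proof -
      have "\<phi> z - \<omega> = (z - \<omega>) * difference_quotient \<omega> \<phi> z"
        by (simp add: difference_quotient_def fixed_point)
      then show ?thesis
        using that into by (simp add: composition_operator_fun f h'_def power_mult_distrib mult.assoc)
    qed
    from remainder_eq[OF h' this z] show ?thesis using z by (simp add: composition_operator_fun)
  qed
  have s1: "summable (\<lambda>k. \<mu> ^ k * remainder m g (x k))"
    and s2: "summable (\<lambda>k. (1 / \<mu>) ^ Suc k * remainder m g (y k))" for g
    using x unfolding summing_orbit_def y_def by blast+
  define S1 where "S1 = (\<Sum>k. \<mu> ^ k * ?F (x k))"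
  define S2 where "S2 = (\<Sum>k. (1 / \<mu>) ^ Suc k * ?F (y k))"
  have S1: "(\<lambda>k. \<mu> ^ k * ?F (x k)) sums S1" using summable_sums[OF s1[of f]] by (simp add: rf[OF xU] S1_def)
  have S2: "(\<lambda>k. (1 / \<mu>) ^ Suc k * ?F (y k)) sums S2"
    using summable_sums[OF s2[of f]] by (simp add: rf[OF yU] S2_def)
  have y0: "\<phi> (x 0) = y 0" and yS: "\<phi> (y k) = y (Suc k)" for k by (simp_all add: y_def)
  have "(\<lambda>k. \<mu> ^ Suc k * ?F (\<phi> (x (Suc k)))) sums (\<mu> * S1)"
    using sums_mult[OF S1, of \<mu>] by (simp add: x\<phi> mult.assoc)
  \<comment> \<open>The shift moves the value at \<open>y 0\<close> into the backward series and out
    of the forward one; the two boundary terms cancel in the sum.\<close>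
  from sums_Suc[OF this] have C1: "(\<lambda>k. \<mu> ^ k * ?F (\<phi> (x k))) sums (\<mu> * S1 + ?F (y 0))" by (simp add: y0)
  have "(\<lambda>k. (1 / \<mu>) ^ Suc (Suc k) * ?F (y (Suc k))) sums (S2 - (1 / \<mu>) * ?F (y 0))"
    using sums_Suc_iff[of "\<lambda>k. (1 / \<mu>) ^ Suc k * ?F (y k)" "S2 - (1 / \<mu>) * ?F (y 0)"] S2 by simp
  from sums_mult[OF this, of \<mu>]
  have C2: "(\<lambda>k. (1 / \<mu>) ^ Suc k * ?F (\<phi> (y k))) sums (\<mu> * S2 - ?F (y 0))"
    using \<mu> by (simp add: yS right_diff_distrib mult.assoc[symmetric])
  have "orbit_functional \<mu> m x (composition_operator \<phi> f) = \<mu> * S1 + ?F (y 0) + (\<mu> * S2 - ?F (y 0))"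
    unfolding orbit_functional_def y_def[symmetric] rC[OF xU] rC[OF yU] using C1 C2 by (simp add: sums_iff)
  moreover have "orbit_functional \<mu> m x f = S1 + S2"
    unfolding orbit_functional_def y_def[symmetric] rf[OF xU] rf[OF yU] using S1 S2 by (simp add: sums_iff)
  moreover have "composition_operator \<phi> f - \<mu> *\<^sub>C f = composition_operator \<phi> f + (- \<mu>) *\<^sub>C f"
    by (rule hardy2_eqI) (simp add: hardy2_fun_add hardy2_fun_diff hardy2_fun_scaleC)
  ultimately show ?thesis using orbit_functional_add_scaleC[OF x, of "composition_operator \<phi> f" "- \<mu>" f]
    by (simp add: algebra_simps)
qed

end

section \<open>Independent orbits and infinite codimension\<close>

context repelling_map_fixed
begin

text \<open>Backward, the depth of \<open>x k\<close> is at least \<open>t / d ^ k\<close>, so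
  values of \<open>f\<close> grow at most like \<open>sqrt d ^ k\<close> while the subtracted Taylor
  polynomial stays bounded. Forward, the zero of order \<open>m\<close> gives
  \<open>\<theta> ^ (m * k)\<close>, which beats the powers of \<open>1 / \<mu>\<close>.\<close>

lemma summing_backward_orbit:
  assumes \<mu>: "\<mu> \<noteq> 0" "cmod \<mu> * sqrt d < 1" and \<epsilon>: "0 < \<epsilon>" "\<epsilon> \<le> 1/8" and t: "0 < t" "t \<le> 1/8"
    and x: "\<And>k. x k \<in> unit_disc" "\<And>k. \<phi> (x (Suc k)) = x k"
      "\<And>k. cmod (of_real (d ^ k) * (1 - x k) - of_real t) \<le> \<epsilon> * t"
    and \<theta>: "0 < \<theta>" "\<theta> < 1" "\<theta> ^ m < cmod \<mu>" and y: "\<And>k. cmod ((\<phi> ^^ k) (x 0) - \<omega>) \<le> C * \<theta> ^ k"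
  shows "summing_orbit \<mu> m x"
proof -
  have d0: "d > 0" using d_gt_1 by simp
  have \<mu>1: "cmod \<mu> < 1"
  proof -
    have "cmod \<mu> * 1 \<le> cmod \<mu> * sqrt d" using d_gt_1 by (intro mult_left_mono) auto
    then show ?thesis using \<mu>(2) by linarith
  qed
  define u where "u k = of_real (d ^ k) * (1 - x k)" for k
  have ut: "cmod (u k - of_real t) \<le> t / 8" for k
    using x(3)[of k] mult_right_mono[OF \<epsilon>(2), of t] t unfolding u_def by linarith
  have u1: "cmod (u k) \<le> (9/8) * t" for k
    using norm_triangle_ineq[of "of_real t" "u k - of_real t"] ut[of k] t by simp
  have u2: "(7/8) * t \<le> Re (u k)" for k using abs_Re_le_cmod[of "u k - of_real t"] ut[of k] by simp
  have xu: "1 - x k = u k / of_real (d ^ k)" for k using d0 by (simp add: u_def)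
  have c1: "cmod (1 - x k) = cmod (u k) / d ^ k" for k using d0 by (simp add: xu norm_divide norm_power)
  have x1: "x \<longlonglongrightarrow> 1"
  proof -
    have "(\<lambda>k. 1 - x k) \<longlonglongrightarrow> 0"
    proof (rule Lim_null_comparison)
      show "\<forall>\<^sub>F k in sequentially. cmod (1 - x k) \<le> (9/8) * t * (1 / d) ^ k"
      proof (intro always_eventually allI)
        fix k
        have "cmod (u k) / d ^ k \<le> ((9/8) * t) / d ^ k" using u1[of k] d0 by (intro divide_right_mono) auto
        then show "cmod (1 - x k) \<le> (9/8) * t * (1 / d) ^ k" unfolding c1 by (simp add: power_one_over)
      qed
      have "(\<lambda>k. (9/8) * t * (1 / d) ^ k) \<longlonglongrightarrow> (9/8) * t * 0"
        using d_gt_1 by (intro tendsto_intros LIMSEQ_power_zero) auto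
      then show "(\<lambda>k. (9/8) * t * (1 / d) ^ k) \<longlonglongrightarrow> 0" by simp
    qed
    from tendsto_diff[OF tendsto_const[of 1] this] show ?thesis by simp
  qed
  \<comment> \<open>The depth is \<open>2 * Re (1 - x k)\<close>, at least \<open>7/4\<close> of
    \<open>t / d ^ k\<close>, minus a square that is at most \<open>1/4\<close> of it because
    \<open>t \<le> 1/8\<close>.\<close>
  have depth: "t / d ^ k \<le> 1 - (cmod (x k))\<^sup>2" for k
  proof -
    have dk: "d ^ k \<ge> 1" using d_gt_1 by simp
    have "1 - (cmod (x k))\<^sup>2 = 2 * Re (1 - x k) - (cmod (1 - x k))\<^sup>2"
      unfolding cmod_power2 by (simp add: power2_eq_square algebra_simps)
    moreover have "Re (1 - x k) = Re (u k) / d ^ k" unfolding xu by (simp only: Re_divide_of_real)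
    moreover have "(7/8) * t / d ^ k \<le> Re (u k) / d ^ k" using u2 d0 by (intro divide_right_mono) auto
    moreover have "(cmod (1 - x k))\<^sup>2 \<le> (1/4) * (t / d ^ k)"
    proof -
      have "(cmod (1 - x k))\<^sup>2 = (cmod (u k))\<^sup>2 / d ^ k / d ^ k" by (simp add: c1 power2_eq_square)
      also have "\<dots> \<le> (cmod (u k))\<^sup>2 / d ^ k / 1"
        using dk d0 by (intro divide_left_mono) auto
      also have "(cmod (u k))\<^sup>2 \<le> ((9/8) * t)\<^sup>2" using u1 by (intro power_mono) auto
      also have "((9/8) * t)\<^sup>2 \<le> (1/4) * t"
      proof -
        have "t * t \<le> t * (1/8)" using t by (intro mult_left_mono) auto
        then show ?thesis using t by (simp add: power2_eq_square)
      qed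
      finally show ?thesis using d0 by (simp add: divide_right_mono)
    qed
    ultimately have "2 * ((7/8) * t / d ^ k) - (1/4) * (t / d ^ k) \<le> 1 - (cmod (x k))\<^sup>2" by linarith
    moreover have "0 \<le> t / d ^ k" using t d0 by simp
    ultimately show ?thesis by simp
  qed
  have x\<omega>: "cmod (x k - \<omega>) \<le> 2" for k
    using norm_triangle_ineq4[of "x k" \<omega>] x(1)[of k] fixed_point_inside by simp
  have bwd: "summable (\<lambda>k. \<mu> ^ k * remainder m f (x k))" for f
  proof -
    define c where "c i = (difference_quotient \<omega> ^^ i) (hardy2_fun f) \<omega>" for i
    define D where "D = (\<Sum>i<m. cmod (c i) * 2 ^ i)"
    have "cmod (remainder m f (x k)) \<le> norm f / sqrt t * sqrt d ^ k + D" for k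
    proof -
      have "remainder m f (x k) = hardy2_fun f (x k) - (\<Sum>i<m. c i * (x k - \<omega>) ^ i)"
        using difference_quotient_expansion[where f="hardy2_fun f" and z="x k" and m=m and a=\<omega>] by (simp add: remainder_def c_def)
      then have "cmod (remainder m f (x k)) \<le> cmod (hardy2_fun f (x k)) + cmod (\<Sum>i<m. c i * (x k - \<omega>) ^ i)"
        by (simp add: norm_triangle_ineq4)
      also have "cmod (\<Sum>i<m. c i * (x k - \<omega>) ^ i) \<le> D"
        unfolding D_def
        by (rule order_trans[OF norm_sum]) (auto simp: norm_mult norm_power intro!: sum_mono mult_left_mono power_mono x\<omega>)
      also have "cmod (hardy2_fun f (x k)) \<le> norm f / sqrt (t / d ^ k)"
      proof -
        have "cmod (hardy2_fun f (x k)) \<le> norm f / sqrt (1 - (cmod (x k))\<^sup>2)"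
          using x(1)[of k] by (intro hardy2_eval_bound) simp
        also have "\<dots> \<le> norm f / sqrt (t / d ^ k)"
        proof (rule divide_left_mono)
          have p: "0 < t / d ^ k" using t d0 by simp
          show "0 < sqrt (1 - (cmod (x k))\<^sup>2) * sqrt (t / d ^ k)"
            using p depth[of k] by (intro mult_pos_pos real_sqrt_gt_zero) auto
        qed (use depth in auto)
        finally show ?thesis .
      qed
      finally show ?thesis by (simp add: real_sqrt_divide real_sqrt_power)
    qed
    then have b: "cmod (\<mu> ^ k * remainder m f (x k)) \<le> norm f / sqrt t * (cmod \<mu> * sqrt d) ^ k + D * cmod \<mu> ^ k" for k
      using mult_left_mono[of "cmod (remainder m f (x k))" "norm f / sqrt t * sqrt d ^ k + D" "cmod \<mu> ^ k"]
      by (simp add: norm_mult norm_power power_mult_distrib algebra_simps)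
    have "summable (\<lambda>k. norm f / sqrt t * (cmod \<mu> * sqrt d) ^ k + D * cmod \<mu> ^ k)"
      using \<mu> \<mu>1 d0 by (intro summable_add summable_mult summable_geometric) auto
    then show ?thesis by (rule summable_comparison_test') (use b in auto)
  qed
  define \<rho> where "\<rho> = \<theta> ^ m / cmod \<mu>"
  have \<rho>: "0 \<le> \<rho>" "\<rho> < 1" using \<theta> \<mu> by (auto simp: \<rho>_def)
  have geo: "cmod ((1 / \<mu>) ^ Suc k) * cmod ((\<phi> ^^ Suc k) (x 0) - \<omega>) ^ m \<le> C ^ m * \<rho> ^ Suc k" for k
  proof -
    have "cmod ((\<phi> ^^ Suc k) (x 0) - \<omega>) ^ m \<le> (C * \<theta> ^ Suc k) ^ m"
      by (intro power_mono y) auto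
    then have "cmod ((1 / \<mu>) ^ Suc k) * cmod ((\<phi> ^^ Suc k) (x 0) - \<omega>) ^ m \<le> cmod ((1 / \<mu>) ^ Suc k) * (C * \<theta> ^ Suc k) ^ m"
      by (intro mult_left_mono) auto
    also have "\<dots> = C ^ m * \<rho> ^ Suc k"
      by (simp only: \<rho>_def norm_power norm_divide norm_one power_divide power_mult_distrib power_one power_mult[symmetric]
          mult.commute[of "Suc k" m]) simp
    finally show ?thesis .
  qed
  have geos: "summable (\<lambda>k. C ^ m * \<rho> ^ Suc k)"
    using \<rho> by (intro summable_mult) (simp add: summable_geometric)
  have fwd: "summable (\<lambda>k. (1 / \<mu>) ^ Suc k * remainder m f ((\<phi> ^^ Suc k) (x 0)))" for f
  proof -
    define h where "h = (difference_quotient \<omega> ^^ m) (hardy2_fun f)"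
    have "h holomorphic_on unit_disc"
      unfolding h_def by (rule iterated_difference_quotient_holomorphic[OF hardy2_fun_holomorphic open_ball])
    then have hc: "isCont h \<omega>"
      using holomorphic_on_imp_continuous_on fixed_point_inside
        continuous_on_eq_continuous_at[OF open_ball, of 0 1 h] by blast
    have "(\<lambda>k. h ((\<phi> ^^ k) (x 0))) \<longlonglongrightarrow> h \<omega>"
      by (rule isCont_tendsto_compose[OF hc iterates_tendsto[OF x(1)]])
    then have "Bseq (\<lambda>k. h ((\<phi> ^^ k) (x 0)))" using convergent_imp_Bseq convergentI by blast
    then obtain K where K: "\<And>k. cmod (h ((\<phi> ^^ k) (x 0))) \<le> K" unfolding Bseq_def by blast
    have K0: "K \<ge> 0" using K[of 0] norm_ge_zero order_trans by blast
    show ?thesis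
    proof (rule summable_comparison_test'[OF summable_mult[OF geos, of K]])
      fix k :: nat
      have "cmod ((1 / \<mu>) ^ Suc k * remainder m f ((\<phi> ^^ Suc k) (x 0))) =
          cmod (h ((\<phi> ^^ Suc k) (x 0))) * (cmod ((1 / \<mu>) ^ Suc k) * cmod ((\<phi> ^^ Suc k) (x 0) - \<omega>) ^ m)"
        unfolding remainder_def h_def[symmetric] norm_mult norm_power by (simp only: mult_ac)
      also have "\<dots> \<le> K * (C ^ m * \<rho> ^ Suc k)"
        by (rule mult_mono[OF K geo K0]) (intro mult_nonneg_nonneg zero_le_power norm_ge_zero)
      finally show "norm ((1 / \<mu>) ^ Suc k * remainder m f ((\<phi> ^^ Suc k) (x 0))) \<le> K * (C ^ m * \<rho> ^ Suc k)" .
    qed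
  qed
  have w1: "summable (\<lambda>k. cmod (\<mu> ^ k) * cmod (x k - \<omega>) ^ m)"
  proof (rule summable_comparison_test')
    show "summable (\<lambda>k. cmod \<mu> ^ k * 2 ^ m)" using \<mu>1 by (intro summable_mult2 summable_geometric) auto
    show "norm (cmod (\<mu> ^ k) * cmod (x k - \<omega>) ^ m) \<le> cmod \<mu> ^ k * 2 ^ m" for k
      using x\<omega> by (auto simp: norm_power intro!: mult_left_mono power_mono)
  qed
  have w2: "summable (\<lambda>k. cmod ((1 / \<mu>) ^ Suc k) * cmod ((\<phi> ^^ Suc k) (x 0) - \<omega>) ^ m)"
  proof (rule summable_comparison_test'[OF geos])
    fix k
    show "norm (cmod ((1 / \<mu>) ^ Suc k) * cmod ((\<phi> ^^ Suc k) (x 0) - \<omega>) ^ m) \<le> C ^ m * \<rho> ^ Suc k"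
      using geo[of k] by (simp only: real_norm_def abs_of_nonneg mult_nonneg_nonneg norm_ge_zero zero_le_power)
  qed
  show ?thesis unfolding summing_orbit_def using x(1,2) x1 bwd fwd w1 w2 by blast
qed

text \<open>The starting distances are taken in \<open>(\<kappa> * T, T]\<close>. One or more
  backward steps bring any of the orbits within \<open>\<kappa> * T\<close> of \<open>1\<close>, so
  no start is a later point of another orbit and all backward points are distinct.\<close>

lemma many_summing_orbits:
  assumes \<mu>: "\<mu> \<noteq> 0" "cmod \<mu> < 1 / sqrt d"
  obtains m where
    "\<And>N :: nat. \<exists>X :: nat \<Rightarrow> nat \<Rightarrow> complex. (\<forall>j<N. summing_orbit \<mu> m (X j)) \<and> (\<forall>i<N. \<forall>j<N. \<forall>k l. X i k = X j l \<longrightarrow> i = j \<and> k = l)"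
proof -
  have d0: "d > 0" using d_gt_1 by simp
  have \<mu>d: "cmod \<mu> * sqrt d < 1" using \<mu>(2) d0 by (simp add: field_simps)
  obtain \<theta> where \<theta>: "0 < \<theta>" "\<theta> < 1"
    and \<theta>y: "\<And>z. z \<in> unit_disc \<Longrightarrow> \<exists>C>0. \<forall>k. cmod ((\<phi> ^^ k) z - \<omega>) \<le> C * \<theta> ^ k"
    using forward_orbit_geometric by metis
  obtain m where m: "\<theta> ^ m < cmod \<mu>" using real_arch_pow_inv[of "cmod \<mu>" \<theta>] \<mu>(1) \<theta> by auto
  define \<epsilon> where "\<epsilon> = min (1/8) ((d - 1) / 2)"
  have \<epsilon>: "0 < \<epsilon>" "\<epsilon> \<le> 1/8" using d_gt_1 by (auto simp: \<epsilon>_def)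
  \<comment> \<open>A distance to \<open>1\<close> after a backward step is at most
    \<open>(1 + \<epsilon>) * T / d\<close>; the second entry of \<open>\<epsilon>\<close> makes
    this ratio less than \<open>1\<close>.\<close>
  define \<kappa> where "\<kappa> = (1 + \<epsilon>) / d"
  have \<kappa>: "0 < \<kappa>" "\<kappa> < 1"
  proof -
    show "0 < \<kappa>" using \<epsilon> d0 by (simp add: \<kappa>_def)
    have "\<epsilon> \<le> (d - 1) / 2" unfolding \<epsilon>_def by (rule min.cobounded2)
    then have "1 + \<epsilon> < d" using d_gt_1 by simp
    then show "\<kappa> < 1" using d0 by (simp add: \<kappa>_def)
  qed
  obtain T where T: "T > 0" "T \<le> 1/8" and orb:
    "\<And>t. 0 < t \<Longrightarrow> t \<le> T \<Longrightarrow> \<exists>x :: nat \<Rightarrow> complex. x 0 = 1 - of_real t \<and>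
      (\<forall>k. x k \<in> unit_disc \<and> \<phi> (x (Suc k)) = x k \<and> cmod (of_real (d ^ k) * (1 - x k) - of_real t) \<le> \<epsilon> * t)"
    using backward_orbit[OF \<epsilon>] by metis
  show thesis
  proof (rule that[of m])
    fix N :: nat
    \<comment> \<open>Equally spaced points of the interval; dividing by \<open>N + 1\<close> keeps
      the lower end excluded.\<close>
    define t where "t j = T * (1 - (1 - \<kappa>) * (real j / real (N + 1)))" for j
    have t: "\<kappa> * T < t j" "t j \<le> T" if "j < N" for j
    proof -
      have j1: "real j / real (N + 1) < 1" using that by simp
      have "(1 - \<kappa>) * (real j / real (N + 1)) < (1 - \<kappa>) * 1"
        using j1 \<kappa> by (intro mult_strict_left_mono) auto
      then have "T * \<kappa> < T * (1 - (1 - \<kappa>) * (real j / real (N + 1)))"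
        using T by (intro mult_strict_left_mono) auto
      then show "\<kappa> * T < t j" by (simp add: t_def mult.commute)
      have "T * (1 - (1 - \<kappa>) * (real j / real (N + 1))) \<le> T * 1"
        using T \<kappa> by (intro mult_left_mono) auto
      then show "t j \<le> T" by (simp add: t_def)
    qed
    have t0: "0 < t j" if "j < N" for j
      using t(1)[OF that] mult_pos_pos[OF \<kappa>(1) T(1)] by linarith
    have tinj: "i = j" if "t i = t j" for i j
      using that T \<kappa> by (simp add: t_def)
    have "\<forall>j. \<exists>x :: nat \<Rightarrow> complex. j < N \<longrightarrow> x 0 = 1 - of_real (t j) \<and>
      (\<forall>k. x k \<in> unit_disc \<and> \<phi> (x (Suc k)) = x k \<and> cmod (of_real (d ^ k) * (1 - x k) - of_real (t j)) \<le> \<epsilon> * t j)"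
      using orb t0 t(2) by blast
    from choice[OF this] obtain X :: "nat \<Rightarrow> nat \<Rightarrow> complex" where
      X: "\<forall>j. j < N \<longrightarrow> X j 0 = 1 - of_real (t j) \<and> (\<forall>k. X j k \<in> unit_disc \<and> \<phi> (X j (Suc k)) = X j k \<and>
        cmod (of_real (d ^ k) * (1 - X j k) - of_real (t j)) \<le> \<epsilon> * t j)" by blast
    have X0: "X j 0 = 1 - of_real (t j)" and XU: "X j k \<in> unit_disc" and X\<phi>: "\<phi> (X j (Suc k)) = X j k"
      and Xb: "cmod (of_real (d ^ k) * (1 - X j k) - of_real (t j)) \<le> \<epsilon> * t j" if "j < N" for j k
      using X that by blast+
    have so: "summing_orbit \<mu> m (X j)" if j: "j < N" for j
    proof -
      obtain C where C: "\<And>k. cmod ((\<phi> ^^ k) (X j 0) - \<omega>) \<le> C * \<theta> ^ k" using \<theta>y[OF XU[OF j]] by blast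
      have "t j \<le> 1/8" using t(2)[OF j] T by linarith
      from summing_backward_orbit[OF \<mu>(1) \<mu>d \<epsilon> t0[OF j] this XU[OF j] X\<phi>[OF j] Xb[OF j] \<theta> m C]
      show ?thesis .
    qed
    have shift: "(\<phi> ^^ n) (X j (n + l)) = X j l" if "j < N" for j n l
      by (induction n) (simp_all add: funpow_Suc_right X\<phi>[OF that] del: funpow.simps(2))
    \<comment> \<open>Applying \<open>\<phi>\<close> \<open>k\<close> times to both points reduces a
      coincidence to one between the start of orbit \<open>i\<close> and a point of orbit
      \<open>j\<close>.\<close>
    have main: "i = j \<and> k = l" if ij: "i < N" "j < N" and e: "X i k = X j l" and kl: "k \<le> l" for i j k l
    proof -
      have "X i 0 = X j (l - k)" using shift[OF ij(1), of k 0] shift[OF ij(2), of k "l - k"] e kl by simp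
      moreover have "l - k = 0"
      proof (rule ccontr)
        assume "l - k \<noteq> 0"
        then obtain n where n: "l - k = Suc n" using not0_implies_Suc by blast
        define v where "v = of_real (d ^ Suc n) * (1 - X j (Suc n))"
        have "cmod v \<le> t j + \<epsilon> * t j"
          using norm_triangle_ineq[of "of_real (t j)" "v - of_real (t j)"] Xb[OF ij(2), of "Suc n"] t0[OF ij(2)]
          by (simp add: v_def)
        also have "\<dots> = (1 + \<epsilon>) * t j" by (simp add: algebra_simps)
        also have "\<dots> \<le> (1 + \<epsilon>) * T" using t(2)[OF ij(2)] \<epsilon> by (intro mult_left_mono) auto
        finally have "d ^ Suc n * cmod (1 - X j (Suc n)) \<le> (1 + \<epsilon>) * T"
          using d0 by (simp add: v_def norm_mult norm_power)
        moreover have "d * cmod (1 - X j (Suc n)) \<le> d ^ Suc n * cmod (1 - X j (Suc n))"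
          using d_gt_1 self_le_power[of d "Suc n"] by (intro mult_right_mono) auto
        ultimately have "d * cmod (1 - X j (Suc n)) \<le> (1 + \<epsilon>) * T" by linarith
        then have "cmod (1 - X j (Suc n)) \<le> \<kappa> * T" using d0 by (simp add: \<kappa>_def field_simps)
        moreover have "cmod (1 - X i 0) = t i" using X0[OF ij(1)] t0[OF ij(1)] by simp
        ultimately show False using \<open>X i 0 = X j (l - k)\<close> n t(1)[OF ij(1)] by simp
      qed
      ultimately have "of_real (t i) = (of_real (t j) :: complex)" using X0[OF ij(1)] X0[OF ij(2)] by simp
      then show ?thesis using tinj \<open>l - k = 0\<close> kl by auto
    qed
    have "i = j \<and> k = l" if "i < N" "j < N" "X i k = X j l" for i j k l
      using main[OF that] main[OF that(2,1) that(3)[symmetric]] by (cases "k \<le> l") auto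
    then show "\<exists>X :: nat \<Rightarrow> nat \<Rightarrow> complex. (\<forall>j<N. summing_orbit \<mu> m (X j)) \<and> (\<forall>i<N. \<forall>j<N. \<forall>k l. X i k = X j l \<longrightarrow> i = j \<and> k = l)"
      using so by blast
  qed
qed

text \<open>The forward halves may merge with one another, so isolation is sought on the backward
  half. Forward points accumulate only at \<open>\<omega>\<close>, whereas the backward half of
  orbit \<open>j0\<close> tends to \<open>1\<close>; a point far enough back is met once only, and
  its weight must vanish.\<close>

lemma summing_orbits_independent:
  fixes N :: nat and X :: "nat \<Rightarrow> nat \<Rightarrow> complex"
  assumes so: "\<And>j. j < N \<Longrightarrow> summing_orbit \<mu> m (X j)" and \<mu>: "\<mu> \<noteq> 0"
    and distinct: "\<And>i j k l. i < N \<Longrightarrow> j < N \<Longrightarrow> X i k = X j l \<Longrightarrow> i = j \<and> k = l"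
    and zero: "\<And>f. (\<Sum>j<N. a j * orbit_functional \<mu> m (X j) f) = 0" and j0: "j0 < N"
  shows "a j0 = 0"
proof -
  have XU: "X j k \<in> unit_disc" and X1: "X j \<longlonglongrightarrow> 1"
    and s1: "summable (\<lambda>k. \<mu> ^ k * remainder m f (X j k))"
    and s2: "summable (\<lambda>k. (1 / \<mu>) ^ Suc k * remainder m f ((\<phi> ^^ Suc k) (X j 0)))"
    and w1: "summable (\<lambda>k. cmod (\<mu> ^ k) * cmod (X j k - \<omega>) ^ m)"
    and w2: "summable (\<lambda>k. cmod ((1 / \<mu>) ^ Suc k) * cmod ((\<phi> ^^ Suc k) (X j 0) - \<omega>) ^ m)" if "j < N" for j k f
    using so[OF that] unfolding summing_orbit_def by blast+
  define y where "y j k = (\<phi> ^^ Suc k) (X j 0)" for j k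
  have yU: "y j k \<in> unit_disc" if "j < N" for j k unfolding y_def by (rule iterate_into[OF XU[OF that]])
  have yl: "y j \<longlonglongrightarrow> \<omega>" if "j < N" for j
    unfolding y_def[abs_def] by (rule LIMSEQ_Suc[OF iterates_tendsto[OF XU[OF that]]])
  \<comment> \<open>All forward points together with their limit: a closed set that misses
    \<open>1\<close>, hence has positive distance from it.\<close>
  define S where "S = (\<Union>j\<in>{..<N}. insert \<omega> (range (y j)))"
  have "closed S"
    unfolding S_def using yl by (intro closed_UN finite_lessThan) (auto intro!: compact_imp_closed compact_sequence_with_limit)
  moreover have "1 \<notin> S"
  proof
    assume "1 \<in> S"
    then obtain j where "j < N" "1 = \<omega> \<or> (\<exists>k. 1 = y j k)" unfolding S_def by blast
    then have "1 \<in> unit_disc" using yU fixed_point_inside by metis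
    then show False by simp
  qed
  ultimately obtain e where e: "e > 0" "\<And>s. s \<in> S \<Longrightarrow> e \<le> dist 1 s" using separate_point_closed by metis
  have "\<forall>\<^sub>F k in sequentially. dist (X j0 k) 1 < e" by (rule tendstoD[OF X1[OF j0] e(1)])
  then obtain k0 where k0: "dist (X j0 k0) 1 < e" by (auto simp: eventually_sequentially)
  then have pS: "X j0 k0 \<notin> S" using e(2) by (metis dist_commute not_le)
  \<comment> \<open>Each orbit becomes two sequences, \<open>True\<close> for the backward half
    tending to \<open>1\<close> and \<open>False\<close> for the forward half tending to
    \<open>\<omega>\<close>.\<close>
  define I where "I = {..<N} \<times> (UNIV :: bool set)"
  define z where "z i = (if snd i then X (fst i) else y (fst i))" for i :: "nat \<times> bool"
  define c where "c i k = a (fst i) * (if snd i then \<mu> ^ k else (1 / \<mu>) ^ Suc k)" for i :: "nat \<times> bool" and k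
  have "c (j0, True) k0 = 0"
  proof (rule isolated_weight_zero[where I=I and z=z and c=c and \<omega>=\<omega> and m=m and p="X j0 k0"])
    show "finite I" by (simp add: I_def)
    show "cmod (z i k) \<le> 1" if "i \<in> I" for i k
      using that XU yU by (auto simp: I_def z_def less_imp_le)
    show "z i \<longlonglongrightarrow> 1 \<or> z i \<longlonglongrightarrow> \<omega>" if "i \<in> I" for i
      using that X1 yl by (auto simp: I_def z_def)
    show "summable (\<lambda>k. cmod (c i k) * cmod (z i k - \<omega>) ^ m)" if i: "i \<in> I" for i
    proof -
      have j: "fst i < N" using i by (auto simp: I_def)
      show ?thesis
      proof (cases "snd i")
        case True
        then show ?thesis using summable_mult[OF w1[OF j], of "cmod (a (fst i))"]
          by (simp add: c_def z_def norm_mult mult.assoc)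
      next
        case False
        then show ?thesis using summable_mult[OF w2[OF j], of "cmod (a (fst i))"]
          by (simp only: c_def z_def y_def False if_False norm_mult mult.assoc)
      qed
    qed
    show "(j0, True) \<in> I" using j0 by (simp add: I_def)
    show "X j0 k0 = z (j0, True) k0" by (simp add: z_def)
    show "X j0 k0 \<noteq> 1" using XU[OF j0, of k0] by auto
    have "\<omega> \<in> S" unfolding S_def using j0 by blast
    then show "X j0 k0 \<noteq> \<omega>" using pS by metis
    show "i = (j0, True) \<and> k = k0" if i: "i \<in> I" and e: "z i k = X j0 k0" for i k
    proof -
      have j: "fst i < N" using i by (auto simp: I_def)
      have "y (fst i) k \<in> S" unfolding S_def using j by blast
      then have "snd i" using e pS by (metis z_def)
      then show ?thesis using e distinct[OF j j0] by (auto simp: z_def prod_eq_iff)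
    qed
    fix P :: "complex \<Rightarrow> complex" assume P: "P holomorphic_on UNIV"
    define g where "g w = (w - \<omega>) ^ m * P w" for w
    have PU: "P holomorphic_on unit_disc" using P by (rule holomorphic_on_subset) simp
    have gh: "g holomorphic_on unit_disc" unfolding g_def by (intro holomorphic_intros PU)
    have "continuous_on (cball 0 1) g"
      unfolding g_def using holomorphic_on_imp_continuous_on[OF P]
      by (intro continuous_intros) (auto intro: continuous_on_subset)
    then have "bounded (g ` cball 0 1)" by (intro compact_imp_bounded compact_continuous_image) auto
    then obtain K where K: "\<And>w. w \<in> cball 0 1 \<Longrightarrow> cmod (g w) \<le> K" unfolding bounded_iff by blast
    define f where "f = hardy2_of g"
    have ff: "hardy2_fun f w = g w" if "w \<in> unit_disc" for w
      unfolding f_def by (rule hardy2_of_bounded(1)[OF gh _ that, of K]) (use K in auto)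
    have rf: "remainder m f w = g w" if w: "w \<in> unit_disc" for w
      using remainder_eq[OF PU _ w, of f m] ff w by (simp add: g_def)
    have "(\<Sum>k. c (j, True) k * g (z (j, True) k)) + (\<Sum>k. c (j, False) k * g (z (j, False) k)) =
        a j * orbit_functional \<mu> m (X j) f" if j: "j < N" for j
    proof -
      have "(\<Sum>k. c (j, True) k * g (z (j, True) k)) = a j * (\<Sum>k. \<mu> ^ k * remainder m f (X j k))"
        using suminf_mult[OF s1[OF j], of "a j" f] by (simp add: c_def z_def rf[OF XU[OF j]] mult.assoc)
      moreover have "(\<Sum>k. c (j, False) k * g (z (j, False) k)) =
          a j * (\<Sum>k. (1 / \<mu>) ^ Suc k * remainder m f ((\<phi> ^^ Suc k) (X j 0)))"
        using suminf_mult[OF s2[OF j], of "a j" f] unfolding y_def[symmetric] rf[OF yU[OF j]]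
        by (simp add: c_def z_def mult.assoc)
      ultimately show ?thesis by (simp add: orbit_functional_def distrib_left)
    qed
    then have "(\<Sum>j<N. (\<Sum>k. c (j, True) k * g (z (j, True) k)) + (\<Sum>k. c (j, False) k * g (z (j, False) k))) = 0"
      using zero[of f] by simp
    moreover have "(\<Sum>i\<in>I. h i) = (\<Sum>j<N. h (j, True) + h (j, False))" for h :: "nat \<times> bool \<Rightarrow> complex"
    proof -
      have "(\<Sum>j<N. h (j, True) + h (j, False)) = (\<Sum>j<N. \<Sum>b\<in>UNIV. h (j, b))"
        by (simp add: UNIV_bool add.commute)
      also have "\<dots> = (\<Sum>i\<in>I. h i)"
        by (subst sum.cartesian_product) (simp add: split_def I_def)
      finally show ?thesis ..
    qed
    ultimately show "(\<Sum>i\<in>I. \<Sum>k. c i k * ((z i k - \<omega>) ^ m * P (z i k))) = 0"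
      unfolding g_def[symmetric] by simp
  qed
  then show ?thesis using \<mu> by (simp add: c_def)
qed

text \<open>With more orbits than vectors in a finite complement, some nontrivial combination
  \<open>L\<close> of orbit functionals annihilates the complement as well as the range. If the two
  spanned the space, \<open>L\<close> would be zero, against independence of the orbits.\<close>

lemma infinite_codimension:
  assumes \<mu>: "\<mu> \<noteq> 0" "cmod \<mu> < 1 / sqrt d" and B: "finite B"
  shows "complex_vs.span (range (\<lambda>f. composition_operator \<phi> f - \<mu> *\<^sub>C f) \<union> B) \<noteq> UNIV"
proof
  define T where "T f = composition_operator \<phi> f - \<mu> *\<^sub>C f" for f
  assume "complex_vs.span (range (\<lambda>f. composition_operator \<phi> f - \<mu> *\<^sub>C f) \<union> B) = UNIV"
  then have span: "complex_vs.span (range T \<union> B) = UNIV" by (simp add: T_def[abs_def])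
  have Tl: "bounded_clinear T"
    unfolding T_def[abs_def] by (rule bounded_clinear_shift[OF bounded_clinear_composition_operator])
  obtain m where orbs: "\<And>N :: nat. \<exists>X :: nat \<Rightarrow> nat \<Rightarrow> complex. (\<forall>j<N. summing_orbit \<mu> m (X j)) \<and>
      (\<forall>i<N. \<forall>j<N. \<forall>k l. X i k = X j l \<longrightarrow> i = j \<and> k = l)"
    using many_summing_orbits[OF \<mu>] by metis
  define pw where "pw i = hardy2_of (\<lambda>z. (z - \<omega>) ^ i)" for i
  have pwf: "hardy2_fun (pw i) z = (z - \<omega>) ^ i" if "z \<in> unit_disc" for i z
    unfolding pw_def by (rule hardy2_of_shifted_power[OF that])
  \<comment> \<open>An orbit functional annihilates \<open>T f\<close> only when \<open>f\<close>
    vanishes to order \<open>m\<close> at \<open>\<omega>\<close>. The images of the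
    \<open>m\<close> lower powers are therefore added to the conditions imposed on
    \<open>L\<close>.\<close>
  define B' where "B' = B \<union> T ` pw ` {..<m}"
  have B': "finite B'" using B by (simp add: B'_def)
  define N where "N = Suc (card B')"
  obtain X where so: "\<And>j. j < N \<Longrightarrow> summing_orbit \<mu> m (X j)"
    and dist: "\<And>i j k l. i < N \<Longrightarrow> j < N \<Longrightarrow> X i k = X j l \<Longrightarrow> i = j \<and> k = l"
    using orbs[of N] by blast
  have "card B' < card {..<N}" by (simp add: N_def)
  from underdetermined_system[OF B' _ this, where l="\<lambda>j. orbit_functional \<mu> m (X j)"]
  obtain a j0 where j0: "j0 < N" "a j0 \<noteq> 0"
    and aB: "\<And>b. b \<in> B' \<Longrightarrow> (\<Sum>j<N. a j * orbit_functional \<mu> m (X j) b) = 0" by auto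
  define L where "L f = (\<Sum>j<N. a j * orbit_functional \<mu> m (X j) f)" for f
  have Ladd: "L (f + c *\<^sub>C g) = L f + c * L g" for f g c
    unfolding L_def sum_distrib_left sum.distrib[symmetric]
    by (intro sum.cong refl) (simp add: orbit_functional_add_scaleC[OF so] algebra_simps)
  have L0: "L 0 = 0" using Ladd[of 0 1 0] by simp
  have Lsub: "complex_vs.subspace {f. L f = 0}"
    unfolding complex_vs.subspace_def using Ladd[of _ 1] Ladd[of 0] L0 by (auto simp: scaleC_one)
  have LT: "L (T f) = 0" for f
  proof -
    define c where "c i = (difference_quotient \<omega> ^^ i) (hardy2_fun f) \<omega>" for i
    define q where "q = (\<Sum>i<m. c i *\<^sub>C pw i)"
    define f0 where "f0 = f - q"
    have f0: "hardy2_fun f0 z = (z - \<omega>) ^ m * (difference_quotient \<omega> ^^ m) (hardy2_fun f) z" if "z \<in> unit_disc" for z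
      using difference_quotient_expansion[where f="hardy2_fun f" and z=z and m=m and a=\<omega>] that
      by (simp add: f0_def q_def hardy2_fun_diff hardy2_fun_sum hardy2_fun_scaleC pwf c_def)
    have "L (T f0) = 0"
      unfolding L_def T_def
      using orbit_functional_range[OF so \<mu>(1) iterated_difference_quotient_holomorphic[OF hardy2_fun_holomorphic open_ball] f0]
      by simp
    moreover have "L (T q) = 0"
    proof -
      have "T q = (\<Sum>i<m. c i *\<^sub>C T (pw i))"
        unfolding q_def module_hom.sum[OF module_hom_bounded_clinear[OF Tl]]
        by (simp add: bounded_clinearD(2)[OF Tl])
      moreover have "(\<Sum>i<m. c i *\<^sub>C T (pw i)) \<in> {f. L f = 0}"
        by (intro complex_vs.subspace_sum[OF Lsub] complex_vs.subspace_scale[OF Lsub])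
           (simp add: L_def aB B'_def)
      ultimately show ?thesis by simp
    qed
    moreover have "T f = T f0 + T q" by (simp add: f0_def bounded_clinearD(3)[OF Tl, symmetric])
    ultimately show ?thesis using Ladd[of "T f0" 1 "T q"] by (simp add: scaleC_one)
  qed
  have "range T \<union> B \<subseteq> {f. L f = 0}" using LT aB by (auto simp: L_def B'_def)
  then have "complex_vs.span (range T \<union> B) \<subseteq> {f. L f = 0}" by (rule complex_vs.span_minimal[OF _ Lsub])
  then have "L f = 0" for f using span by auto
  then have "a j0 = 0"
    unfolding L_def by (intro summing_orbits_independent[OF so \<mu>(1) dist _ j0(1)])
  then show False using j0(2) by simp
qed

text \<open>The boundary circle and the point \<open>0\<close> remain. A finite complement there
  would serve for all nearby parameters, among which are nonzero ones of smaller modulus than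
  \<open>1 / sqrt d\<close>.\<close>

lemma cokernel_inside:
  assumes \<mu>: "cmod \<mu> \<le> 1 / sqrt d" and B: "finite B"
  shows "complex_vs.span (range (\<lambda>f. composition_operator \<phi> f - \<mu> *\<^sub>C f) \<union> B) \<noteq> UNIV"
proof
  assume "complex_vs.span (range (\<lambda>f. composition_operator \<phi> f - \<mu> *\<^sub>C f) \<union> B) = UNIV"
  from range_shift_perturbed[OF bounded_clinear_composition_operator B this]
  obtain \<epsilon> where \<epsilon>: "\<epsilon> > 0" and span: "\<And>\<nu>. cmod (\<nu> - \<mu>) \<le> \<epsilon> \<Longrightarrow>
      complex_vs.span (range (\<lambda>f. composition_operator \<phi> f - \<nu> *\<^sub>C f) \<union> B) = UNIV" by metis
  have r: "1 / sqrt d > 0" using d_gt_1 by simp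
  have "\<exists>\<nu>. \<nu> \<noteq> 0 \<and> cmod \<nu> < 1 / sqrt d \<and> cmod (\<nu> - \<mu>) \<le> \<epsilon>"
  proof (cases "\<mu> = 0")
    case True
    define s where "s = min \<epsilon> (1 / sqrt d / 2)"
    have half: "y / 2 < y" if "y > 0" for y :: real using that by simp
    have "0 < s" "s \<le> \<epsilon>" using \<epsilon> r by (auto simp: s_def)
    moreover have "s < 1 / sqrt d"
      unfolding s_def by (rule le_less_trans[OF min.cobounded2 half[OF r]])
    ultimately show ?thesis using True by (intro exI[of _ "of_real s"]) auto
  next
    case False
    \<comment> \<open>Shrinking \<open>\<mu>\<close> by the factor \<open>1 - s\<close> moves it by
      at most \<open>\<epsilon>\<close> into the open disc; \<open>s < 1\<close> keeps it
      nonzero.\<close>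
    define s where "s = min (1/2) (\<epsilon> / cmod \<mu>)"
    have s: "0 < s" "s < 1" using \<epsilon> False by (auto simp: s_def)
    have "cmod (of_real (1 - s) * \<mu>) < 1 / sqrt d"
    proof -
      have "cmod (of_real (1 - s) * \<mu>) = (1 - s) * cmod \<mu>"
        using s unfolding norm_mult norm_of_real by simp
      also have "\<dots> < 1 * cmod \<mu>" using s False by (intro mult_strict_right_mono) auto
      finally show ?thesis using \<mu> by simp
    qed
    moreover have "cmod (of_real (1 - s) * \<mu> - \<mu>) \<le> \<epsilon>"
    proof -
      have "of_real (1 - s) * \<mu> - \<mu> = - (of_real s * \<mu>)" by (simp add: algebra_simps)
      then have "cmod (of_real (1 - s) * \<mu> - \<mu>) = s * cmod \<mu>" using s by (simp add: norm_mult)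
      also have "\<dots> \<le> \<epsilon> / cmod \<mu> * cmod \<mu>" by (intro mult_right_mono) (auto simp: s_def)
      finally show ?thesis using False by simp
    qed
    moreover have "of_real (1 - s) * \<mu> \<noteq> 0" using s False by simp
    ultimately show ?thesis by blast
  qed
  then show False using infinite_codimension[OF _ _ B] span by blast
qed

end

section \<open>Eigenvalues and the spectra\<close>

context repelling_map_fixed
begin

text \<open>Near \<open>\<omega>\<close> the function is \<open>h z * (z - \<omega>) ^ n\<close>
  with \<open>h \<omega> \<noteq> 0\<close>, and \<open>\<phi> z - \<omega>\<close> is
  asymptotically the multiplier times \<open>z - \<omega>\<close>. The order \<open>n\<close> and
  the coefficient do not depend on \<open>\<mu>\<close>, so one statement serves both eigenvalues
  and ranges.\<close>

lemma leading_term: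
  assumes f: "f \<noteq> 0"
  obtains n h0 where "h0 \<noteq> 0"
    "\<And>\<mu>. ((\<lambda>z. (hardy2_fun f (\<phi> z) - \<mu> * hardy2_fun f z) / (z - \<omega>) ^ n) \<longlongrightarrow> (deriv \<phi> \<omega> ^ n - \<mu>) * h0) (at \<omega>)"
proof -
  let ?F = "hardy2_fun f"
  define h where "h = zor_poly ?F \<omega>"
  define n where "n = nat (zorder ?F \<omega>)"
  have "\<exists>w\<in>unit_disc. ?F w \<noteq> 0"
  proof (rule ccontr)
    assume "\<not> ?thesis"
    then have "f = 0" by (intro hardy2_eqI) auto
    then show False using f by simp
  qed
  from zorder_exist_zero[OF hardy2_fun_holomorphic open_ball connected_ball fixed_point_inside this]
  obtain r where r: "r > 0" "h holomorphic_on cball \<omega> r"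
    and F: "\<And>w. w \<in> cball \<omega> r \<Longrightarrow> ?F w = h w * (w - \<omega>) ^ n \<and> h w \<noteq> 0"
    unfolding h_def n_def by blast
  have "h holomorphic_on ball \<omega> r" by (rule holomorphic_on_subset[OF r(2)]) auto
  then have hc: "isCont h \<omega>"
    using holomorphic_on_imp_continuous_on r(1) continuous_on_eq_continuous_at[OF open_ball, of \<omega> r h] by fastforce
  have h0: "h \<omega> \<noteq> 0" using F[of \<omega>] r by simp
  have \<phi>d: "(\<phi> has_field_derivative deriv \<phi> \<omega>) (at \<omega>)"
    by (rule holomorphic_derivI[OF hol open_ball fixed_point_inside])
  have q: "((\<lambda>z. (\<phi> z - \<omega>) / (z - \<omega>)) \<longlongrightarrow> deriv \<phi> \<omega>) (at \<omega>)"
    using \<phi>d unfolding has_field_derivative_iff by (simp add: fixed_point)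
  have \<phi>l: "(\<phi> \<longlongrightarrow> \<omega>) (at \<omega>)"
    using DERIV_isCont[OF \<phi>d] by (simp add: isCont_def fixed_point)
  have hl: "((\<lambda>z. h (\<phi> z)) \<longlongrightarrow> h \<omega>) (at \<omega>)" by (rule isCont_tendsto_compose[OF hc \<phi>l])
  show thesis
  proof (rule that[of "h \<omega>" n])
    fix \<mu>
    have "((\<lambda>z. ((\<phi> z - \<omega>) / (z - \<omega>)) ^ n * h (\<phi> z) - \<mu> * h z) \<longlongrightarrow> deriv \<phi> \<omega> ^ n * h \<omega> - \<mu> * h \<omega>) (at \<omega>)"
      using hc by (intro tendsto_intros q hl) (simp add: isCont_def)
    moreover have "\<forall>\<^sub>F z in at \<omega>. ((\<phi> z - \<omega>) / (z - \<omega>)) ^ n * h (\<phi> z) - \<mu> * h z =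
        (?F (\<phi> z) - \<mu> * ?F z) / (z - \<omega>) ^ n"
    proof -
      have e1: "\<forall>\<^sub>F z in at \<omega>. dist (\<phi> z) \<omega> < r" by (rule tendstoD[OF \<phi>l r(1)])
      have e2: "\<forall>\<^sub>F z in at \<omega>. dist z \<omega> < r" using r(1) by (auto simp: eventually_at)
      have e3: "\<forall>\<^sub>F z in at \<omega>. z \<noteq> \<omega>" by (simp add: eventually_at_filter)
      show ?thesis
        using e1 e2 e3
      proof eventually_elim
        case (elim z)
        have "?F (\<phi> z) = h (\<phi> z) * (\<phi> z - \<omega>) ^ n" "?F z = h z * (z - \<omega>) ^ n"
          using F[of "\<phi> z"] F[of z] elim by (auto simp: dist_commute)
        then show ?case using elim(3) by (simp add: power_divide diff_divide_distrib[of _ _ "(z - \<omega>) ^ n"] mult_ac)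
      qed
    qed
    ultimately have "((\<lambda>z. (?F (\<phi> z) - \<mu> * ?F z) / (z - \<omega>) ^ n) \<longlongrightarrow> deriv \<phi> \<omega> ^ n * h \<omega> - \<mu> * h \<omega>) (at \<omega>)"
      by (rule Lim_transform_eventually)
    then show "((\<lambda>z. (?F (\<phi> z) - \<mu> * ?F z) / (z - \<omega>) ^ n) \<longlongrightarrow> (deriv \<phi> \<omega> ^ n - \<mu>) * h \<omega>) (at \<omega>)"
      by (simp add: left_diff_distrib)
  qed (rule h0)
qed

lemma eventually_inside: "\<forall>\<^sub>F z in at \<omega>. z \<in> unit_disc \<and> z \<noteq> \<omega>"
  using fixed_point_inside eventually_at_in_open[of unit_disc \<omega>] by (auto elim: eventually_mono)

lemma eigenvalue_is_power:
  assumes "composition_operator \<phi> f = \<mu> *\<^sub>C f" "f \<noteq> 0"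
  shows "\<exists>n. \<mu> = deriv \<phi> \<omega> ^ n"
proof -
  obtain n h0 where h0: "h0 \<noteq> 0" and lim: "\<And>\<mu>. ((\<lambda>z. (hardy2_fun f (\<phi> z) - \<mu> * hardy2_fun f z) / (z - \<omega>) ^ n) \<longlongrightarrow> (deriv \<phi> \<omega> ^ n - \<mu>) * h0) (at \<omega>)"
    by (rule leading_term[OF assms(2)]) blast
  have "\<forall>\<^sub>F z in at \<omega>. (hardy2_fun f (\<phi> z) - \<mu> * hardy2_fun f z) / (z - \<omega>) ^ n = 0"
    using eventually_inside
  proof eventually_elim
    case (elim z)
    then show ?case using composition_operator_fun[of z f] assms(1) by (simp add: hardy2_fun_scaleC)
  qed
  from Lim_transform_eventually[OF lim this] have "(deriv \<phi> \<omega> ^ n - \<mu>) * h0 = 0"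
    by (rule tendsto_unique[OF at_neq_bot _ tendsto_const])
  then show ?thesis using h0 by (intro exI[of _ n]) simp
qed

text \<open>The power \<open>(z - \<omega>) ^ k\<close> is missing from the range. A preimage of
  order \<open>n = k\<close> would have its leading coefficient killed, one of order
  \<open>n < k\<close> would need equal \<open>n\<close>-th and \<open>k\<close>-th powers of the
  multiplier, and one of order \<open>n > k\<close> would vanish too fast. In the middle case
  \<open>k > 0\<close>, so the multiplier is nonzero and its powers strictly decrease in
  modulus.\<close>

lemma power_not_surjective:
  assumes k: "k = 0 \<or> deriv \<phi> \<omega> \<noteq> 0"
  shows "\<not> surj (\<lambda>f. composition_operator \<phi> f - deriv \<phi> \<omega> ^ k *\<^sub>C f)"
proof
  let ?m = "deriv \<phi> \<omega>"
  assume "surj (\<lambda>f. composition_operator \<phi> f - ?m ^ k *\<^sub>C f)"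
  from surjD[OF this, of "hardy2_of (\<lambda>z. (z - \<omega>) ^ k)"] obtain f where
    f: "composition_operator \<phi> f - ?m ^ k *\<^sub>C f = hardy2_of (\<lambda>z. (z - \<omega>) ^ k)"
    by (elim exE) (erule meta_allE, erule meta_mp, erule sym)
  have eq: "hardy2_fun f (\<phi> z) - ?m ^ k * hardy2_fun f z = (z - \<omega>) ^ k" if z: "z \<in> unit_disc" for z
    using arg_cong[OF f, of "\<lambda>g. hardy2_fun g z"] hardy2_of_shifted_power[OF z]
    by (simp add: hardy2_fun_diff hardy2_fun_scaleC composition_operator_fun[OF z])
  have "f \<noteq> 0"
  proof
    assume "f = 0"
    then have pz: "(z - \<omega>) ^ k = 0" if "z \<in> unit_disc" for z using eq[OF that] by simp
    have "\<forall>\<^sub>F z in at \<omega>. False"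
      using eventually_inside
    proof eventually_elim
      case (elim z)
      then show False using pz[of z] by auto
    qed
    then show False by (simp add: eventually_False)
  qed
  obtain n h0 where h0: "h0 \<noteq> 0" and lim: "\<And>\<mu>. ((\<lambda>z. (hardy2_fun f (\<phi> z) - \<mu> * hardy2_fun f z) / (z - \<omega>) ^ n) \<longlongrightarrow> (?m ^ n - \<mu>) * h0) (at \<omega>)"
    by (rule leading_term[OF \<open>f \<noteq> 0\<close>]) blast
  define L where "L = (?m ^ n - ?m ^ k) * h0"
  have "\<forall>\<^sub>F z in at \<omega>. (hardy2_fun f (\<phi> z) - ?m ^ k * hardy2_fun f z) / (z - \<omega>) ^ n = (z - \<omega>) ^ k / (z - \<omega>) ^ n"
    using eventually_inside by eventually_elim (simp add: eq)
  from Lim_transform_eventually[OF lim this]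
  have L: "((\<lambda>z. (z - \<omega>) ^ k / (z - \<omega>) ^ n) \<longlongrightarrow> L) (at \<omega>)" by (simp add: L_def)
  have zl: "((\<lambda>z. (z - \<omega>) ^ j) \<longlongrightarrow> 0) (at \<omega>)" if "j > 0" for j
  proof -
    have "((\<lambda>z. (z - \<omega>) ^ j) \<longlongrightarrow> (\<omega> - \<omega>) ^ j) (at \<omega>)" by (intro tendsto_intros)
    then show ?thesis using that by (simp add: zero_power)
  qed
  consider "n = k" | "n < k" | "k < n" by linarith
  then show False
  proof cases
    case 1
    have "\<forall>\<^sub>F z in at \<omega>. (z - \<omega>) ^ k / (z - \<omega>) ^ n = 1"
      using eventually_inside by eventually_elim (simp add: 1)
    from Lim_transform_eventually[OF L this] have "L = 1"
      by (rule tendsto_unique[OF at_neq_bot _ tendsto_const])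
    then show False using 1 by (simp add: L_def)
  next
    case 2
    have "\<forall>\<^sub>F z in at \<omega>. (z - \<omega>) ^ (k - n) = (z - \<omega>) ^ k / (z - \<omega>) ^ n"
      using eventually_inside by eventually_elim (use 2 in \<open>simp add: power_diff\<close>)
    from Lim_transform_eventually[OF zl this] have "((\<lambda>z. (z - \<omega>) ^ k / (z - \<omega>) ^ n) \<longlongrightarrow> 0) (at \<omega>)" using 2 by simp
    then have "L = 0" using tendsto_unique[OF at_neq_bot L] by blast
    then have "?m ^ n = ?m ^ k" using h0 by (simp add: L_def)
    then have "cmod ?m ^ n = cmod ?m ^ k" by (metis norm_power)
    moreover have "cmod ?m > 0" using k 2 by auto
    then have "cmod ?m ^ k < cmod ?m ^ n" using 2 multiplier_less_1 by (intro power_strict_decreasing) auto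
    ultimately show False by simp
  next
    case 3
    have "((\<lambda>z. (z - \<omega>) ^ (n - k) * ((z - \<omega>) ^ k / (z - \<omega>) ^ n)) \<longlongrightarrow> 0 * L) (at \<omega>)"
      by (intro tendsto_mult L zl) (use 3 in simp)
    moreover have "\<forall>\<^sub>F z in at \<omega>. (z - \<omega>) ^ (n - k) * ((z - \<omega>) ^ k / (z - \<omega>) ^ n) = 1"
      using eventually_inside by eventually_elim (use 3 in \<open>simp flip: power_add\<close>)
    ultimately have "((\<lambda>z. 1) \<longlongrightarrow> 0 * L) (at \<omega>)"
      by (rule Lim_transform_eventually)
    then have "0 * L = 1" by (rule tendsto_unique[OF at_neq_bot _ tendsto_const])
    then show False by simp
  qed
qed

text \<open>Outside the closed disc a failure of invertibility is a failure of injectivity, hence an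
  eigenvalue and a power of the multiplier; exponents from \<open>N\<close> on lie in the disc.
  Conversely, every point of the claimed sets is detected by a defect of the range.\<close>

lemma spectra:
  fixes r :: real and N :: nat
  defines "r \<equiv> d powr (- 1 / 2)"
  assumes N: "N = (LEAST n. 0 < n \<and> cmod (deriv \<phi> \<omega>) ^ n \<le> r)"
  shows "spectrum (composition_operator \<phi>) = {z. cmod z \<le> r} \<union> {deriv \<phi> \<omega> ^ n | n. n < N}"
    and "essential_spectrum (composition_operator \<phi>) = {z. cmod z \<le> r}"
proof -
  let ?C = "composition_operator \<phi>" and ?m = "deriv \<phi> \<omega>"
  have d0: "d > 0" using d_gt_1 by simp
  have half: "- 1 / 2 = - (1 / 2 :: real)" by simp
  have rd: "r = 1 / sqrt d"
    unfolding r_def half powr_minus_divide using d0 by (simp only: powr_half_sqrt)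
  have r0: "r > 0" using d0 by (simp add: rd)
  have inside: "complex_vs.span (range (\<lambda>f. ?C f - \<mu> *\<^sub>C f) \<union> B) \<noteq> UNIV" if "cmod \<mu> \<le> r" "finite B" for \<mu> B
    using cokernel_inside that by (simp add: rd)
  have inv_surj: "surj T" if "invertible_operator T" for T :: "hardy2 \<Rightarrow> hardy2"
    using that unfolding invertible_operator_def by (metis comp_apply id_apply surjI)
  obtain n0 where "cmod ?m ^ n0 < r" using real_arch_pow_inv[OF r0 multiplier_less_1] by blast
  moreover have "cmod ?m ^ Suc n0 \<le> cmod ?m ^ n0" using multiplier_less_1 by (intro power_decreasing) auto
  \<comment> \<open>The successor supplies the positive exponent that the \<open>LEAST\<close>
    condition demands; \<open>n0\<close> itself may be \<open>0\<close>.\<close>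
  ultimately have "0 < Suc n0 \<and> cmod ?m ^ Suc n0 \<le> r" by simp
  then have Nr: "cmod ?m ^ N \<le> r"
    unfolding N by (rule LeastI2) simp
  show "essential_spectrum ?C = {z. cmod z \<le> r}"
  proof (intro set_eqI iffI)
    fix \<mu> assume "\<mu> \<in> essential_spectrum ?C"
    then show "\<mu> \<in> {z. cmod z \<le> r}"
      using fredholm_outside(1)[of \<mu>] by (auto simp: essential_spectrum_def rd not_le[symmetric])
  next
    fix \<mu> assume "\<mu> \<in> {z. cmod z \<le> r}"
    then show "\<mu> \<in> essential_spectrum ?C"
      using inside[of \<mu>] by (auto simp: essential_spectrum_def fredholm_def)
  qed
  show "spectrum ?C = {z. cmod z \<le> r} \<union> {?m ^ n | n. n < N}"
  proof (intro set_eqI iffI)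
    fix \<mu> assume \<mu>: "\<mu> \<in> spectrum ?C"
    show "\<mu> \<in> {z. cmod z \<le> r} \<union> {?m ^ n | n. n < N}"
    proof (cases "cmod \<mu> \<le> r")
      case False
      then have "\<not> inj (\<lambda>f. ?C f - \<mu> *\<^sub>C f)"
        using \<mu> fredholm_outside(2)[of \<mu>] by (auto simp: spectrum_def rd)
      then obtain f g where fg: "?C f - \<mu> *\<^sub>C f = ?C g - \<mu> *\<^sub>C g" "f \<noteq> g" unfolding inj_def by blast
      have "?C (f - g) = \<mu> *\<^sub>C (f - g)"
        using fg(1) by (simp add: bounded_clinearD(4)[OF bounded_clinear_composition_operator]
            complex_vs.scale_right_diff_distrib algebra_simps)
      then obtain n where n: "\<mu> = ?m ^ n" using eigenvalue_is_power[of "f - g" \<mu>] fg(2) by auto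
      have "n < N"
      proof (rule ccontr)
        assume "\<not> n < N"
        then have "cmod ?m ^ n \<le> cmod ?m ^ N" using multiplier_less_1 by (intro power_decreasing) auto
        then show False using Nr False n by (simp add: norm_power)
      qed
      then show ?thesis using n by blast
    qed simp
  next
    fix \<mu> assume "\<mu> \<in> {z. cmod z \<le> r} \<union> {?m ^ n | n. n < N}"
    then consider "cmod \<mu> \<le> r" | n where "\<mu> = ?m ^ n" "\<not> cmod \<mu> \<le> r" by blast
    then have "\<not> surj (\<lambda>f. ?C f - \<mu> *\<^sub>C f)"
    proof cases
      case 1
      then show ?thesis using inside[of \<mu> "{}"] by auto
    next
      case 2
      \<comment> \<open>A power outside the disc is nonzero because \<open>r > 0\<close>; so a
        positive exponent forces a nonzero multiplier.\<close>
      have "n = 0 \<or> ?m \<noteq> 0" using 2 r0 by (cases n) auto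
      then show ?thesis using power_not_surjective 2(1) by simp
    qed
    then show "\<mu> \<in> spectrum ?C" using inv_surj by (auto simp: spectrum_def)
  qed
qed

end

theorem theorem4p2:
  fixes \<phi> :: "complex \<Rightarrow> complex" and \<omega> :: complex and d :: real and N :: nat
  assumes "essentially_linear_fractional \<phi>"
    and "has_boundary_value \<phi> 1 1"
    and "has_boundary_value (deriv \<phi>) 1 (complex_of_real d)"
    and "d > 1"
    and "denjoy_wolff_point \<phi> \<omega>"
    and "N = (LEAST n. 0 < n \<and> cmod (deriv \<phi> \<omega>) ^ n \<le> d powr (- 1 / 2))"
  shows "\<omega> \<in> unit_disc \<and>
    spectrum (composition_operator \<phi>) =
      {z. cmod z \<le> d powr (- 1 / 2)} \<union> {deriv \<phi> \<omega> ^ n | n. n < N} \<and>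
    essential_spectrum (composition_operator \<phi>) = {z. cmod z \<le> d powr (- 1 / 2)}"
proof -
  interpret repelling_map_fixed \<phi> d \<omega>
    by unfold_locales (fact assms)+
  show ?thesis using fixed_point_inside spectra[OF assms(6)] by blast
qed

end
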